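(* Consider the four-vortex collinear relative equilibria with circulations $\Gamma_1=\Gamma_2=\Gamma_3=1$ and $\Gamma_4=m$. Let $$\Psi(m)=64m^6+320m^5+96m^4-220m^3+505m^2+522m+9,$$ and let $m^{\ast}<m_c$ be the two real roots of $\Psi$ in $(-1,0)$, so $m^\ast\approx-0.8564136$ and $m_c\approx -0.0175413$. The linear stability and nontrivial eigenvalue structure are as follows. (i) The solutions from Group I are linearly stable for $-1<m<m^{\ast}$, spectrally stable at $m=m^{\ast}$, and unstable for $m>m^{\ast}$. (ii) For $m>m_c$, the nontrivial eigenvalues for the Group I solutions consist of two real pairs, and at $m=m_c$ these pairs merge to form a real pair with multiplicity two. As $m\to\infty$, the nontrivial normalized Group I eigenvalues approach $\pm 2\sqrt6$ and $\pm 2\sqrt2$. For $m^{\ast}<m<m_c$, the nontrivial eigenvalues form a complex quartuplet $\pm\alpha\pm i\beta$. As $m\to -1^+$, the nontrivial normalized eigenvalues approach $0,0,\pm i$. (iii) The solutions from Group II (which exist for $m>-1/2$) are always unstable, with two real pairs of nontrivial normalized eigenvalues $\pm\lambda_1,\pm\lambda_2$. As $m\to -1/2^{+}$, $\lambda_1\to\infty$ and $\lambda_2\to 2\sqrt{14}/5$. As $m\to\infty$, $\lambda_1\to 2\sqrt2$ and $\lambda_2\to 0$. (Here $\lambda_1,\lambda_2$ denote the positive members of the pairs.)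
   Context: Relative equilibria: distinct positions $z_i\in\mathbb{R}^2$ with $-\omega(z_i-c)=\sum_{j\ne i}\frac{\Gamma_j}{r_{ij}^2}(z_j-z_i)$ for $i=1,\dots,4$, where $r_{ij}=\|z_i-z_j\|$, $\omega\neq0$ is the angular velocity and $c=\frac{1}{\Gamma}\sum_i\Gamma_i z_i$, $\Gamma=\sum_i \Gamma_i$, is the center of vorticity. Configurations are identified under rotation, scaling and translation. A collinear relative equilibrium is normalized as $z_i=(x_i,0)$ with $x_1=-1,x_2=1$; its ordering $(i\,j\,k\,l)$ means $x_i<x_j<x_k<x_l$. Group I consists of the solutions with orderings $(1\,2\,3\,4),(4\,3\,1\,2),(4\,1\,2\,3),(1\,3\,2\,4),(3\,1\,2\,4),(4\,1\,3\,2)$ (vortex 4 exterior to the other three); Group II of those with orderings $(1\,2\,4\,3),(3\,4\,1\,2),(1\,4\,2\,3),(1\,3\,4\,2),(3\,1\,4\,2),(1\,4\,3\,2)$ (vortex 4 between two equal-strength vortices). For each $m>-1$ there is exactly one solution for each Group I ordering; for each $m>-1/2$ there is exactly one solution for each Group II ordering. Stability (in the full plane): translate the solution $z_0$ so that $c=0$. With $H=-\sum_{i<j}\Gamma_i\Gamma_j\ln r_{ij}$, $M=\mathrm{diag}\{\Gamma_1,\Gamma_1,\dots,\Gamma_4,\Gamma_4\}$ and $K$ the $8\times8$ block-diagonal matrix with blocks $J=\begin{bmatrix}0&1\\-1&0\end{bmatrix}$, the scaled stability matrix is $\omega^{-1}B=K(\omega^{-1}M^{-1}D^2H(z_0)+I)$.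 For a collinear solution, in coordinates $(x_1,\dots,x_4,y_1,\dots,y_4)$, $$\omega^{-1}M^{-1}D^2H(z_0)=\begin{bmatrix}A&0\\0&-A\end{bmatrix},\quad A_{ij}=-\omega^{-1}\Gamma_j r_{ij}^{-2}\ (i\ne j),\quad A_{ii}=-\sum_{j\neq i}A_{ij},$$ so that $\omega^{-1}B=\begin{bmatrix}0&I-A\\-(I+A)&0\end{bmatrix}$ (this form is used also when $m=0$). The eigenvalues of $\omega^{-1}B$ are called normalized eigenvalues; they always include the four trivial ones $0,0,\pm i$, and the remaining four (with multiplicity) are the nontrivial (normalized) eigenvalues. Let $V=\mathrm{span}\{z_0,Kz_0\}$ and $V^\perp=\{w\in\mathbb{R}^8: w^TMv=0\ \forall v\in V\}$, which is invariant under $\omega^{-1}B$. A relative equilibrium is nondegenerate if the nontrivial eigenvalues are nonzero. A nondegenerate relative equilibrium is spectrally stable if the nontrivial eigenvalues lie on the imaginary axis, and linearly stable if, in addition, the restriction of $\omega^{-1}B$ to $V^\perp$ has a block-diagonal (real) Jordan form with blocks $\begin{bmatrix}0&\beta_i\\-\beta_i&0\end{bmatrix}$. It is unstable if some nontrivial eigenvalue is not on the imaginary axis. A complex quartuplet $\pm\alpha\pm i\beta$ means four eigenvalues with $\alpha,\beta$ real and nonzero. *)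

theory Defs
  imports
    "HOL-Analysis.Product_Vector"
    "HOL-Computational_Algebra.Fundamental_Theorem_Algebra"
    "Jordan_Normal_Form.Char_Poly"
begin

text \<open>Vortices are numbered 1 to 4. The values of \<open>\<Gamma>\<close>, \<open>z\<close> and \<open>x\<close> at other indices are
  irrelevant.\<close>

definition center_of_vorticity :: "(nat \<Rightarrow> real) \<Rightarrow> (nat \<Rightarrow> real \<times> real) \<Rightarrow> real \<times> real" where
  "center_of_vorticity \<Gamma> z = (1 / (\<Sum>i\<in>{1..4}. \<Gamma> i)) *\<^sub>R (\<Sum>i\<in>{1..4}. \<Gamma> i *\<^sub>R z i)"

definition relative_equilibrium ::
    "(nat \<Rightarrow> real) \<Rightarrow> real \<Rightarrow> (nat \<Rightarrow> real \<times> real) \<Rightarrow> bool" where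
  "relative_equilibrium \<Gamma> \<omega> z \<longleftrightarrow>
     \<omega> \<noteq> 0 \<and> inj_on z {1..4} \<and>
     (\<forall>i\<in>{1..4}. - \<omega> *\<^sub>R (z i - center_of_vorticity \<Gamma> z) =
        (\<Sum>j\<in>{1..4} - {i}. (\<Gamma> j / (dist (z i) (z j))\<^sup>2) *\<^sub>R (z j - z i)))"

definition circ :: "real \<Rightarrow> nat \<Rightarrow> real" where
  "circ m j = (if j = 4 then m else 1)"

definition collinear_re :: "real \<Rightarrow> real \<Rightarrow> (nat \<Rightarrow> real) \<Rightarrow> bool" where
  "collinear_re m \<omega> x \<longleftrightarrow>
     relative_equilibrium (circ m) \<omega> (\<lambda>i. (x i, 0)) \<and> x 1 = - 1 \<and> x 2 = 1"

definition has_ordering :: "(nat \<Rightarrow> real) \<Rightarrow> nat list \<Rightarrow> bool" where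
  "has_ordering x p \<longleftrightarrow> sorted_wrt (<) (map x p)"

definition group_I_orderings :: "nat list set" where
  "group_I_orderings =
     {[1,2,3,4], [4,3,1,2], [4,1,2,3], [1,3,2,4], [3,1,2,4], [4,1,3,2]}"

definition group_II_orderings :: "nat list set" where
  "group_II_orderings =
     {[1,2,4,3], [3,4,1,2], [1,4,2,3], [1,3,4,2], [3,1,4,2], [1,4,3,2]}"

definition group_I_solution :: "real \<Rightarrow> real \<Rightarrow> (nat \<Rightarrow> real) \<Rightarrow> bool" where
  "group_I_solution m \<omega> x \<longleftrightarrow> collinear_re m \<omega> x \<and> (\<exists>p\<in>group_I_orderings. has_ordering x p)"

definition group_II_solution :: "real \<Rightarrow> real \<Rightarrow> (nat \<Rightarrow> real) \<Rightarrow> bool" where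
  "group_II_solution m \<omega> x \<longleftrightarrow> collinear_re m \<omega> x \<and> (\<exists>p\<in>group_II_orderings. has_ordering x p)"

text \<open>Matrices are indexed from 0, so vortex \<open>i\<close> corresponds to row \<open>i - 1\<close>. Vectors of dimension 8
  use the coordinates \<open>(x\<^sub>1, \<dots>, x\<^sub>4, y\<^sub>1, \<dots>, y\<^sub>4)\<close>.\<close>

definition A_offdiag :: "real \<Rightarrow> real \<Rightarrow> (nat \<Rightarrow> real) \<Rightarrow> nat \<Rightarrow> nat \<Rightarrow> real" where
  "A_offdiag m \<omega> x i j = - (1 / \<omega>) * circ m j / (dist (x i, 0::real) (x j, 0))\<^sup>2"

definition A_mat :: "real \<Rightarrow> real \<Rightarrow> (nat \<Rightarrow> real) \<Rightarrow> real mat" where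
  "A_mat m \<omega> x = mat 4 4 (\<lambda>(i, j).
     if i \<noteq> j then A_offdiag m \<omega> x (i + 1) (j + 1)
     else - (\<Sum>k\<in>{1..4} - {i + 1}. A_offdiag m \<omega> x (i + 1) k))"

text \<open>\<open>\<omega>\<^sup>-\<^sup>1 M\<^sup>-\<^sup>1 D\<^sup>2H\<close> at a collinear configuration, for
  \<open>H = - (\<Sum>i<j. \<Gamma>\<^sub>i \<Gamma>\<^sub>j ln r\<^sub>i\<^sub>j)\<close>; the factor \<open>\<Gamma>\<^sub>i\<close> has cancelled, so the formula makes sense
  for \<open>m = 0\<close> as well.\<close>

definition scaled_hessian :: "real \<Rightarrow> real \<Rightarrow> (nat \<Rightarrow> real) \<Rightarrow> real mat" where
  "scaled_hessian m \<omega> x =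
     four_block_mat (A_mat m \<omega> x) (0\<^sub>m 4 4) (0\<^sub>m 4 4) (- A_mat m \<omega> x)"

text \<open>The block-diagonal matrix with blocks \<open>[[0, 1], [-1, 0]]\<close>, in the coordinates above.\<close>

definition K_mat :: "real mat" where
  "K_mat = four_block_mat (0\<^sub>m 4 4) (1\<^sub>m 4) (- 1\<^sub>m 4) (0\<^sub>m 4 4)"

definition stability_matrix :: "real \<Rightarrow> real \<Rightarrow> (nat \<Rightarrow> real) \<Rightarrow> real mat" where
  "stability_matrix m \<omega> x = K_mat * (scaled_hessian m \<omega> x + 1\<^sub>m 8)"

lemma stability_matrix_blocks:
  "stability_matrix m \<omega> x =
     four_block_mat (0\<^sub>m 4 4) (1\<^sub>m 4 - A_mat m \<omega> x) (- (1\<^sub>m 4 + A_mat m \<omega> x)) (0\<^sub>m 4 4)"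
proof -
  let ?A = "A_mat m \<omega> x"
  have A: "?A \<in> carrier_mat 4 4" by (simp add: A_mat_def)
  have "scaled_hessian m \<omega> x + 1\<^sub>m 8 = four_block_mat (?A + 1\<^sub>m 4) (0\<^sub>m 4 4) (0\<^sub>m 4 4) (1\<^sub>m 4 - ?A)"
    by (rule eq_matI) (use A in \<open>auto simp: scaled_hessian_def\<close>)
  then show ?thesis
    unfolding stability_matrix_def K_mat_def
    apply (simp only:)
    apply (subst mult_four_block_mat[of _ 4 4 _ 4 _ 4 _ _ 4 _ 4])
    using A by (auto simp: comm_add_mat[of ?A 4 4] intro!: arg_cong2[where f = "\<lambda>a b. four_block_mat (0\<^sub>m 4 4) a b (0\<^sub>m 4 4)"])
qed

text \<open>Multisets are used throughout because eigenvalues are counted with (algebraic)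
  multiplicity.\<close>

definition nontrivial_eigenvalues :: "real \<Rightarrow> real \<Rightarrow> (nat \<Rightarrow> real) \<Rightarrow> complex multiset" where
  "nontrivial_eigenvalues m \<omega> x =
     proots (char_poly (map_mat complex_of_real (stability_matrix m \<omega> x))) - {#0, 0, \<i>, - \<i>#}"

definition nondegenerate :: "real \<Rightarrow> real \<Rightarrow> (nat \<Rightarrow> real) \<Rightarrow> bool" where
  "nondegenerate m \<omega> x \<longleftrightarrow> (\<forall>\<mu>\<in>#nontrivial_eigenvalues m \<omega> x. \<mu> \<noteq> 0)"

definition spectrally_stable :: "real \<Rightarrow> real \<Rightarrow> (nat \<Rightarrow> real) \<Rightarrow> bool" where
  "spectrally_stable m \<omega> x \<longleftrightarrow>
     nondegenerate m \<omega> x \<and> (\<forall>\<mu>\<in>#nontrivial_eigenvalues m \<omega> x. Re \<mu> = 0)"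

definition unstable :: "real \<Rightarrow> real \<Rightarrow> (nat \<Rightarrow> real) \<Rightarrow> bool" where
  "unstable m \<omega> x \<longleftrightarrow> (\<exists>\<mu>\<in>#nontrivial_eigenvalues m \<omega> x. Re \<mu> \<noteq> 0)"

text \<open>The configuration translated so that its center of vorticity is the origin.\<close>

definition z0_vec :: "real \<Rightarrow> (nat \<Rightarrow> real) \<Rightarrow> real vec" where
  "z0_vec m x = vec 8 (\<lambda>k.
     if k < 4 then x (k + 1) - fst (center_of_vorticity (circ m) (\<lambda>i. (x i, 0))) else 0)"

definition M_mat :: "real \<Rightarrow> real mat" where
  "M_mat m = mat 8 8 (\<lambda>(i, j). if i = j then circ m (i mod 4 + 1) else 0)"

definition V_space :: "real \<Rightarrow> (nat \<Rightarrow> real) \<Rightarrow> real vec set" where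
  "V_space m x = {a \<cdot>\<^sub>v z0_vec m x + b \<cdot>\<^sub>v (K_mat *\<^sub>v z0_vec m x) | a b. True}"

definition V_perp :: "real \<Rightarrow> (nat \<Rightarrow> real) \<Rightarrow> real vec set" where
  "V_perp m x = {w \<in> carrier_vec 8. \<forall>v\<in>V_space m x. w \<bullet> (M_mat m *\<^sub>v v) = 0}"

definition rotation_block :: "real \<Rightarrow> real mat" where
  "rotation_block \<beta> = mat_of_rows_list 2 [[0, \<beta>], [- \<beta>, 0]]"

text \<open>The columns of \<open>P\<close> form a basis of \<open>V_perp\<close> in which the restriction of the stability matrix
  is represented by the block-diagonal matrix with blocks \<open>[[0, \<beta>], [-\<beta>, 0]]\<close>, \<open>\<beta>\<close> in \<open>\<beta>s\<close>.\<close>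

definition linearly_stable :: "real \<Rightarrow> real \<Rightarrow> (nat \<Rightarrow> real) \<Rightarrow> bool" where
  "linearly_stable m \<omega> x \<longleftrightarrow>
     spectrally_stable m \<omega> x \<and>
     (\<exists>\<beta>s P. P \<in> carrier_mat 8 (2 * length \<beta>s) \<and>
        bij_betw (\<lambda>c. P *\<^sub>v c) (carrier_vec (2 * length \<beta>s)) (V_perp m x) \<and>
        stability_matrix m \<omega> x * P = P * diag_block_mat (map rotation_block \<beta>s))"

definition real_pairs :: "real \<Rightarrow> real \<Rightarrow> complex multiset" where
  "real_pairs a b = {#complex_of_real a, - complex_of_real a, complex_of_real b, - complex_of_real b#}"

definition \<Psi> :: "real \<Rightarrow> real" where
  "\<Psi> m = 64 * m ^ 6 + 320 * m ^ 5 + 96 * m ^ 4 - 220 * m ^ 3 + 505 * m ^ 2 + 522 * m + 9"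

end

theory Submission
  imports Defs "HOL-Real_Asymp.Real_Asymp"
begin

text \<open>Put vortex 4 at the origin, let \<open>e1, e2, e3\<close> be the elementary symmetric functions of the other
  three positions and \<open>c\<close> the center of vorticity. The equations of motion are equivalent to four
  polynomial relations between \<open>e1, e2, e3, c, \<omega>\<close>, which force the scale-invariant quantity
  \<open>v = e1 / (\<omega> * e3)\<close> to be a root of a quadratic polynomial with coefficients depending on \<open>m\<close>. Group I
  corresponds to its root in \<open>(0, 3 / (m + 2))\<close> (the upper bound is Newton's inequality
  \<open>e2\<^sup>2 \<ge> 3 * e1 * e3\<close>), Group II to its negative root.

  The matrix \<open>A\<close> becomes explicit in the basis \<open>1, y, y\<^sup>2\<close>, indicator of vortex 4. Besides the trivial
  eigenvalues \<open>0, 1\<close> it has two eigenvalues \<open>\<mu>\<close> whose sum and product are affine in \<open>n = (1 - m) * v\<close>, and the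
  nontrivial eigenvalues of the stability matrix are \<open>\<plusminus> sqrt (\<mu>\<^sup>2 - 1)\<close>. Eliminating \<open>n\<close> from the quadratic equation
  and the discriminant of the pair \<open>\<mu>\<close> gives exactly \<open>\<Psi>\<close>, so that the sign of \<open>\<Psi>\<close> decides between real and
  complex \<open>\<mu>\<close>, and \<open>1 - (\<mu>\<^sub>1 + \<mu>\<^sub>2) + \<mu>\<^sub>1 * \<mu>\<^sub>2 > 0\<close> always puts real \<open>\<mu>\<close> on the same side of 1.\<close>

subsection \<open>Eigenvalues in terms of the shape parameter\<close>

text \<open>The delicate range is -1 < m < -1/2. There \<open>shape_poly\<close> is concave in v and
  has a second positive root beyond 3 / (m + 2), so Newton's bound is what singles out the Group I
  root. Bounds for v are obtained without square roots, from the sign of \<open>shape_poly\<close>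
  at two test points: the v for which one of the two eigenvalues equals 1, and the v for which their
  sum equals 2. The sum decides the side of 1 on which a real pair lies. On Group I it passes
  through 2 only while the pair is complex, so crude rational thresholds for m suffice. The shift
  from mu to mu^2 - 1 comes from the off-diagonal block form of the stability matrix: its
  characteristic polynomial at l is det (t - A) * det (t + A) for t^2 = l^2 + 1. Only v enters the
  nontrivial eigenvalues. They are therefore functions of m alone, shared by all orderings of a
  group, without any appeal to uniqueness of the configurations.\<close>

definition shape_poly :: "real \<Rightarrow> real \<Rightarrow> real" where
  "shape_poly m v = (m + 2) * (m + 3) * (1 + 2 * m) * v\<^sup>2 + (1 - m) * (4 * m + 9) * v - 6 * (m + 3)"

definition mu_sum :: "real \<Rightarrow> real \<Rightarrow> real" where
  "mu_sum m v = 5 - (1 - m) * v"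

definition mu_prod :: "real \<Rightarrow> real \<Rightarrow> real" where
  "mu_prod m v = 6 - 3 * (m + 2) * ((1 - m) * v) / (m + 3)"

definition mu_disc :: "real \<Rightarrow> real \<Rightarrow> real" where
  "mu_disc m v = (mu_sum m v)\<^sup>2 - 4 * mu_prod m v"

definition root_I :: "real \<Rightarrow> real \<Rightarrow> bool" where
  "root_I m v \<longleftrightarrow> 0 < v \<and> v < 3 / (m + 2) \<and> shape_poly m v = 0"

definition root_II :: "real \<Rightarrow> real \<Rightarrow> bool" where
  "root_II m v \<longleftrightarrow> v < 0 \<and> shape_poly m v = 0"

lemma mu_disc_alt:
  assumes "m > -3"
  shows "mu_disc m v = ((1 - m) * v)\<^sup>2 - 2 * (3 - m) / (3 + m) * ((1 - m) * v) + 1"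
  using assms unfolding mu_disc_def mu_sum_def mu_prod_def
  by (simp add: field_simps power2_eq_square)

text \<open>The resultant of the two quadratics in n is p^2 times the right-hand side, and the
  factor beside h is a Bezout cofactor, affine in n. Hence h has the sign of the right-hand side
  wherever that cofactor is positive, and no root formula is involved.\<close>

lemma elimination_identity:
  fixes a b c h n p q :: real
  assumes g: "p * a * n\<^sup>2 + b * n - p * c = 0" and h: "p * h = p * n\<^sup>2 - 2 * q * n + p" and p: "p \<noteq> 0"
  shows "h * (p\<^sup>2 * a * (a + c) + (b + 2 * q * a) * (b + p * a * n)) =
     p\<^sup>2 * (a + c)\<^sup>2 + b\<^sup>2 + 2 * q * b * (a - c) - 4 * q\<^sup>2 * a * c" (is "h * ?K = ?R")
proof -
  have "(p * n\<^sup>2 - 2 * q * n + p) * ?K - p * ?R =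
    (p * a * n\<^sup>2 + b * n - p * c) * ((b + 2 * q * a) * p * n + p\<^sup>2 * (a + c) - 2 * q * (b + 2 * q * a))"
    by (simp add: algebra_simps eval_nat_numeral)
  hence "p * (h * ?K) = p * ?R"
    unfolding g h[symmetric] by (simp add: mult.assoc)
  thus ?thesis using p by simp
qed

text \<open>The origin of the sextic: this is the right-hand side of
  \<open>elimination_identity\<close> for p = m + 3, q = 3 - m and the coefficients of (1 - m)^2 *
  \<open>shape_poly\<close>, rewritten in n = (1 - m) * v.\<close>

lemma Psi_resultant:
  "(m + 3)\<^sup>2 * ((m + 2) * (1 + 2 * m) + 6 * (1 - m)\<^sup>2)\<^sup>2 + ((1 - m)\<^sup>2 * (4 * m + 9))\<^sup>2
     + 2 * (3 - m) * ((1 - m)\<^sup>2 * (4 * m + 9)) * ((m + 2) * (1 + 2 * m) - 6 * (1 - m)\<^sup>2)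
     - 4 * (3 - m)\<^sup>2 * ((m + 2) * (1 + 2 * m)) * (6 * (1 - m)\<^sup>2) = \<Psi> m"
  unfolding \<Psi>_def by (simp add: algebra_simps eval_nat_numeral)

section \<open>Sign tests that locate the roots of the shape polynomial\<close>

lemma shape_poly_chord:
  "(b - a) * shape_poly m x = (b - x) * shape_poly m a + (x - a) * shape_poly m b
     - (m + 2) * (m + 3) * (1 + 2 * m) * ((b - a) * (b - x) * (x - a))"
  unfolding shape_poly_def by (simp add: algebra_simps power2_eq_square)

text \<open>Excludes equality in Newton's bound. As the polynomial is negative at 0, it also anchors
  the concavity arguments for m < -1/2.\<close>

lemma shape_poly_bound: assumes "m > -1" shows "shape_poly m (3 / (m + 2)) > 0"
proof -
  define w where "w = 3 / (m + 2)"
  have w: "(m + 2) * w = 3" using assms by (simp add: w_def field_simps)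
  have "(m + 2) * shape_poly m w =
      (m + 3) * (1 + 2 * m) * ((m + 2) * w)\<^sup>2 + (1 - m) * (4 * m + 9) * ((m + 2) * w) - 6 * (m + 2) * (m + 3)"
    unfolding shape_poly_def by (simp add: algebra_simps power2_eq_square)
  also have "\<dots> = 18 * (m + 1)" unfolding w by (simp add: algebra_simps power2_eq_square)
  also have "\<dots> > 0" using assms by simp
  finally show ?thesis using assms by (simp add: w_def zero_less_mult_iff)
qed

text \<open>Reduces an upper bound for the Group I root to a sign test at w. For m >= -1/2 the
  quotient of \<open>shape_poly m v\<close> by v increases on positive v. For m < -1/2 the
  polynomial is concave and positive at both w and 3 / (m + 2), hence positive between them.\<close>

lemma root_I_upper:
  assumes m: "m > -1" and v: "root_I m v" and w: "w > 0" "shape_poly m w > 0"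
  shows "v < w"
proof (rule ccontr)
  assume "\<not> v < w"
  hence vw: "w \<le> v" by simp
  have v': "0 < v" "v < 3 / (m + 2)" "shape_poly m v = 0" using v by (auto simp: root_I_def)
  show False
  proof (cases "1 + 2 * m \<ge> 0")
    case True
    have "w * shape_poly m v - v * shape_poly m w =
      (v - w) * ((m + 2) * (m + 3) * (1 + 2 * m) * v * w + 6 * (m + 3))"
      unfolding shape_poly_def by (simp add: algebra_simps power2_eq_square)
    moreover have "(m + 2) * (m + 3) * (1 + 2 * m) \<ge> 0" using m True by simp
    hence "(m + 2) * (m + 3) * (1 + 2 * m) * v * w \<ge> 0" using w v' by simp
    hence "(v - w) * ((m + 2) * (m + 3) * (1 + 2 * m) * v * w + 6 * (m + 3)) \<ge> 0"
      using m vw by (intro mult_nonneg_nonneg[of "v - w"]) auto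
    moreover have "v * shape_poly m w > 0" using v' w by simp
    ultimately show False using v' by simp
  next
    case False
    let ?V = "3 / (m + 2)"
    have "(m + 2) * (m + 3) * (1 + 2 * m) \<le> 0" using False m by (intro mult_nonneg_nonpos) auto
    moreover have "(?V - w) * (?V - v) * (v - w) \<ge> 0"
      using vw v' by (intro mult_nonneg_nonneg) auto
    ultimately have "(m + 2) * (m + 3) * (1 + 2 * m) * ((?V - w) * (?V - v) * (v - w)) \<le> 0"
      by (rule mult_nonpos_nonneg)
    moreover have "(?V - v) * shape_poly m w > 0" using v' w by simp
    moreover have "(v - w) * shape_poly m ?V \<ge> 0" using vw shape_poly_bound[OF m] by simp
    ultimately show False using shape_poly_chord[of ?V w m v] v' by simp
  qed
qed

text \<open>The quotient of \<open>shape_poly m v\<close> by v increases for positive v, so beyond 3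
  / (m + 2), where the polynomial is positive, there is no root.\<close>

lemma root_I_if_pos:
  assumes m: "m > -1/2" and v: "v > 0" "shape_poly m v = 0"
  shows "root_I m v"
proof -
  define V where "V = 3 / (m + 2)"
  have V: "V > 0" "shape_poly m V > 0" using m shape_poly_bound[of m] by (simp_all add: V_def)
  have "v < V"
  proof (rule ccontr)
    assume *: "\<not> v < V"
    have "V * shape_poly m v - v * shape_poly m V =
      (v - V) * ((m + 2) * (m + 3) * (1 + 2 * m) * v * V + 6 * (m + 3))"
      unfolding shape_poly_def by (simp add: algebra_simps power2_eq_square)
    moreover have "(m + 2) * (m + 3) * (1 + 2 * m) \<ge> 0" using m by simp
    hence "(m + 2) * (m + 3) * (1 + 2 * m) * v * V \<ge> 0" using V v by simp
    hence "(v - V) * ((m + 2) * (m + 3) * (1 + 2 * m) * v * V + 6 * (m + 3)) \<ge> 0"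
      using m * by (intro mult_nonneg_nonneg[of "v - V"]) auto
    moreover have "v * shape_poly m V > 0" using v V by simp
    ultimately show False using v by simp
  qed
  thus ?thesis using v by (simp add: root_I_def V_def)
qed

text \<open>The test point is the v at which 1 - \<open>mu_sum\<close> + \<open>mu_prod\<close>
  vanishes, that is, at which one of the two eigenvalues equals 1. The factor (m + 1)^3 in the value
  shows that such a v is never a root for m > -1.\<close>

lemma shape_poly_critical:
  assumes "m > -1" "m \<noteq> 1"
  shows "shape_poly m (2 * (m + 3) / ((2 * m + 3) * (1 - m))) > 0"
proof -
  have "(2 * m + 3) \<noteq> 0" "1 - m \<noteq> 0" using assms by auto
  hence "shape_poly m (2 * (m + 3) / ((2 * m + 3) * (1 - m))) =
     72 * (m + 1) ^ 3 * (m + 3) / ((2 * m + 3)\<^sup>2 * (1 - m)\<^sup>2)"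
    unfolding shape_poly_def 
    apply (simp add: divide_simps)
    apply (simp add: algebra_simps eval_nat_numeral)
    done
  moreover have "\<dots> > 0" using assms by auto
  ultimately show ?thesis by simp
qed

lemma root_I_critical:
  assumes m: "m > -1" and v: "root_I m v"
  shows "(1 - m) * v * (2 * m + 3) < 2 * (m + 3)"
proof (cases "m < 1")
  case True
  have d: "(2 * m + 3) * (1 - m) > 0" using m True by simp
  have "v < 2 * (m + 3) / ((2 * m + 3) * (1 - m))"
  proof (rule root_I_upper[OF m v])
    show "2 * (m + 3) / ((2 * m + 3) * (1 - m)) > 0" using m d by (intro divide_pos_pos) auto
    show "shape_poly m (2 * (m + 3) / ((2 * m + 3) * (1 - m))) > 0"
      using m True by (intro shape_poly_critical) auto
  qed
  with d have "v * ((2 * m + 3) * (1 - m)) < 2 * (m + 3)" by (simp only: pos_less_divide_eq)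
  thus ?thesis by (simp only: mult_ac)
next
  case False
  have "v > 0" using v by (simp add: root_I_def)
  hence "(1 - m) * v \<le> 0" using False by (intro mult_nonpos_nonneg) auto
  hence "(1 - m) * v * (2 * m + 3) \<le> 0" by (rule mult_nonpos_nonneg) (use m in auto)
  moreover have "2 * (m + 3) > 0" using m by simp
  ultimately show ?thesis by (rule le_less_trans)
qed

text \<open>For m <= 1 the left-hand side is not positive. For m > 1 the test point w is negative,
  and v <= w is impossible by convexity: the polynomial vanishes at v and is negative at 0, so it
  would not be positive at w.\<close>

lemma root_II_critical:
  assumes "m > -1/2" "root_II m v"
  shows "(1 - m) * v * (2 * m + 3) < 2 * (m + 3)"
proof (cases "m > 1")
  case False
  hence "(1 - m) * v \<le> 0" using assms by (intro mult_nonneg_nonpos) (auto simp: root_II_def)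
  hence "(1 - m) * v * (2 * m + 3) \<le> 0" by (rule mult_nonpos_nonneg) (use assms in auto)
  moreover have "2 * (m + 3) > 0" using assms by simp
  ultimately show ?thesis by (rule le_less_trans)
next
  case True
  define w where "w = 2 * (m + 3) / ((2 * m + 3) * (1 - m))"
  have w: "w < 0" unfolding w_def using True by (intro divide_pos_neg mult_pos_neg) auto
  have gw: "shape_poly m w > 0" unfolding w_def using True by (intro shape_poly_critical) auto
  have "v > w"
  proof (rule ccontr)
    assume "\<not> v > w"
    hence vw: "v \<le> w" by simp
    have v: "v < 0" "shape_poly m v = 0" using assms by (auto simp: root_II_def)
    have "(0 - v) * (0 - w) * (w - v) \<ge> 0" using vw v w by (intro mult_nonneg_nonneg) auto
    hence "(m + 2) * (m + 3) * (1 + 2 * m) * ((0 - v) * (0 - w) * (w - v)) \<ge> 0"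
      using assms by (intro mult_nonneg_nonneg[of "(m + 2) * (m + 3) * (1 + 2 * m)"]) auto
    moreover have "(w - v) * shape_poly m 0 \<le> 0"
      using vw assms by (intro mult_nonneg_nonpos) (auto simp: shape_poly_def)
    moreover have "(0 - v) * shape_poly m w > 0"
      using v gw by (intro mult_pos_pos) auto
    moreover have "(0 - w) * shape_poly m v = 0" using v by simp
    ultimately show False using shape_poly_chord[of 0 v m w] by linarith
  qed
  moreover have "(2 * m + 3) * (1 - m) < 0" using True by (intro mult_pos_neg) auto
  ultimately have "v * ((2 * m + 3) * (1 - m)) < 2 * (m + 3)" by (simp only: w_def neg_divide_less_eq)
  thus ?thesis by (simp only: mult_ac)
qed

section \<open>Position of the two eigenvalues relative to 1\<close>

lemma mu_bounds:
  assumes "m > -1" "(1 - m) * v * (2 * m + 3) < 2 * (m + 3)"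
  shows "1 - mu_sum m v + mu_prod m v > 0" "mu_prod m v > 0" "mu_sum m v > 1"
proof -
  let ?n = "(1 - m) * v"
  have "1 - mu_sum m v + mu_prod m v = (2 * (m + 3) - ?n * (2 * m + 3)) / (m + 3)"
    using assms by (simp add: mu_sum_def mu_prod_def field_simps)
  thus "1 - mu_sum m v + mu_prod m v > 0" using assms by simp
  have "?n * (m + 2) < 2 * (m + 3)"
  proof (cases "?n > 0")
    case True
    hence "?n * (m + 2) \<le> ?n * (2 * m + 3)" using assms by (intro mult_left_mono) auto
    thus ?thesis using assms by simp
  next
    case False
    hence "?n * (m + 2) \<le> 0" using assms by (intro mult_nonpos_nonneg[of ?n]) auto
    thus ?thesis using assms by simp
  qed
  thus "mu_prod m v > 0" using assms by (simp add: mu_prod_def field_simps)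
  have "?n * (2 * m + 3) < 4 * (2 * m + 3)" using assms by simp
  hence "?n < 4" using assms by (subst (asm) mult_less_cancel_right_pos) auto
  thus "mu_sum m v > 1" by (simp add: mu_sum_def)
qed

text \<open>The test point n = 3 is where \<open>mu_sum\<close> equals 2. The cubic is increasing,
  and its zero lies between -4/5 and -3/4.\<close>

lemma shape_poly_3:
  assumes "m \<noteq> 1"
  shows "shape_poly m (3 / (1 - m)) * (1 - m)\<^sup>2 = 3 * (8 * m ^ 3 + 32 * m\<^sup>2 + 47 * m + 21)"
proof -
  have "1 - m \<noteq> 0" using assms by simp
  thus ?thesis unfolding shape_poly_def
    apply (simp add: divide_simps)
    apply (simp add: algebra_simps eval_nat_numeral)
    done
qed

text \<open>Real pairs of Group I eigenvalues are claimed from \<open>m_c\<close> on, so any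
  threshold between the zero of the cubic and \<open>m_c\<close> serves. With -3/4 the cubic has
  positive coefficients in t = 4 * m + 3.\<close>

lemma root_I_mu_sum_gt_2:
  assumes m: "m > -3/4" and v: "root_I m v"
  shows "mu_sum m v > 2"
proof (cases "m < 1")
  case True
  define t where "t = 4 * m + 3"
  have t: "t > 0" using m by (simp add: t_def)
  have "8 * (8 * m ^ 3 + 32 * m\<^sup>2 + 47 * m + 21) = t ^ 3 + 7 * t\<^sup>2 + 25 * t + 3"
    unfolding t_def by (simp add: algebra_simps eval_nat_numeral)
  also have "\<dots> > 0" using t by (intro add_pos_pos mult_pos_pos zero_less_power) auto
  finally have "shape_poly m (3 / (1 - m)) * (1 - m)\<^sup>2 > 0"
    using shape_poly_3[of m] True by simp
  moreover have "(1 - m)\<^sup>2 > 0" using True by simp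
  ultimately have "shape_poly m (3 / (1 - m)) > 0" by (simp only: zero_less_mult_pos2)
  moreover have "3 / (1 - m) > 0" using True by simp
  moreover have "m > -1" using m by simp
  ultimately have "v < 3 / (1 - m)" using root_I_upper[OF _ v] by blast
  hence "v * (1 - m) < 3" using True by (simp only: pos_less_divide_eq diff_gt_0_iff_gt)
  thus ?thesis by (simp add: mu_sum_def mult.commute)
next
  case False
  have "v > 0" using v by (simp add: root_I_def)
  hence "(1 - m) * v \<le> 0" using False by (intro mult_nonpos_nonneg) auto
  thus ?thesis by (simp add: mu_sum_def)
qed

text \<open>The stable range ends below -4/5, and there the cubic is negative, as its expansion
  around -4/5 shows. So \<open>shape_poly\<close> is negative at the test point and positive at 3 /
  (m + 2); by concavity its root v cannot lie to the left of the test point.\<close>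

lemma root_I_mu_sum_lt_2:
  assumes m: "-1 < m" "m < -4/5" and v: "root_I m v"
  shows "mu_sum m v < 2"
proof -
  let ?s = "m + 4/5"
  have s: "?s < 0" "?s > -1/5" using m by auto
  have "8 * m ^ 3 + 32 * m\<^sup>2 + 47 * m + 21 = ?s * (8 * ?s\<^sup>2 + 64/5 * ?s + 279/25) - 27/125"
    by (simp add: field_simps eval_nat_numeral)
  also have "?s * (8 * ?s\<^sup>2 + 64/5 * ?s + 279/25) \<le> 0"
  proof (intro mult_nonpos_nonneg)
    have "8 * ?s\<^sup>2 + 64/5 * ?s + 279/25 = 8 * (?s + 4/5)\<^sup>2 + 151/25"
      by (simp add: field_simps power2_eq_square)
    also have "\<dots> \<ge> 0" by simp
    finally show "8 * ?s\<^sup>2 + 64/5 * ?s + 279/25 \<ge> 0" .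
  qed (use s in auto)
  finally have "shape_poly m (3 / (1 - m)) * (1 - m)\<^sup>2 < 0"
    using shape_poly_3[of m] m by auto
  hence w: "shape_poly m (3 / (1 - m)) < 0" by (auto simp: mult_less_0_iff)
  let ?w = "3 / (1 - m)" and ?V = "3 / (m + 2)"
  have v': "0 < v" "v < ?V" "shape_poly m v = 0" using v by (auto simp: root_I_def)
  have "v > ?w"
  proof (rule ccontr)
    assume "\<not> v > ?w"
    hence vw: "v \<le> ?w" by simp
    have wV: "?w < ?V" using m by (intro divide_strict_left_mono) auto
    have "(m + 2) * (m + 3) * (1 + 2 * m) \<le> 0" using m by (intro mult_nonneg_nonpos) auto
    moreover have "(?V - v) * (?V - ?w) * (?w - v) \<ge> 0"
      using vw v' wV by (intro mult_nonneg_nonneg) auto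
    ultimately have "(m + 2) * (m + 3) * (1 + 2 * m) * ((?V - v) * (?V - ?w) * (?w - v)) \<le> 0"
      by (rule mult_nonpos_nonneg)
    moreover have "(?w - v) * shape_poly m ?V \<ge> 0" using vw shape_poly_bound[of m] m by simp
    moreover have "(?V - v) * shape_poly m ?w < 0" using v' w by (intro mult_pos_neg) auto
    ultimately show False using shape_poly_chord[of ?V v m ?w] v' by simp
  qed
  thus ?thesis using m by (simp add: mu_sum_def field_simps)
qed

lemma root_II_mu_sum_gt_2:
  assumes "m > -1/2" "root_II m v"
  shows "mu_sum m v > 2"
proof -
  have "(1 - m) * v * (2 * m + 3) < 3 * (2 * m + 3)" using root_II_critical[OF assms] assms by simp
  hence "(1 - m) * v < 3" using assms by (subst (asm) mult_less_cancel_right_pos) auto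
  thus ?thesis by (simp add: mu_sum_def)
qed

section \<open>Sign of the discriminant of the pair\<close>

lemma mu_disc_pos_if_m_pos:
  assumes "m > 0" shows "mu_disc m v > 0"
proof -
  define k where "k = (3 - m) / (3 + m)"
  have "mu_disc m v = ((1 - m) * v)\<^sup>2 - 2 * k * ((1 - m) * v) + 1"
    using assms by (subst mu_disc_alt) (auto simp: k_def)
  also have "\<dots> = ((1 - m) * v - k)\<^sup>2 + (1 - k\<^sup>2)"
    by (simp add: power2_eq_square algebra_simps)
  also have "\<dots> > 0"
  proof -
    have "\<bar>k\<bar> < 1" using assms by (auto simp: k_def abs_if field_simps)
    hence "k\<^sup>2 < 1" using abs_square_less_1 by blast
    thus ?thesis by (simp add: add_nonneg_pos)
  qed
  finally show ?thesis .
qed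

lemma root_II_mu_disc_pos:
  assumes "m > -1/2" "root_II m v"
  shows "mu_disc m v > 0"
proof (cases "m > 0")
  case False
  define n where "n = (1 - m) * v"
  have "n \<le> 0" using assms False unfolding n_def by (intro mult_nonneg_nonpos) (auto simp: root_II_def)
  moreover have "2 * (3 - m) / (3 + m) \<ge> 0" using assms False by simp
  ultimately have "2 * (3 - m) / (3 + m) * n \<le> 0" by (rule_tac mult_nonneg_nonpos)
  moreover have "mu_disc m v = n\<^sup>2 - 2 * (3 - m) / (3 + m) * n + 1"
    unfolding n_def using assms by (intro mu_disc_alt) auto
  ultimately show ?thesis using zero_le_power2[of n] by linarith
qed (use mu_disc_pos_if_m_pos in auto)

text \<open>By elimination \<Psi> is the discriminant times the Bezout cofactor K, so the work
  consists in showing that K is positive.\<close>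

lemma root_I_mu_disc_sgn:
  assumes m: "m > -1" "m \<le> 0" and v: "root_I m v"
  shows "sgn (mu_disc m v) = sgn (\<Psi> m)"
proof -
  define a where "a = (m + 2) * (1 + 2 * m)"
  define b where "b = (1 - m)\<^sup>2 * (4 * m + 9)"
  define c where "c = 6 * (1 - m)\<^sup>2"
  define n where "n = (1 - m) * v"
  have "(m + 3) * a * n\<^sup>2 + b * n - (m + 3) * c = (1 - m)\<^sup>2 * shape_poly m v"
    unfolding shape_poly_def n_def a_def b_def c_def by (simp add: algebra_simps eval_nat_numeral)
  hence g: "(m + 3) * a * n\<^sup>2 + b * n - (m + 3) * c = 0" using v by (simp add: root_I_def)
  have h: "(m + 3) * mu_disc m v = (m + 3) * n\<^sup>2 - 2 * (3 - m) * n + (m + 3)"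
  proof -
    have "m + 3 > 0" using m by simp
    have "(m + 3) * mu_disc m v = (m + 3) * n\<^sup>2 - (m + 3) * (2 * (3 - m) / (3 + m)) * n + (m + 3)"
      using m by (simp add: mu_disc_alt n_def algebra_simps)
    also have "(m + 3) * (2 * (3 - m) / (3 + m)) = 2 * (3 - m)" using m by (simp add: field_simps)
    finally show ?thesis .
  qed
  have n: "n > 0" "n * (2 * m + 3) < 2 * (m + 3)"
    using m v root_I_critical[OF m(1) v] by (auto simp: n_def root_I_def)
  have b: "b > 0" and c: "c > 0" using m by (auto simp: b_def c_def)
  define K where "K = (m + 3)\<^sup>2 * a * (a + c) + (b + 2 * (3 - m) * a) * (b + (m + 3) * a * n)"
  have hK: "mu_disc m v * K = \<Psi> m"
  proof -
    have "m + 3 \<noteq> 0" using m by simp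
    from elimination_identity[OF g h this] show ?thesis
      unfolding K_def a_def b_def c_def Psi_resultant .
  qed
  have "K > 0"
  proof (cases "1 + 2 * m \<ge> 0")
    case True
    hence a: "a \<ge> 0" using m by (simp add: a_def)
    have "(m + 3)\<^sup>2 * a * (a + c) \<ge> 0" using a c by simp
    moreover have "b + 2 * (3 - m) * a > 0" using a b m by (intro add_pos_nonneg) auto
    moreover have "b + (m + 3) * a * n > 0" using a b m n by (intro add_pos_nonneg) auto
    ultimately show ?thesis unfolding K_def by (metis add_nonneg_pos mult_pos_pos)
  next
    case False
    \<comment> \<open>In this range K is affine in n with nonpositive slope, so it is bounded below
      by its value at the bound n = 2 * (m + 3) / (2 * m + 3) from
      \<open>root_I_critical\<close>.\<close>
    have a: "a \<le> 0" using m False by (auto simp: a_def mult_nonneg_nonpos)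
    have B: "b + 2 * (3 - m) * a \<ge> 0"
    proof -
      have "b + 2 * (3 - m) * a = 3 * (m + 2)\<^sup>2 + 9"
        by (simp add: a_def b_def algebra_simps eval_nat_numeral)
      thus ?thesis by simp
    qed
    \<comment> \<open>At that bound (2 * m + 3) * K is a polynomial in m, and in the variable s its
      positivity on (0, 1/2) is nearly visible from the coefficients.\<close>
    define s where "s = m + 1"
    have s: "s > 0" "s < 1/2" using m False by (auto simp: s_def)
    have ms: "m = s - 1" by (simp add: s_def)
    have "(m + 3)\<^sup>2 * a * (a + c) * (2 * m + 3)
        + (b + 2 * (3 - m) * a) * (b * (2 * m + 3) + (m + 3) * a * (2 * (m + 3)))
      = 32 * s ^ 7 + 104 * s ^ 6 - 48 * s ^ 5 - 12 * s ^ 4 + 522 * s ^ 3 + 693 * s\<^sup>2 + 412 * s + 52"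
    proof -
      have 1: "(m + 3)\<^sup>2 * a = 2 * s ^ 4 + 9 * s ^ 3 + 11 * s\<^sup>2 - 4"
        and 2: "(a + c) * (2 * m + 3) = 16 * s ^ 3 - 38 * s\<^sup>2 + 23 * s + 23"
        and 3: "b + 2 * (3 - m) * a = 3 * s\<^sup>2 + 6 * s + 12"
        and 4: "b * (2 * m + 3) + (m + 3) * a * (2 * (m + 3)) = 12 * s ^ 4 + 3 * s\<^sup>2 + 36 * s + 12"
        unfolding a_def b_def c_def ms by (simp_all add: algebra_simps eval_nat_numeral)
      show ?thesis unfolding mult.assoc[of "(m + 3)\<^sup>2 * a" "a + c" "2 * m + 3"] unfolding 1 2 3 4
        by (simp add: algebra_simps eval_nat_numeral)
    qed
    \<comment> \<open>The two negative terms are absorbed by 522 * s^3.\<close>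
    also have "\<dots> = 32 * s ^ 7 + 104 * s ^ 6 + s ^ 3 * (522 - 12 * s - 48 * s\<^sup>2) + 693 * s\<^sup>2 + 412 * s + 52"
      by (simp add: algebra_simps eval_nat_numeral)
    also have "\<dots> > 0"
    proof -
      have "s\<^sup>2 \<le> 1" using s by (intro power_le_one) auto
      hence "522 - 12 * s - 48 * s\<^sup>2 > 0" using s by linarith
      thus ?thesis using s by (intro add_pos_pos mult_pos_pos) auto
    qed
    finally have L: "(m + 3)\<^sup>2 * a * (a + c) * (2 * m + 3)
        + (b + 2 * (3 - m) * a) * (b * (2 * m + 3) + (m + 3) * a * (2 * (m + 3))) > 0" .
    have "(m + 3) * a * (n * (2 * m + 3)) \<ge> (m + 3) * a * (2 * (m + 3))"
      using a m n by (intro mult_left_mono_neg) (auto intro: mult_nonneg_nonpos)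
    hence "(b + 2 * (3 - m) * a) * (b * (2 * m + 3) + (m + 3) * a * (n * (2 * m + 3)))
      \<ge> (b + 2 * (3 - m) * a) * (b * (2 * m + 3) + (m + 3) * a * (2 * (m + 3)))"
      using B by (intro mult_left_mono) auto
    note less_le_trans[OF L add_left_mono[OF this]]
    also have "(m + 3)\<^sup>2 * a * (a + c) * (2 * m + 3)
       + (b + 2 * (3 - m) * a) * (b * (2 * m + 3) + (m + 3) * a * (n * (2 * m + 3))) = K * (2 * m + 3)"
      unfolding K_def by (simp only: distrib_right distrib_left mult.assoc)
    finally have "K * (2 * m + 3) > 0" .
    thus ?thesis using m by (simp add: zero_less_mult_iff)
  qed
  hence "sgn (mu_disc m v) = sgn (mu_disc m v * K)" by (simp add: sgn_mult)
  thus ?thesis by (simp only: hK)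
qed

subsection \<open>The polynomial \<open>\<Psi>\<close>\<close>

lemma has_real_derivative_Psi:
  "(\<Psi> has_real_derivative (384 * m ^ 5 + 1600 * m ^ 4 + 384 * m ^ 3 - 660 * m\<^sup>2 + 1010 * m + 522)) (at m)"
proof -
  have "((\<lambda>m. 64 * m ^ 6 + 320 * m ^ 5 + 96 * m ^ 4 - 220 * m ^ 3 + 505 * m ^ 2 + 522 * m + 9)
     has_real_derivative (384 * m ^ 5 + 1600 * m ^ 4 + 384 * m ^ 3 - 660 * m\<^sup>2 + 1010 * m + 522)) (at m)"
    by (auto intro!: derivative_eq_intros)
  thus ?thesis unfolding \<Psi>_def[abs_def] .
qed

lemma isCont_Psi: "isCont \<Psi> m"
  using has_real_derivative_Psi DERIV_isCont by blast

text \<open>A certificate of Bernstein type: s and t are positive inside the interval and 2 * s + t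
  = 1, so the derivative can be made homogeneous of degree 5 in s and t, and then all its
  coefficients have one sign.\<close>

lemma Psi_strict_decreasing:
  assumes "-1 \<le> a" "a < b" "b \<le> -1/2" shows "\<Psi> b < \<Psi> a"
proof (rule DERIV_neg_imp_decreasing_open[OF assms(2)])
  fix m :: real assume m: "a < m" "m < b"
  define s t where "s = m + 1" and "t = - 1 - 2 * m"
  have st: "s > 0" "t > 0" using m assms by (auto simp: s_def t_def)
  have "384 * m ^ 5 + 1600 * m ^ 4 + 384 * m ^ 3 - 660 * m\<^sup>2 + 1010 * m + 522
     = - (316 * t ^ 5 + 4158 * s * t ^ 4 + 16676 * s\<^sup>2 * t ^ 3 + 27720 * s ^ 3 * t\<^sup>2 + 18864 * s ^ 4 * t + 3456 * s ^ 5)"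
    unfolding s_def t_def by (simp add: algebra_simps eval_nat_numeral)
  also have "\<dots> < 0" unfolding neg_less_0_iff_less using st by (intro add_pos_pos) auto
  finally show "\<exists>y. (\<Psi> has_real_derivative y) (at m) \<and> y < 0"
    using has_real_derivative_Psi by blast
qed (use isCont_Psi in \<open>auto intro!: continuous_at_imp_continuous_on\<close>)

lemma Psi_strict_increasing:
  assumes "-1/4 \<le> a" "a < b" "b \<le> 0" shows "\<Psi> a < \<Psi> b"
proof (rule DERIV_pos_imp_increasing_open[OF assms(2)])
  fix m :: real assume m: "a < m" "m < b"
  \<comment> \<open>The same device, now with s + 4 * t = 1.\<close>
  define s t where "s = 4 * m + 1" and "t = - m"
  have st: "s > 0" "t > 0" using m assms by (auto simp: s_def t_def)
  have "384 * m ^ 5 + 1600 * m ^ 4 + 384 * m ^ 3 - 660 * m\<^sup>2 + 1010 * m + 522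
     = 233600 * t ^ 5 + 376448 * s * t ^ 4 + 228816 * s\<^sup>2 * t ^ 3 + 66700 * s ^ 3 * t\<^sup>2 + 9430 * s ^ 4 * t + 522 * s ^ 5"
    unfolding s_def t_def by (simp add: algebra_simps eval_nat_numeral)
  also have "\<dots> > 0" using st by (intro add_pos_pos) auto
  finally show "\<exists>y. (\<Psi> has_real_derivative y) (at m) \<and> y > 0"
    using has_real_derivative_Psi by blast
qed (use isCont_Psi in \<open>auto intro!: continuous_at_imp_continuous_on\<close>)

lemma Psi_neg:
  assumes "-1/2 \<le> m" "m \<le> -1/4" shows "\<Psi> m < 0"
proof -
  \<comment> \<open>Here 2 * s + t = 1 and the form has degree 6. Either variable may vanish at an
    end of the interval, but not both.\<close>
  define s t where "s = 2 * m + 1" and "t = - 1 - 4 * m"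
  have st: "s \<ge> 0" "t \<ge> 0" "s > 0 \<or> t > 0" using assms by (auto simp: s_def t_def)
  have "4 * \<Psi> m = - (405 * t ^ 6 + 5076 * s * t ^ 5 + 25821 * s\<^sup>2 * t ^ 4 + 68214 * s ^ 3 * t ^ 3
      + 98576 * s ^ 4 * t\<^sup>2 + 73672 * s ^ 5 * t + 22124 * s ^ 6)"
    unfolding s_def t_def \<Psi>_def by (simp add: algebra_simps eval_nat_numeral)
  also have "\<dots> < 0"
  proof (cases "s > 0")
    case True
    thus ?thesis unfolding neg_less_0_iff_less using st by (intro add_nonneg_pos add_nonneg_nonneg) auto
  next
    case False
    thus ?thesis unfolding neg_less_0_iff_less using st by (intro add_pos_nonneg) auto
  qed
  finally show ?thesis by simp
qed

text \<open>Clears denominators, so that the signs of \<Psi> at decimal fractions become integer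
  arithmetic.\<close>

lemma Psi_rat:
  fixes k N :: real
  assumes "N > 0"
  defines "p \<equiv> 64 * k ^ 6 - 320 * k ^ 5 * N + 96 * k ^ 4 * N\<^sup>2 + 220 * k ^ 3 * N ^ 3
     + 505 * k\<^sup>2 * N ^ 4 - 522 * k * N ^ 5 + 9 * N ^ 6"
  shows "\<Psi> (- k / N) > 0 \<longleftrightarrow> p > 0" "\<Psi> (- k / N) < 0 \<longleftrightarrow> p < 0"
proof -
  have p: "p = N ^ 6 * \<Psi> (- k / N)"
    using assms(1) unfolding p_def \<Psi>_def by (simp add: field_simps eval_nat_numeral)
  show "\<Psi> (- k / N) > 0 \<longleftrightarrow> p > 0" "\<Psi> (- k / N) < 0 \<longleftrightarrow> p < 0"
    using assms(1) by (auto simp: p zero_less_mult_iff mult_less_0_iff)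
qed

text \<open>\<Psi> falls on [-1, -1/2], is negative on [-1/2, -1/4] and rises on [-1/4, 0]; one sign
  change on each outer interval thus accounts for every root.\<close>

lemma Psi_roots:
  obtains m_star m_c where
    "- 85641365 / 100000000 < m_star" "m_star < - 85641355 / 100000000" "- 1754135 / 100000000 < m_c" "m_c < - 1754125 / 100000000"
    "\<Psi> m_star = 0" "\<Psi> m_c = 0"
    "\<And>m. -1 < m \<Longrightarrow> m < m_star \<Longrightarrow> \<Psi> m > 0"
    "\<And>m. m_star < m \<Longrightarrow> m < m_c \<Longrightarrow> \<Psi> m < 0"
    "\<And>m. m_c < m \<Longrightarrow> m \<le> 0 \<Longrightarrow> \<Psi> m > 0"
proof -
  \<comment> \<open>The rounded roots plus and minus half a unit in the seventh decimal, which is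
    the accuracy stated in the theorem.\<close>
  have v: "\<Psi> (- 85641365 / 100000000) > 0" "\<Psi> (- 85641355 / 100000000) < 0" "\<Psi> (- 1754135 / 100000000) < 0" "\<Psi> (- 1754125 / 100000000) > 0"
    by (simp_all only: Psi_rat zero_less_numeral) simp_all
  have "\<exists>x\<ge>- 85641365 / 100000000. x \<le> - 85641355 / 100000000 \<and> \<Psi> x = 0"
    using v isCont_Psi by (intro IVT2) auto
  then obtain m_star where a: "- 85641365 / 100000000 \<le> m_star" "m_star \<le> - 85641355 / 100000000" "\<Psi> m_star = 0" by auto
  have "\<exists>x\<ge>- 1754135 / 100000000. x \<le> - 1754125 / 100000000 \<and> \<Psi> x = 0"
    using v isCont_Psi by (intro IVT) auto
  then obtain m_c where c: "- 1754135 / 100000000 \<le> m_c" "m_c \<le> - 1754125 / 100000000" "\<Psi> m_c = 0" by auto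
  show ?thesis
  proof (rule that[of m_star m_c])
    show "- 85641365 / 100000000 < m_star" "m_star < - 85641355 / 100000000" "- 1754135 / 100000000 < m_c" "m_c < - 1754125 / 100000000"
      using a c v by (metis less_le less_irrefl)+
    show "\<Psi> m > 0" if "-1 < m" "m < m_star" for m
    proof -
      have "\<Psi> m_star < \<Psi> m" using that a by (intro Psi_strict_decreasing) linarith+
      thus ?thesis using a by simp
    qed
    show "\<Psi> m < 0" if "m_star < m" "m < m_c" for m
    proof -
      consider "m \<le> -1/2" | "-1/2 \<le> m" "m \<le> -1/4" | "-1/4 \<le> m" by linarith
      thus ?thesis
      proof cases
        case 1
        have "\<Psi> m < \<Psi> m_star" using that a 1 by (intro Psi_strict_decreasing) linarith+
        thus ?thesis using a by simp
      next
        case 3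
        have "\<Psi> m < \<Psi> m_c" using that c 3 by (intro Psi_strict_increasing) linarith+
        thus ?thesis using c by simp
      qed (rule Psi_neg)
    qed
    show "\<Psi> m > 0" if "m_c < m" "m \<le> 0" for m
    proof -
      have "\<Psi> m_c < \<Psi> m" using that c by (intro Psi_strict_increasing) linarith+
      thus ?thesis using c by simp
    qed
  qed (fact a(3) c(3))+
qed

subsection \<open>Equations of a collinear relative equilibrium\<close>

text \<open>Positions relative to vortex 4, so that vortex 4 sits at the origin.\<close>

definition line_re :: "real \<Rightarrow> real \<Rightarrow> real \<Rightarrow> real \<Rightarrow> real \<Rightarrow> real \<Rightarrow> bool" where
  "line_re m \<omega> c a b d \<longleftrightarrow>
     \<omega> \<noteq> 0 \<and> a \<noteq> 0 \<and> b \<noteq> 0 \<and> d \<noteq> 0 \<and> a \<noteq> b \<and> a \<noteq> d \<and> b \<noteq> d \<and>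
     (m + 3) * c = a + b + d \<and>
     \<omega> * (a - c) = 1 / (a - b) + 1 / (a - d) + m / a \<and>
     \<omega> * (b - c) = 1 / (b - a) + 1 / (b - d) + m / b \<and>
     \<omega> * (d - c) = 1 / (d - a) + 1 / (d - b) + m / d \<and>
     \<omega> * c = 1 / a + 1 / b + 1 / d"

text \<open>The second relation is the equation of vortex 4 multiplied by \<open>e3\<close>. The
  third and fourth add the other three equations, each weighted by the sum, respectively the
  product, of the two other positions; under these weights the mutual terms 1 / (a - b) collapse to
  polynomials.\<close>

lemma line_re_symmetric_functions:
  fixes m \<omega> c a b d :: real
  assumes "line_re m \<omega> c a b d"
  defines "e1 \<equiv> a + b + d" and "e2 \<equiv> a * b + a * d + b * d" and "e3 \<equiv> a * b * d"
  shows "e1 = (m + 3) * c" "e2 = \<omega> * c * e3"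
    "2 * \<omega> * e2 = - 3 * (1 + m) + \<omega> * c * (2 + m) * e1"
    "3 * \<omega> * e3 = - (1 + 2 * m) * e1 + \<omega> * c * (1 + m) * e2"
proof -
  note r = assms(1)[unfolded line_re_def]
  have nz: "a \<noteq> 0" "b \<noteq> 0" "d \<noteq> 0" and dist: "a - b \<noteq> 0" "a - d \<noteq> 0" "b - d \<noteq> 0" using r by auto
  show "e1 = (m + 3) * c" using r by (simp add: e1_def)
  \<comment> \<open>With names for the reciprocals each identity below is polynomial, modulo
    relations such as p * (a - b) = 1 and i * a = 1.\<close>
  define p q s where "p = 1 / (a - b)" and "q = 1 / (a - d)" and "s = 1 / (b - d)"
  define i j k where "i = 1 / a" and "j = 1 / b" and "k = 1 / d"
  have D: "p * (a - b) = 1" "q * (a - d) = 1" "s * (b - d) = 1" using dist by (simp_all add: p_def q_def s_def)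
  have I: "i * a = 1" "j * b = 1" "k * d = 1" using nz by (simp_all add: i_def j_def k_def)
  have neg: "1 / (b - a) = - p" "1 / (d - a) = - q" "1 / (d - b) = - s"
    unfolding p_def q_def s_def by (simp_all add: minus_divide_right)
  have F: "\<omega> * (a - c) = p + q + m * i" "\<omega> * (b - c) = s - p + m * j" "\<omega> * (d - c) = - q - s + m * k"
    "\<omega> * c = i + j + k"
    using r unfolding neg by (simp_all add: p_def q_def s_def i_def j_def k_def)
  have "e2 - (i + j + k) * e3 = - (b * d * (i * a - 1) + a * d * (j * b - 1) + a * b * (k * d - 1))"
    unfolding e2_def e3_def by (simp add: algebra_simps)
  thus 2: "e2 = \<omega> * c * e3" unfolding F(4) I by simp
  have "(b + d) * (p + q + m * i) + (a + d) * (s - p + m * j) + (a + b) * (- q - s + m * k)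
      - (- 3 * (1 + m) + m * e1 * (i + j + k))
    = - (p * (a - b) - 1) - (q * (a - d) - 1) - (s * (b - d) - 1)
      - m * ((i * a - 1) + (j * b - 1) + (k * d - 1))"
    unfolding e1_def by (simp add: algebra_simps)
  hence "(b + d) * (\<omega> * (a - c)) + (a + d) * (\<omega> * (b - c)) + (a + b) * (\<omega> * (d - c))
     = - 3 * (1 + m) + m * e1 * (\<omega> * c)"
    unfolding F I D by simp
  thus "2 * \<omega> * e2 = - 3 * (1 + m) + \<omega> * c * (2 + m) * e1"
    unfolding e1_def e2_def by (simp add: algebra_simps)
  have "b * d * (p + q + m * i) + a * d * (s - p + m * j) + a * b * (- q - s + m * k)
      - (- (1 + 2 * m) * e1 + m * (i + j + k) * e2)
    = - d * (p * (a - b) - 1) - b * (q * (a - d) - 1) - a * (s * (b - d) - 1)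
      - m * ((i * a - 1) * (b + d) + (j * b - 1) * (a + d) + (k * d - 1) * (a + b))"
    unfolding e1_def e2_def by (simp add: algebra_simps)
  hence "b * d * (\<omega> * (a - c)) + a * d * (\<omega> * (b - c)) + a * b * (\<omega> * (d - c))
     = - (1 + 2 * m) * e1 + m * (\<omega> * c) * e2"
    unfolding F I D by simp
  thus "3 * \<omega> * e3 = - (1 + 2 * m) * e1 + \<omega> * c * (1 + m) * e2"
    unfolding e2_def e3_def by (simp add: algebra_simps)
qed

definition shape_param :: "real \<Rightarrow> real \<Rightarrow> real \<Rightarrow> real \<Rightarrow> real" where
  "shape_param \<omega> a b d = (a + b + d) / (\<omega> * (a * b * d))"

text \<open>A second invariant u = \<omega> * c^2 mediates. The second and fourth symmetric
  relations make (1 + m) * u affine in v, the first three give an equation bilinear in u and v, and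
  eliminating u leaves the quadratic for v.\<close>

lemma line_re_shape_param:
  assumes r: "line_re m \<omega> c a b d" and m: "m > -1"
  defines "v \<equiv> shape_param \<omega> a b d"
  shows "c \<noteq> 0" "v \<noteq> 0" "v * (\<omega> * (a * b * d)) = (m + 3) * c"
    "(1 + m) * (\<omega> * c\<^sup>2) = 3 + (1 + 2 * m) * v" "shape_poly m v = 0"
proof -
  define e1 e2 e3 where "e1 = a + b + d" and "e2 = a * b + a * d + b * d" and "e3 = a * b * d"
  note E = line_re_symmetric_functions[OF r, folded e1_def e2_def e3_def]
  have nz: "\<omega> \<noteq> 0" "e3 \<noteq> 0" using r by (auto simp: line_re_def e3_def)
  \<comment> \<open>If c were 0, then \<open>e1\<close> and \<open>e2\<close> would vanish and the
    third relation would force m = -1.\<close>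
  show c: "c \<noteq> 0" using E(1-3) m by auto
  have v: "v * (\<omega> * e3) = e1"
    using nz by (simp add: v_def shape_param_def e1_def[symmetric] e3_def[symmetric])
  thus "v * (\<omega> * (a * b * d)) = (m + 3) * c" using E(1) by (simp add: e3_def)
  show "v \<noteq> 0" using v E(1) c m by auto
  define u where "u = \<omega> * c\<^sup>2"
  have "(\<omega> * e3) * ((1 + m) * u) = (\<omega> * e3) * (3 + (1 + 2 * m) * v)"
  proof -
    have "(\<omega> * e3) * ((1 + m) * u) = \<omega> * c * (1 + m) * e2"
      unfolding E(2) u_def by (simp add: power2_eq_square)
    also have "\<dots> = 3 * \<omega> * e3 + (1 + 2 * m) * e1" unfolding E(4) by (simp add: algebra_simps)
    also have "\<dots> = (\<omega> * e3) * (3 + (1 + 2 * m) * v)" unfolding v[symmetric] by (simp add: algebra_simps)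
    finally show ?thesis .
  qed
  thus u: "(1 + m) * (\<omega> * c\<^sup>2) = 3 + (1 + 2 * m) * v" using nz by (simp add: u_def)
  have "2 * (m + 3) * u = 2 * (\<omega> * c) * e1" unfolding u_def E(1) by (simp add: power2_eq_square)
  also have "\<dots> = v * (2 * \<omega> * e2)" unfolding E(2) v[symmetric] by simp
  also have "\<dots> = v * ((m + 2) * (m + 3) * u - 3 * (1 + m))"
    unfolding E(3) unfolding E(1) u_def by (simp add: algebra_simps power2_eq_square)
  \<comment> \<open>The factor 1 + m makes u appear only as (1 + m) * u, for which the affine
    expression can be substituted.\<close>
  finally have "(1 + m) * (2 * (m + 3) * u) = (1 + m) * (v * ((m + 2) * (m + 3) * u - 3 * (1 + m)))"
    by (rule arg_cong)
  hence "2 * (m + 3) * ((1 + m) * u) = v * ((m + 2) * (m + 3) * ((1 + m) * u) - 3 * (1 + m)\<^sup>2)"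
    by (simp add: algebra_simps power2_eq_square)
  hence "2 * (m + 3) * (3 + (1 + 2 * m) * v) = v * ((m + 2) * (m + 3) * (3 + (1 + 2 * m) * v) - 3 * (1 + m)\<^sup>2)"
    using u by (simp add: u_def)
  thus "shape_poly m v = 0" unfolding shape_poly_def by (simp add: algebra_simps power2_eq_square)
qed

text \<open>The positions share a sign, and so do c and \<omega> * c; hence \<omega> and v are
  positive. Newton's inequality becomes 3 * v <= \<omega> * c^2, and the affine relation for
  \<omega> * c^2 turns this into v * (m + 2) <= 3.\<close>

lemma root_I_if_exterior:
  assumes r: "line_re m \<omega> c a b d" and m: "m > -1"
    and s: "a > 0 \<and> b > 0 \<and> d > 0 \<or> a < 0 \<and> b < 0 \<and> d < 0"
  shows "root_I m (shape_param \<omega> a b d)"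
proof -
  define v where "v = shape_param \<omega> a b d"
  note V = line_re_shape_param[OF r m, folded v_def]
  define e1 e2 e3 where "e1 = a + b + d" and "e2 = a * b + a * d + b * d" and "e3 = a * b * d"
  note E = line_re_symmetric_functions[OF r, folded e1_def e2_def e3_def]
  have c: "(m + 3) * c = a + b + d" "\<omega> * c = 1 / a + 1 / b + 1 / d" using r by (auto simp: line_re_def)
  have \<omega>: "\<omega> > 0"
  proof (cases "a > 0")
    case True
    hence "(m + 3) * c > 0" "\<omega> * c > 0" unfolding c using s by (auto intro!: add_pos_pos)
    thus ?thesis using m by (auto simp: zero_less_mult_iff)
  next
    case False
    hence "(m + 3) * c < 0" "\<omega> * c < 0" unfolding c using s by (auto intro!: add_neg_neg simp: divide_neg_neg)
    thus ?thesis using m by (auto simp: mult_less_0_iff)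
  qed
  have "e1 * e3 > 0" using s unfolding e1_def e3_def
    by (auto simp: zero_less_mult_iff mult_less_0_iff add_pos_pos add_neg_neg)
  moreover have e1: "e1 = v * (\<omega> * e3)" using V(3) E(1) by (simp add: e3_def)
  ultimately have "v * \<omega> * e3\<^sup>2 > 0" by (simp add: power2_eq_square mult_ac)
  hence v: "v > 0" using \<omega> by (simp add: zero_less_mult_iff)
  have "2 * (e2\<^sup>2 - 3 * e1 * e3) = (a * b - a * d)\<^sup>2 + (a * b - b * d)\<^sup>2 + (a * d - b * d)\<^sup>2"
    unfolding e1_def e2_def e3_def by (simp add: algebra_simps power2_eq_square)
  also have "\<dots> \<ge> 0" by simp
  finally have "3 * e1 * e3 \<le> e2\<^sup>2" by simp
  hence "(\<omega> * e3\<^sup>2) * (3 * v) \<le> (\<omega> * e3\<^sup>2) * (\<omega> * c\<^sup>2)"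
    unfolding E(2) e1 by (simp add: power2_eq_square mult_ac)
  moreover have "\<omega> * e3\<^sup>2 > 0" using \<omega> r by (auto simp: line_re_def e3_def)
  ultimately have "3 * v \<le> \<omega> * c\<^sup>2" by (simp only: mult_le_cancel_left_pos)
  hence "(1 + m) * (3 * v) \<le> (1 + m) * (\<omega> * c\<^sup>2)" using m by (intro mult_left_mono) auto
  hence "v * (m + 2) \<le> 3" unfolding V(4) by (simp add: algebra_simps)
  hence "v \<le> 3 / (m + 2)" using m by (simp add: pos_le_divide_eq)
  moreover have "v \<noteq> 3 / (m + 2)" using shape_poly_bound[OF m] V(5) by auto
  ultimately show ?thesis using v V(5) by (simp add: root_I_def v_def)
qed

text \<open>For positive v also \<omega> and \<open>e2\<close> would be positive, and
  \<open>e1\<close> and \<open>e3\<close> would share a sign. As in Descartes' rule, all three roots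
  of the cubic would then lie on the side of \<open>e1\<close>, which makes vortex 4
  exterior.\<close>

lemma root_II_if_interior:
  assumes r: "line_re m \<omega> c a b d" and m: "m > -1/2"
    and s: "\<not> (a > 0 \<and> b > 0 \<and> d > 0 \<or> a < 0 \<and> b < 0 \<and> d < 0)"
  shows "root_II m (shape_param \<omega> a b d)"
proof -
  define v where "v = shape_param \<omega> a b d"
  have m1: "m > -1" using m by simp
  note V = line_re_shape_param[OF r m1, folded v_def]
  define e1 e2 e3 where "e1 = a + b + d" and "e2 = a * b + a * d + b * d" and "e3 = a * b * d"
  note E = line_re_symmetric_functions[OF r, folded e1_def e2_def e3_def]
  have e1: "e1 = v * (\<omega> * e3)" using V(3) E(1) by (simp add: e3_def)
  have nz: "e3 \<noteq> 0" using r by (auto simp: line_re_def e3_def)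
  have "\<not> v > 0"
  proof
    assume v: "v > 0"
    have "(1 + m) * (\<omega> * c\<^sup>2) > 0" unfolding V(4) using v m mult_pos_pos[of "1 + 2 * m" v] by linarith
    hence \<omega>: "\<omega> > 0" using m by (simp add: zero_less_mult_iff)
    have "e1 * e3 = v * \<omega> * e3\<^sup>2" unfolding e1 by (simp add: power2_eq_square)
    also have "\<dots> > 0" using v \<omega> nz by simp
    finally have e13: "e1 * e3 > 0" .
    have "(m + 3) * e2 = \<omega> * (e1 * e3)" unfolding E(2) E(1) by simp
    also have "\<dots> > 0" using \<omega> e13 by simp
    finally have e2: "e2 > 0" using m by (simp add: zero_less_mult_iff)
    \<comment> \<open>The cubic equation of the positions, arranged so that the signs of the
      right-hand side and of y^2 + \<open>e2\<close> are known and that of y follows.\<close>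
    have key: "y * (y\<^sup>2 + e2) = e1 * y\<^sup>2 + e3" if "y = a \<or> y = b \<or> y = d" for y
      using that unfolding e1_def e2_def e3_def by (auto simp: algebra_simps power2_eq_square)
    have sg: "y\<^sup>2 + e2 > 0" for y :: real using e2 by (simp add: add_nonneg_pos)
    show False
    proof (cases "e1 > 0")
      case True
      hence e3: "e3 > 0" using e13 by (simp add: zero_less_mult_iff)
      have "y > 0" if "y = a \<or> y = b \<or> y = d" for y
      proof -
        have "y * (y\<^sup>2 + e2) > 0" unfolding key[OF that] using True e3 by (simp add: add_nonneg_pos)
        thus ?thesis using sg[of y] by (simp add: zero_less_mult_iff)
      qed
      thus False using s by auto
    next
      case False
      hence e1n: "e1 < 0" "e3 < 0" using e13 by (auto simp: zero_less_mult_iff)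
      have "y < 0" if "y = a \<or> y = b \<or> y = d" for y
      proof -
        have "y * (y\<^sup>2 + e2) < 0" unfolding key[OF that] using e1n
          by (intro add_nonpos_neg mult_nonpos_nonneg) auto
        thus ?thesis using sg[of y] by (simp add: mult_less_0_iff)
      qed
      thus False using s by auto
    qed
  qed
  thus ?thesis using V(2,5) by (simp add: root_II_def v_def)
qed

subsection \<open>The matrix of the linearization\<close>

lemma det_2:
  assumes "A \<in> carrier_mat 2 2"
  shows "det A = A $$ (0,0) * A $$ (1,1) - A $$ (0,1) * A $$ (1,0)"
  using assms by (subst laplace_expansion_row[OF assms, of 0])
    (auto simp: cofactor_def numeral_2_eq_2 mat_delete_def det_single)

lemma mat_delete_index':
  assumes "A \<in> carrier_mat (Suc n) (Suc n)" "a < n" "b < n"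
  shows "mat_delete A i j $$ (a, b) = A $$ (if a < i then a else Suc a, if b < j then b else Suc b)"
  using assms by (simp add: mat_delete_def)

lemma det_3:
  fixes A :: "'a :: comm_ring_1 mat"
  assumes "A \<in> carrier_mat 3 3"
  shows "det A = A $$ (0,0) * (A $$ (1,1) * A $$ (2,2) - A $$ (1,2) * A $$ (2,1))
     - A $$ (0,1) * (A $$ (1,0) * A $$ (2,2) - A $$ (1,2) * A $$ (2,0))
     + A $$ (0,2) * (A $$ (1,0) * A $$ (2,1) - A $$ (1,1) * A $$ (2,0))"
proof -
  have A: "A \<in> carrier_mat (Suc 2) (Suc 2)" using assms by simp
  have "mat_delete A i j \<in> carrier_mat 2 2" for i j using assms by (auto simp: mat_delete_def)
  note d = det_2[OF this]
  have "det A = (\<Sum>j<3. A $$ (0, j) * cofactor A 0 j)"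
    by (rule laplace_expansion_row[OF assms]) simp
  also have "\<dots> =
      A $$ (0, 0) * cofactor A 0 0 + A $$ (0, 1) * cofactor A 0 1 + A $$ (0, 2) * cofactor A 0 2"
    by (simp add: eval_nat_numeral)
  finally show ?thesis
    by (simp add: cofactor_def d mat_delete_index'[OF A] numeral_2_eq_2 algebra_simps)
qed

lemma det_4:
  fixes A :: "'a :: comm_ring_1 mat"
  assumes "A \<in> carrier_mat 4 4"
  shows "det A = 
      A $$ (0,0) * (A $$ (1,1) * (A $$ (2,2) * A $$ (3,3) - A $$ (2,3) * A $$ (3,2))
        - A $$ (1,2) * (A $$ (2,1) * A $$ (3,3) - A $$ (2,3) * A $$ (3,1))
        + A $$ (1,3) * (A $$ (2,1) * A $$ (3,2) - A $$ (2,2) * A $$ (3,1)))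
    - A $$ (0,1) * (A $$ (1,0) * (A $$ (2,2) * A $$ (3,3) - A $$ (2,3) * A $$ (3,2))
        - A $$ (1,2) * (A $$ (2,0) * A $$ (3,3) - A $$ (2,3) * A $$ (3,0))
        + A $$ (1,3) * (A $$ (2,0) * A $$ (3,2) - A $$ (2,2) * A $$ (3,0)))
    + A $$ (0,2) * (A $$ (1,0) * (A $$ (2,1) * A $$ (3,3) - A $$ (2,3) * A $$ (3,1))
        - A $$ (1,1) * (A $$ (2,0) * A $$ (3,3) - A $$ (2,3) * A $$ (3,0))
        + A $$ (1,3) * (A $$ (2,0) * A $$ (3,1) - A $$ (2,1) * A $$ (3,0)))
    - A $$ (0,3) * (A $$ (1,0) * (A $$ (2,1) * A $$ (3,2) - A $$ (2,2) * A $$ (3,1))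
        - A $$ (1,1) * (A $$ (2,0) * A $$ (3,2) - A $$ (2,2) * A $$ (3,0))
        + A $$ (1,2) * (A $$ (2,0) * A $$ (3,1) - A $$ (2,1) * A $$ (3,0)))"
proof -
  have A: "A \<in> carrier_mat (Suc 3) (Suc 3)" using assms by simp
  have "mat_delete A i j \<in> carrier_mat 3 3" for i j using assms by (auto simp: mat_delete_def)
  note d = det_3[OF this]
  have "det A = (\<Sum>j<4. A $$ (0, j) * cofactor A 0 j)"
    by (rule laplace_expansion_row[OF assms]) simp
  also have "\<dots> =
      A $$ (0, 0) * cofactor A 0 0 + A $$ (0, 1) * cofactor A 0 1 + A $$ (0, 2) * cofactor A 0 2
      + A $$ (0, 3) * cofactor A 0 3"
    by (simp add: eval_nat_numeral)
  finally show ?thesis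
    by (simp add: cofactor_def d mat_delete_index'[OF A] numeral_2_eq_2 numeral_3_eq_3 algebra_simps)
qed

section \<open>The matrix A as a weighted Laplacian\<close>

lemma A_mat_carrier [simp]: "A_mat m \<omega> x \<in> carrier_mat 4 4"
  by (simp add: A_mat_def)

lemma A_mat_mult_vec_index:
  assumes i: "i < 4"
  shows "(A_mat m \<omega> x *\<^sub>v vec 4 f) $ i =
     (\<Sum>k\<in>{1..4} - {i + 1}. circ m k * (f i - f (k - 1)) / (\<omega> * (x (i + 1) - x k)\<^sup>2))"
proof -
  define w where "w k = A_offdiag m \<omega> x (i + 1) k" for k
  have w: "w k = - (circ m k / (\<omega> * (x (i + 1) - x k)\<^sup>2))" for k
    by (simp add: w_def A_offdiag_def dist_prod_def dist_real_def)
  have "(A_mat m \<omega> x *\<^sub>v vec 4 f) $ i = (\<Sum>j\<in>{0..<4}. A_mat m \<omega> x $$ (i, j) * f j)"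
    using i by (simp add: A_mat_def scalar_prod_def)
  also have "\<dots> = (\<Sum>j\<in>{0..<4}. (if i \<noteq> j then w (j + 1) else - (\<Sum>k\<in>{1..4} - {i + 1}. w k)) * f j)"
    using i by (intro sum.cong) (auto simp: A_mat_def w_def)
  also have "\<dots> = - (\<Sum>k\<in>{1..4} - {i + 1}. w k) * f i + (\<Sum>j\<in>{0..<4} - {i}. w (j + 1) * f j)"
    using i by (subst sum.remove[of _ i]) auto
  also have "(\<Sum>j\<in>{0..<4} - {i}. w (j + 1) * f j) = (\<Sum>k\<in>{1..4} - {i + 1}. w k * f (k - 1))"
    by (rule sum.reindex_bij_witness[of _ "\<lambda>k. k - 1" "\<lambda>j. j + 1"]) auto
  finally have "(A_mat m \<omega> x *\<^sub>v vec 4 f) $ i =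
      (\<Sum>k\<in>{1..4} - {i + 1}. - w k * f i) + (\<Sum>k\<in>{1..4} - {i + 1}. w k * f (k - 1))"
    by (simp add: sum_distrib_right sum_negf)
  also have "\<dots> = (\<Sum>k\<in>{1..4} - {i + 1}. - w k * f i + w k * f (k - 1))"
    by (rule sum.distrib[symmetric])
  also have "\<dots> = (\<Sum>k\<in>{1..4} - {i + 1}. circ m k * (f i - f (k - 1)) / (\<omega> * (x (i + 1) - x k)\<^sup>2))"
    by (intro sum.cong) (simp_all add: w algebra_simps diff_divide_distrib)
  finally show ?thesis .
qed

lemma A_mat_mult_vec_4:
  "A_mat m \<omega> x *\<^sub>v vec 4 f = vec 4 (\<lambda>i. 1 / \<omega> * (
     if i = 0 then (f 0 - f 1) / (x 1 - x 2)\<^sup>2 + (f 0 - f 2) / (x 1 - x 3)\<^sup>2 + m * (f 0 - f 3) / (x 1 - x 4)\<^sup>2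
     else if i = 1 then (f 1 - f 0) / (x 1 - x 2)\<^sup>2 + (f 1 - f 2) / (x 2 - x 3)\<^sup>2 + m * (f 1 - f 3) / (x 2 - x 4)\<^sup>2
     else if i = 2 then (f 2 - f 0) / (x 1 - x 3)\<^sup>2 + (f 2 - f 1) / (x 2 - x 3)\<^sup>2 + m * (f 2 - f 3) / (x 3 - x 4)\<^sup>2
     else (f 3 - f 0) / (x 1 - x 4)\<^sup>2 + (f 3 - f 1) / (x 2 - x 4)\<^sup>2 + (f 3 - f 2) / (x 3 - x 4)\<^sup>2))"
  (is "_ = vec 4 ?g")
proof (rule eq_vecI)
  fix i :: nat assume "i < dim_vec (vec 4 ?g)"
  hence i: "i < 4" by simp
  have sets: "{1..4} - {0 + 1::nat} = {2, 3, 4}" "{1..4} - {1 + 1::nat} = {1, 3, 4}"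
    "{1..4} - {2 + 1::nat} = {1, 2, 4}" "{1..4} - {3 + 1::nat} = {1, 2, 3}" by auto
  have "i = 0 \<or> i = 1 \<or> i = 2 \<or> i = 3" using i by auto
  hence "(A_mat m \<omega> x *\<^sub>v vec 4 f) $ i = ?g i"
  proof (elim disjE)
    assume i': "i = 0"
    show ?thesis unfolding A_mat_mult_vec_index[OF i] unfolding i' sets
      by (simp add: circ_def distrib_left eval_nat_numeral)
  next
    assume i': "i = 1"
    show ?thesis unfolding A_mat_mult_vec_index[OF i] unfolding i' sets
      by (simp add: circ_def distrib_left numeral_2_eq_2[symmetric] power2_commute[of "x 2"])
  next
    assume i': "i = 2"
    show ?thesis unfolding A_mat_mult_vec_index[OF i] unfolding i' sets
      by (simp add: circ_def distrib_left power2_commute[of "x 3"])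
  next
    assume i': "i = 3"
    show ?thesis unfolding A_mat_mult_vec_index[OF i] unfolding i' sets
      by (simp add: circ_def distrib_left power2_commute[of "x 4"])
  qed
  thus "(A_mat m \<omega> x *\<^sub>v vec 4 f) $ i = vec 4 ?g $ i" using i by simp
qed (simp add: A_mat_def)

section \<open>The equations of motion on a line\<close>

lemma center_of_vorticity_line:
  "center_of_vorticity (circ m) (\<lambda>i. (x i, 0)) = ((x 1 + x 2 + x 3 + m * x 4) / (m + 3), 0)"
proof -
  have s: "{1..4::nat} = {1, 2, 3, 4}" by auto
  have "(\<Sum>i\<in>{1..4}. circ m i) = m + 3" unfolding s by (simp add: circ_def)
  moreover have "(\<Sum>i\<in>{1..4}. circ m i *\<^sub>R (x i, 0::real)) = (x 1 + x 2 + x 3 + m * x 4, 0)"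
    unfolding s by (simp add: circ_def)
  ultimately show ?thesis unfolding center_of_vorticity_def by simp
qed

lemma inj_on_1_4:
  "inj_on f {1..4::nat} \<longleftrightarrow> f 1 \<noteq> f 2 \<and> f 1 \<noteq> f 3 \<and> f 1 \<noteq> f 4 \<and> f 2 \<noteq> f 3 \<and> f 2 \<noteq> f 4 \<and> f 3 \<noteq> f 4"
proof -
  have s: "{1..4::nat} = {1, 2, 3, 4}" by auto
  show ?thesis unfolding s inj_on_def by auto
qed

lemma relative_equilibrium_line_iff:
  assumes m: "m \<noteq> -3"
  defines "c \<equiv> \<lambda>x. (x 1 + x 2 + x 3 + m * x 4) / (m + 3)"
  shows "relative_equilibrium (circ m) \<omega> (\<lambda>i. (x i, 0)) \<longleftrightarrow>
    \<omega> \<noteq> 0 \<and> inj_on x {1..4} \<and>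
    \<omega> * (x 1 - c x) = 1 / (x 1 - x 2) + 1 / (x 1 - x 3) + m / (x 1 - x 4) \<and>
    \<omega> * (x 2 - c x) = 1 / (x 2 - x 1) + 1 / (x 2 - x 3) + m / (x 2 - x 4) \<and>
    \<omega> * (x 3 - c x) = 1 / (x 3 - x 1) + 1 / (x 3 - x 2) + m / (x 3 - x 4) \<and>
    \<omega> * (x 4 - c x) = 1 / (x 4 - x 1) + 1 / (x 4 - x 2) + 1 / (x 4 - x 3)"
proof -
  have s: "{1..4::nat} = {1, 2, 3, 4}" by auto
  have cv: "center_of_vorticity (circ m) (\<lambda>i. (x i, 0)) = (c x, 0)"
    unfolding c_def by (rule center_of_vorticity_line)
  \<comment> \<open>For u = v both sides are 0 by the convention for division, so \<open>row\<close>
    holds without a distinctness hypothesis.\<close>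
  have inv: "g * (v - u) / (dist (u, 0::real) (v, 0))\<^sup>2 = - (g / (u - v))" for g u v :: real
  proof (cases "u = v")
    case False
    hence "g * (v - u) / (u - v)\<^sup>2 = - (g / (u - v))"
      by (simp add: power2_eq_square divide_simps) (simp add: algebra_simps)
    thus ?thesis by (simp add: dist_prod_def dist_real_def)
  qed simp
  have row: "- \<omega> *\<^sub>R ((u, 0::real) - (c x, 0)) = (\<Sum>j\<in>J. (circ m j / (dist (u, 0::real) (x j, 0))\<^sup>2) *\<^sub>R ((x j, 0) - (u, 0)))
    \<longleftrightarrow> \<omega> * (u - c x) = (\<Sum>j\<in>J. circ m j / (u - x j))" for u J
  proof -
    have *: "(\<Sum>j\<in>J. (circ m j / (dist (u, 0::real) (x j, 0))\<^sup>2) *\<^sub>R ((x j, 0::real) - (u, 0)))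
      = (- (\<Sum>j\<in>J. circ m j / (u - x j)), 0)"
      using inv by (simp add: prod_eq_iff fst_sum snd_sum sum_negf)
    show ?thesis unfolding * by (auto simp: prod_eq_iff algebra_simps)
  qed
  have J: "{1..4} - {1::nat} = {2, 3, 4}" "{1..4} - {2::nat} = {1, 3, 4}"
    "{1..4} - {3::nat} = {1, 2, 4}" "{1..4} - {4::nat} = {1, 2, 3}" by auto
  have inj: "inj_on (\<lambda>i. (x i, 0::real)) {1..4} = inj_on x {1..4}" by (simp add: inj_on_def)
  have ball: "(\<forall>i\<in>{1..4}. Q i) \<longleftrightarrow> Q 1 \<and> Q 2 \<and> Q 3 \<and> Q 4" for Q :: "nat \<Rightarrow> bool"
    unfolding s by simp
  show ?thesis unfolding relative_equilibrium_def cv row inj ball J by (simp add: circ_def add.assoc)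
qed

lemma collinear_re_line_re:
  assumes r: "collinear_re m \<omega> x" and m: "m > -3"
  shows "line_re m \<omega> (fst (center_of_vorticity (circ m) (\<lambda>i. (x i, 0))) - x 4) (x 1 - x 4) (x 2 - x 4) (x 3 - x 4)"
proof -
  define c where "c = (x 1 + x 2 + x 3 + m * x 4) / (m + 3)"
  have cv: "fst (center_of_vorticity (circ m) (\<lambda>i. (x i, 0))) = c"
    unfolding c_def by (simp only: center_of_vorticity_line fst_conv)
  have c: "(m + 3) * c = x 1 + x 2 + x 3 + m * x 4" using m by (simp add: c_def)
  have m': "m \<noteq> -3" using m by simp
  have R: "relative_equilibrium (circ m) \<omega> (\<lambda>i. (x i, 0))" using r by (simp add: collinear_re_def)
  note R = R[unfolded relative_equilibrium_line_iff[OF m'], folded c_def]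
  have inj: "x 1 \<noteq> x 2" "x 1 \<noteq> x 3" "x 1 \<noteq> x 4" "x 2 \<noteq> x 3" "x 2 \<noteq> x 4" "x 3 \<noteq> x 4"
    using R unfolding inj_on_1_4 by blast+
  have "1 / (x 4 - x k) = - (1 / (x k - x 4))" for k
    by (metis minus_diff_eq minus_divide_right)
  hence "\<omega> * (c - x 4) = 1 / (x 1 - x 4) + 1 / (x 2 - x 4) + 1 / (x 3 - x 4)"
    using R by (simp add: algebra_simps)
  moreover have "(m + 3) * (c - x 4) = (x 1 - x 4) + (x 2 - x 4) + (x 3 - x 4)"
    using c by (simp add: algebra_simps)
  ultimately show ?thesis using R inj by (simp add: line_re_def cv)
qed

section \<open>A basis adapted to the equations of motion\<close>

definition vec4 :: "'a \<Rightarrow> 'a \<Rightarrow> 'a \<Rightarrow> 'a \<Rightarrow> 'a vec" where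
  "vec4 p q r s = vec 4 (\<lambda>i. if i = 0 then p else if i = 1 then q else if i = 2 then r else s)"

lemma vec4_simps [simp]:
  "dim_vec (vec4 p q r s) = 4" "vec4 p q r s $ 0 = p" "vec4 p q r s $ 1 = q" "vec4 p q r s $ Suc 0 = q"
  "vec4 p q r s $ 2 = r" "vec4 p q r s $ 3 = s"  "vec4 p q r s \<in> carrier_vec 4"
  by (simp_all add: vec4_def)

lemma vec4_cong: "p = p' \<Longrightarrow> q = q' \<Longrightarrow> r = r' \<Longrightarrow> s = s' \<Longrightarrow> vec4 p q r s = vec4 p' q' r' s'"
  by simp

lemma A_mat_mult_vec4:
  "A_mat m \<omega> x *\<^sub>v vec4 p q r s = vec4
     (1 / \<omega> * ((p - q) / (x 1 - x 2)\<^sup>2 + (p - r) / (x 1 - x 3)\<^sup>2 + m * (p - s) / (x 1 - x 4)\<^sup>2))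
     (1 / \<omega> * ((q - p) / (x 1 - x 2)\<^sup>2 + (q - r) / (x 2 - x 3)\<^sup>2 + m * (q - s) / (x 2 - x 4)\<^sup>2))
     (1 / \<omega> * ((r - p) / (x 1 - x 3)\<^sup>2 + (r - q) / (x 2 - x 3)\<^sup>2 + m * (r - s) / (x 3 - x 4)\<^sup>2))
     (1 / \<omega> * ((s - p) / (x 1 - x 4)\<^sup>2 + (s - q) / (x 2 - x 4)\<^sup>2 + (s - r) / (x 3 - x 4)\<^sup>2))"
  unfolding vec4_def A_mat_mult_vec_4 by (intro arg_cong[where f = "vec 4"] ext) simp

definition node_mat :: "real \<Rightarrow> real \<Rightarrow> real \<Rightarrow> real mat" where
  "node_mat a b d = mat_of_cols 4 [vec4 1 1 1 1, vec4 a b d 0, vec4 (a\<^sup>2) (b\<^sup>2) (d\<^sup>2) 0, vec4 0 0 0 1]"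

lemma node_mat_mult_vec4:
  "node_mat a b d *\<^sub>v vec4 p q r s =
     vec4 (p + q * a + r * a\<^sup>2) (p + q * b + r * b\<^sup>2) (p + q * d + r * d\<^sup>2) (p + s)"
proof (rule eq_vecI)
  fix i :: nat assume "i < dim_vec (vec4 (p + q * a + r * a\<^sup>2) (p + q * b + r * b\<^sup>2) (p + q * d + r * d\<^sup>2) (p + s))"
  hence "i = 0 \<or> i = 1 \<or> i = 2 \<or> i = 3" by auto
  moreover have "{0..<4::nat} = {0, 1, 2, 3}" by auto
  ultimately show "(node_mat a b d *\<^sub>v vec4 p q r s) $ i =
     vec4 (p + q * a + r * a\<^sup>2) (p + q * b + r * b\<^sup>2) (p + q * d + r * d\<^sup>2) (p + s) $ i"
    by (auto simp: node_mat_def scalar_prod_def mat_of_cols_index)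
qed (simp add: node_mat_def)

lemma node_mat_carrier [simp]: "node_mat a b d \<in> carrier_mat 4 4"
  by (rule carrier_matI) (simp_all add: node_mat_def)

text \<open>Expansion along the indicator column leaves the Vandermonde determinant of a, b, d;
  distinct positions therefore give a basis.\<close>

lemma det_node_mat: "det (node_mat a b d) = (b - a) * (d - a) * (d - b)"
  unfolding det_4[OF node_mat_carrier]
  by (simp add: node_mat_def mat_of_cols_index) (simp add: algebra_simps power2_eq_square)

text \<open>The columns of \<open>node_mat\<close> sample \<open>1\<close>, \<open>y\<close>, \<open>y\<^sup>2\<close> at the vortices and the indicator of vortex 4;
  the equations of a relative equilibrium make the action of \<open>A\<close> on them explicit. The last column
  comes from interpolating \<open>1 / y\<^sup>2\<close> at the three nonzero positions by a quadratic polynomial.\<close>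

definition model_mat :: "real \<Rightarrow> real \<Rightarrow> real \<Rightarrow> real \<Rightarrow> real \<Rightarrow> real \<Rightarrow> real \<Rightarrow> real mat" where
  "model_mat m \<omega> c \<alpha> \<beta> \<gamma> \<kappa> = mat_of_cols 4 [vec4 0 0 0 0, vec4 (- c) 1 0 0,
     vec4 (- ((m + 2) / \<omega>)) (- 2 * c) 2 ((m - 1) / \<omega>), vec4 \<alpha> \<beta> \<gamma> \<kappa>]"

lemma model_mat_carrier [simp]: "model_mat m \<omega> c \<alpha> \<beta> \<gamma> \<kappa> \<in> carrier_mat 4 4"
  by (rule carrier_matI) (simp_all add: model_mat_def)

text \<open>The weights of the Laplacian contain 1 / (u - v)^2. Constants are killed; on y the
  weights leave 1 / (u - v), hence the force equation; on y^2 they leave 2 * u / (u - v) - 1, hence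
  the force equation times 2 * u. The value of \<kappa> is read off from the row of vortex
  4.\<close>

lemma A_mat_mult_node_mat:
  assumes r: "line_re m \<omega> c a b d" and x: "x 1 - x 4 = a" "x 2 - x 4 = b" "x 3 - x 4 = d"
  defines "e1 \<equiv> a + b + d" and "e2 \<equiv> a * b + a * d + b * d" and "e3 \<equiv> a * b * d"
  defines "\<alpha> \<equiv> - (m / \<omega>) * (\<omega> * c * e2 - e1) / e3"
    and "\<beta> \<equiv> - (m / \<omega>) * (1 - \<omega> * c * e1) / e3"
    and "\<gamma> \<equiv> - (m / \<omega>) * (\<omega> * c) / e3"
  defines "\<kappa> \<equiv> 1 / \<omega> * (1 / a\<^sup>2 + 1 / b\<^sup>2 + 1 / d\<^sup>2) - \<alpha>"
  shows "A_mat m \<omega> x * node_mat a b d = node_mat a b d * model_mat m \<omega> c \<alpha> \<beta> \<gamma> \<kappa>"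
proof -
  note r' = r[unfolded line_re_def]
  have nz: "\<omega> \<noteq> 0" "a \<noteq> 0" "b \<noteq> 0" "d \<noteq> 0" "a - b \<noteq> 0" "a - d \<noteq> 0" "b - d \<noteq> 0" using r' by auto
  have df: "x 1 - x 2 = a - b" "x 1 - x 3 = a - d" "x 2 - x 3 = b - d" using x by auto
  define p q s where "p = 1 / (a - b)" and "q = 1 / (a - d)" and "s = 1 / (b - d)"
  have neg: "1 / (b - a) = - p" "1 / (d - a) = - q" "1 / (d - b) = - s"
    unfolding p_def q_def s_def by (simp_all add: minus_divide_right)
  have F: "p + q + m / a = \<omega> * (a - c)" "- p + s + m / b = \<omega> * (b - c)"
    "- q - s + m / d = \<omega> * (d - c)" "1 / a + 1 / b + 1 / d = \<omega> * c"
    using r' unfolding neg by (simp_all add: p_def q_def s_def)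
  have quo: "(u - v) / (u - v)\<^sup>2 = 1 / (u - v)" "(v - u) / (u - v)\<^sup>2 = - (1 / (u - v))"
    "u - v \<noteq> 0 \<Longrightarrow> (u\<^sup>2 - v\<^sup>2) / (u - v)\<^sup>2 = 2 * u * (1 / (u - v)) - 1"
    "u - v \<noteq> 0 \<Longrightarrow> (v\<^sup>2 - u\<^sup>2) / (u - v)\<^sup>2 = - (2 * v * (1 / (u - v))) - 1" for u v :: real
    by (auto simp: power2_eq_square divide_simps) (simp_all add: algebra_simps)
  have mq: "m * y / y\<^sup>2 = m / y" "m * y\<^sup>2 / y\<^sup>2 = m" "y / y\<^sup>2 = 1 / y" "y\<^sup>2 / y\<^sup>2 = 1"
    if "y \<noteq> 0" for y using that by (simp_all add: power2_eq_square)
  have col1: "A_mat m \<omega> x *\<^sub>v vec4 1 1 1 1 = vec4 0 0 0 0"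
    by (simp add: A_mat_mult_vec4)
  have div: "1 / \<omega> * t = s \<longleftrightarrow> t = \<omega> * s" for t s using nz(1) by (auto simp: field_simps)
  have "1 / \<omega> * ((a - b) / (a - b)\<^sup>2 + (a - d) / (a - d)\<^sup>2 + m * (a - 0) / a\<^sup>2) = a - c"
    "1 / \<omega> * ((b - a) / (a - b)\<^sup>2 + (b - d) / (b - d)\<^sup>2 + m * (b - 0) / b\<^sup>2) = b - c"
    "1 / \<omega> * ((d - a) / (a - d)\<^sup>2 + (d - b) / (b - d)\<^sup>2 + m * (d - 0) / d\<^sup>2) = d - c"
    "1 / \<omega> * ((0 - a) / a\<^sup>2 + (0 - b) / b\<^sup>2 + (0 - d) / d\<^sup>2) = - c"
    unfolding div using F nz by (simp_all add: quo mq flip: p_def q_def s_def)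
  hence col2: "A_mat m \<omega> x *\<^sub>v vec4 a b d 0 = vec4 (a - c) (b - c) (d - c) (- c)"
    unfolding A_mat_mult_vec4 x df by (simp only:)
  have sq: "2 * y * P - 1 + (2 * y * Q - 1) + m = \<omega> * (2 * y\<^sup>2 - 2 * c * y - (m + 2) / \<omega>)"
    if "P + Q + m / y = \<omega> * (y - c)" "y \<noteq> 0" for y P Q
  proof -
    have "2 * y * P - 1 + (2 * y * Q - 1) + m = 2 * y * (P + Q + m / y) - m - 2"
      using that(2) by (simp add: algebra_simps)
    also have "\<dots> = \<omega> * (2 * y\<^sup>2 - 2 * c * y - (m + 2) / \<omega>)"
      unfolding that(1) using nz(1) by (simp add: right_diff_distrib power2_eq_square)
    finally show ?thesis .
  qed
  have "1 / \<omega> * ((a\<^sup>2 - b\<^sup>2) / (a - b)\<^sup>2 + (a\<^sup>2 - d\<^sup>2) / (a - d)\<^sup>2 + m * (a\<^sup>2 - 0) / a\<^sup>2) = 2 * a\<^sup>2 - 2 * c * a - (m + 2) / \<omega>"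
    "1 / \<omega> * ((b\<^sup>2 - a\<^sup>2) / (a - b)\<^sup>2 + (b\<^sup>2 - d\<^sup>2) / (b - d)\<^sup>2 + m * (b\<^sup>2 - 0) / b\<^sup>2) = 2 * b\<^sup>2 - 2 * c * b - (m + 2) / \<omega>"
    "1 / \<omega> * ((d\<^sup>2 - a\<^sup>2) / (a - d)\<^sup>2 + (d\<^sup>2 - b\<^sup>2) / (b - d)\<^sup>2 + m * (d\<^sup>2 - 0) / d\<^sup>2) = 2 * d\<^sup>2 - 2 * c * d - (m + 2) / \<omega>"
    "1 / \<omega> * ((0 - a\<^sup>2) / a\<^sup>2 + (0 - b\<^sup>2) / b\<^sup>2 + (0 - d\<^sup>2) / d\<^sup>2) = - 3 / \<omega>"
    unfolding div diff_0_right
    unfolding quo(3)[OF nz(5)] quo(3)[OF nz(6)] quo(3)[OF nz(7)] quo(4)[OF nz(5)] quo(4)[OF nz(6)] quo(4)[OF nz(7)]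
      mq(2)[OF nz(2)] mq(2)[OF nz(3)] mq(2)[OF nz(4)] p_def[symmetric] q_def[symmetric] s_def[symmetric]
    using sq[OF F(1) nz(2)] sq[OF F(2) nz(3)] sq[OF F(3)[unfolded diff_conv_add_uminus[of "- q" s]] nz(4)] nz
    by simp_all
  hence col3: "A_mat m \<omega> x *\<^sub>v vec4 (a\<^sup>2) (b\<^sup>2) (d\<^sup>2) 0 =
     vec4 (2 * a\<^sup>2 - 2 * c * a - (m + 2) / \<omega>) (2 * b\<^sup>2 - 2 * c * b - (m + 2) / \<omega>)
       (2 * d\<^sup>2 - 2 * c * d - (m + 2) / \<omega>) (- 3 / \<omega>)"
    unfolding A_mat_mult_vec4 x df by (simp only:)
  have e2: "e2 = \<omega> * c * e3" unfolding e2_def e3_def by (rule line_re_symmetric_functions[OF r])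
  have e3: "e3 \<noteq> 0" using nz by (simp add: e3_def)
  \<comment> \<open>The cubic satisfied by y, together with \<open>e2 = \<omega> * c * e3\<close>,
    reduces 1 / y^2 to a quadratic polynomial in y.\<close>
  have inter: "- (m / \<omega>) * (1 / y\<^sup>2) = \<alpha> + \<beta> * y + \<gamma> * y\<^sup>2" if "y = a \<or> y = b \<or> y = d" for y
  proof -
    have y: "y \<noteq> 0" using that nz by auto
    have cub: "y ^ 3 - e1 * y\<^sup>2 + e2 * y = e3"
      using that unfolding e1_def e2_def e3_def by (auto simp: algebra_simps eval_nat_numeral)
    define \<sigma> where "\<sigma> = \<omega> * c"
    have "((\<sigma> * e2 - e1) + (1 - \<sigma> * e1) * y + \<sigma> * y\<^sup>2) * y\<^sup>2
      = \<sigma> * y * (y ^ 3 - e1 * y\<^sup>2 + e2 * y) + (y ^ 3 - e1 * y\<^sup>2)"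
      by (simp add: algebra_simps eval_nat_numeral)
    also have "\<sigma> * y * (y ^ 3 - e1 * y\<^sup>2 + e2 * y) = e2 * y" unfolding cub unfolding e2 by (simp add: \<sigma>_def)
    also have "e2 * y + (y ^ 3 - e1 * y\<^sup>2) = e3" using cub by simp
    finally have "(\<sigma> * e2 - e1) + (1 - \<sigma> * e1) * y + \<sigma> * y\<^sup>2 = e3 * (1 / y\<^sup>2)" using y by (simp add: field_simps)
    hence "1 / y\<^sup>2 = ((\<sigma> * e2 - e1) + (1 - \<sigma> * e1) * y + \<sigma> * y\<^sup>2) / e3" using e3 by simp
    thus ?thesis unfolding \<alpha>_def \<beta>_def \<gamma>_def \<sigma>_def
      by (simp only: add_divide_distrib distrib_left times_divide_eq_right times_divide_eq_left mult.assoc)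
  qed
  have "1 / \<omega> * ((0 - 0) / (a - b)\<^sup>2 + (0 - 0) / (a - d)\<^sup>2 + m * (0 - 1) / a\<^sup>2) = \<alpha> + \<beta> * a + \<gamma> * a\<^sup>2"
    "1 / \<omega> * ((0 - 0) / (a - b)\<^sup>2 + (0 - 0) / (b - d)\<^sup>2 + m * (0 - 1) / b\<^sup>2) = \<alpha> + \<beta> * b + \<gamma> * b\<^sup>2"
    "1 / \<omega> * ((0 - 0) / (a - d)\<^sup>2 + (0 - 0) / (b - d)\<^sup>2 + m * (0 - 1) / d\<^sup>2) = \<alpha> + \<beta> * d + \<gamma> * d\<^sup>2"
    "1 / \<omega> * ((1 - 0) / a\<^sup>2 + (1 - 0) / b\<^sup>2 + (1 - 0) / d\<^sup>2) = \<alpha> + \<kappa>"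
    using inter[of a, symmetric] inter[of b, symmetric] inter[of d, symmetric] by (simp_all add: \<kappa>_def)
  hence col4: "A_mat m \<omega> x *\<^sub>v vec4 0 0 0 1 =
     vec4 (\<alpha> + \<beta> * a + \<gamma> * a\<^sup>2) (\<alpha> + \<beta> * b + \<gamma> * b\<^sup>2) (\<alpha> + \<beta> * d + \<gamma> * d\<^sup>2) (\<alpha> + \<kappa>)"
    unfolding A_mat_mult_vec4 x df by (simp only:)
  have nc: "col (node_mat a b d) 0 = vec4 1 1 1 1" "col (node_mat a b d) 1 = vec4 a b d 0"
     "col (node_mat a b d) 2 = vec4 (a\<^sup>2) (b\<^sup>2) (d\<^sup>2) 0" "col (node_mat a b d) 3 = vec4 0 0 0 1"
    by (simp_all add: node_mat_def)
  have mc: "col (model_mat m \<omega> c \<alpha> \<beta> \<gamma> \<kappa>) 0 = vec4 0 0 0 0" "col (model_mat m \<omega> c \<alpha> \<beta> \<gamma> \<kappa>) 1 = vec4 (- c) 1 0 0"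
     "col (model_mat m \<omega> c \<alpha> \<beta> \<gamma> \<kappa>) 2 = vec4 (- ((m + 2) / \<omega>)) (- 2 * c) 2 ((m - 1) / \<omega>)"
     "col (model_mat m \<omega> c \<alpha> \<beta> \<gamma> \<kappa>) 3 = vec4 \<alpha> \<beta> \<gamma> \<kappa>"
    by (simp_all add: model_mat_def)
  \<comment> \<open>In the row of vortex 4 the y^2 column yields -3 / \<omega>, while the constant
    term contributes only -(m + 2) / \<omega>; the indicator column supplies the difference.\<close>
  have last: "- 3 / \<omega> = - ((m + 2) / \<omega>) + (m - 1) / \<omega>"
    by (simp add: add_divide_distrib diff_divide_distrib)
  show ?thesis
  proof (rule mat_col_eqI)
    fix j assume "j < dim_col (node_mat a b d * model_mat m \<omega> c \<alpha> \<beta> \<gamma> \<kappa>)"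
    hence j: "j < 4" by (simp add: model_mat_def)
    hence "j = 0 \<or> j = 1 \<or> j = 2 \<or> j = 3" by auto
    hence "A_mat m \<omega> x *\<^sub>v col (node_mat a b d) j = node_mat a b d *\<^sub>v col (model_mat m \<omega> c \<alpha> \<beta> \<gamma> \<kappa>) j"
    proof (elim disjE)
      assume "j = 0" thus ?thesis by (simp only: nc mc node_mat_mult_vec4 col1) simp
    next
      assume "j = 1" thus ?thesis by (simp only: nc mc node_mat_mult_vec4 col2) simp
    next
      assume "j = 2" thus ?thesis
        by (simp only: nc mc node_mat_mult_vec4 col3 last) (intro vec4_cong; simp)
    next
      assume "j = 3" thus ?thesis by (simp only: nc mc node_mat_mult_vec4 col4)
    qed
    thus "col (A_mat m \<omega> x * node_mat a b d) j = col (node_mat a b d * model_mat m \<omega> c \<alpha> \<beta> \<gamma> \<kappa>) j"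
      using j by (simp add: col_mult2[of _ 4 4 _ 4])
  qed (auto simp: A_mat_def node_mat_def model_mat_def)
qed

text \<open>The matrix is block triangular: diagonal entries 0 and 1, followed by the block acting
  on y^2 and the indicator of vortex 4.\<close>

lemma det_model_mat:
  "det (t \<cdot>\<^sub>m 1\<^sub>m 4 - model_mat m \<omega> c \<alpha> \<beta> \<gamma> \<kappa>) =
     t * (t - 1) * (t\<^sup>2 - (2 + \<kappa>) * t + (2 * \<kappa> - \<gamma> * ((m - 1) / \<omega>)))"
proof -
  have c: "t \<cdot>\<^sub>m 1\<^sub>m 4 - model_mat m \<omega> c \<alpha> \<beta> \<gamma> \<kappa> \<in> carrier_mat 4 4"
    by (rule minus_carrier_mat) simp
  show ?thesis unfolding det_4[OF c]
    by (simp add: model_mat_def mat_of_cols_index) (simp add: algebra_simps power2_eq_square)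
qed

text \<open>\<open>A_mat\<close> and \<open>model_mat\<close> are similar through
  \<open>node_mat\<close>, so it remains to express \<kappa> and \<gamma> by v.\<close>

lemma det_A_mat:
  assumes r: "line_re m \<omega> c a b d" and x: "x 1 - x 4 = a" "x 2 - x 4 = b" "x 3 - x 4 = d" and m: "m > -1"
  defines "v \<equiv> shape_param \<omega> a b d"
  shows "det (t \<cdot>\<^sub>m 1\<^sub>m 4 - A_mat m \<omega> x) = t * (t - 1) * (t\<^sup>2 - mu_sum m v * t + mu_prod m v)"
proof -
  define e1 e2 e3 where "e1 = a + b + d" and "e2 = a * b + a * d + b * d" and "e3 = a * b * d"
  define \<alpha> \<beta> \<gamma> where "\<alpha> = - (m / \<omega>) * (\<omega> * c * e2 - e1) / e3"
    and "\<beta> = - (m / \<omega>) * (1 - \<omega> * c * e1) / e3"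
    and "\<gamma> = - (m / \<omega>) * (\<omega> * c) / e3"
  define \<kappa> where "\<kappa> = 1 / \<omega> * (1 / a\<^sup>2 + 1 / b\<^sup>2 + 1 / d\<^sup>2) - \<alpha>"
  let ?A = "A_mat m \<omega> x" and ?N = "node_mat a b d" and ?C = "model_mat m \<omega> c \<alpha> \<beta> \<gamma> \<kappa>" and ?t = "t \<cdot>\<^sub>m 1\<^sub>m 4"
  have AN: "?A * ?N = ?N * ?C"
    using A_mat_mult_node_mat[OF r x] unfolding \<kappa>_def \<alpha>_def \<beta>_def \<gamma>_def e1_def e2_def e3_def .
  have "(?t - ?A) * ?N = ?N * (?t - ?C)"
  proof -
    have "(?t - ?A) * ?N = ?t * ?N - ?A * ?N"
      by (rule minus_mult_distrib_mat[of _ 4 4 _ _ 4]) simp_all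
    also have "?t * ?N = ?N * ?t"
      by (simp add: mult_smult_assoc_mat[of _ 4 4 _ 4] mult_smult_distrib[of _ 4 4 _ 4]
          left_mult_one_mat[of _ 4 4] right_mult_one_mat[of _ 4 4])
    also have "?N * ?t - ?A * ?N = ?N * (?t - ?C)" unfolding AN
      by (rule mult_minus_distrib_mat[of _ 4 4 _ 4, symmetric]) simp_all
    finally show ?thesis .
  qed
  hence "det ((?t - ?A) * ?N) = det (?N * (?t - ?C))" by simp
  hence "det (?t - ?A) * det ?N = det ?N * det (?t - ?C)"
    by (simp add: det_mult[of _ 4] minus_carrier_mat)
  moreover have "det ?N \<noteq> 0" unfolding det_node_mat using r by (auto simp: line_re_def)
  ultimately have D: "det (?t - ?A) = det (?t - ?C)" by simp
  have nz: "\<omega> \<noteq> 0" "a \<noteq> 0" "b \<noteq> 0" "d \<noteq> 0" using r by (auto simp: line_re_def)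
  hence e3: "e3 \<noteq> 0" by (simp add: e3_def)
  note V = line_re_shape_param[OF r m, folded v_def e3_def]
  have e1: "e1 = (m + 3) * c" and e2: "e2 = \<omega> * c * e3"
    using line_re_symmetric_functions[OF r] by (simp_all add: e1_def e2_def e3_def)
  have ve: "e1 / e3 = \<omega> * v" using V(3) e1 e3 by (simp add: field_simps)
  \<comment> \<open>The sum of reciprocals is \<omega> * c, so its square delivers the sum of
    inverse squares that occurs in \<kappa>.\<close>
  have "(1 / a + 1 / b + 1 / d)\<^sup>2 = 1 / a\<^sup>2 + 1 / b\<^sup>2 + 1 / d\<^sup>2 + 2 * (e1 / e3)"
    unfolding e1_def e3_def using nz by (simp add: divide_simps) (simp add: algebra_simps eval_nat_numeral)
  hence i2: "1 / a\<^sup>2 + 1 / b\<^sup>2 + 1 / d\<^sup>2 = (\<omega> * c)\<^sup>2 - 2 * (\<omega> * v)"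
    using r by (simp add: line_re_def ve)
  have "(\<omega> * c * e2 - e1) / e3 = (\<omega> * c)\<^sup>2 - \<omega> * v"
    unfolding diff_divide_distrib ve unfolding e2 using e3 by (simp add: power2_eq_square)
  hence \<alpha>: "\<alpha> = - (m / \<omega>) * ((\<omega> * c)\<^sup>2 - \<omega> * v)" unfolding \<alpha>_def times_divide_eq_right[symmetric] by simp
  have "\<kappa> = (1 + m) * (\<omega> * c\<^sup>2) - (2 + m) * v"
    unfolding \<kappa>_def \<alpha> i2 using nz by (simp add: field_simps power2_eq_square)
  hence \<kappa>: "\<kappa> = 3 - (1 - m) * v" unfolding V(4) by (simp add: algebra_simps)
  have "c / (\<omega> * e3) = v / (m + 3)" using V(3) nz e3 m by (simp add: field_simps)
  hence \<gamma>: "\<gamma> * ((m - 1) / \<omega>) = - (m * (m - 1)) * (v / (m + 3))"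
  proof -
    have "\<gamma> * ((m - 1) / \<omega>) = - (m * (m - 1)) * (c / (\<omega> * e3))"
      unfolding \<gamma>_def using nz by (simp add: mult_ac)
    thus ?thesis unfolding \<open>c / (\<omega> * e3) = v / (m + 3)\<close> .
  qed
  have "2 + \<kappa> = mu_sum m v" by (simp add: \<kappa> mu_sum_def)
  moreover have "2 * \<kappa> - \<gamma> * ((m - 1) / \<omega>) = mu_prod m v"
    unfolding \<gamma> \<kappa> mu_prod_def using m by (simp add: field_simps)
  ultimately show ?thesis unfolding D det_model_mat by simp
qed

section \<open>From the matrix A to the spectrum of the stability matrix\<close>

lemma mat_difference_of_squares:
  fixes A :: "'a :: comm_ring_1 mat"
  assumes A: "A \<in> carrier_mat n n" and t: "t\<^sup>2 = l\<^sup>2 + 1"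
  shows "(l \<cdot>\<^sub>m 1\<^sub>m n) * (l \<cdot>\<^sub>m 1\<^sub>m n) - (A - 1\<^sub>m n) * (1\<^sub>m n + A)
    = (t \<cdot>\<^sub>m 1\<^sub>m n - A) * (t \<cdot>\<^sub>m 1\<^sub>m n + A)"
proof -
  define Q where "Q = A * A"
  have Q: "Q \<in> carrier_mat n n" unfolding Q_def by (rule mult_carrier_mat[OF A A])
  note d = carrier_matD[OF A] carrier_matD[OF Q]
  have "(A - 1\<^sub>m n) * (1\<^sub>m n + A) = A + Q - (1\<^sub>m n + A)"
    using A by (simp add: minus_mult_distrib_mat[of _ n n _ _ n] mult_add_distrib_mat[of _ n n _ n]
        left_mult_one_mat[of _ n n] right_mult_one_mat[of _ n n] Q_def)
  moreover have "(t \<cdot>\<^sub>m 1\<^sub>m n - A) * (t \<cdot>\<^sub>m 1\<^sub>m n + A) = t \<cdot>\<^sub>m (t \<cdot>\<^sub>m 1\<^sub>m n) + t \<cdot>\<^sub>m A - (t \<cdot>\<^sub>m A + Q)"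
    using A by (simp add: minus_mult_distrib_mat[of _ n n _ _ n] mult_add_distrib_mat[of _ n n _ n]
        mult_smult_assoc_mat[of _ n n _ n] mult_smult_distrib[of _ n n _ n]
        left_mult_one_mat[of _ n n] right_mult_one_mat[of _ n n] Q_def)
  moreover have "(l \<cdot>\<^sub>m 1\<^sub>m n) * (l \<cdot>\<^sub>m 1\<^sub>m n) = l \<cdot>\<^sub>m (l \<cdot>\<^sub>m (1\<^sub>m n :: 'a mat))"
    by (simp add: mult_smult_assoc_mat[of _ n n _ n] left_mult_one_mat[of _ n n])
  moreover have "t * t = l * l + 1" using t by (simp add: power2_eq_square)
  ultimately show ?thesis
    by (simp only:) (rule eq_matI, use d in auto)
qed

text \<open>The block form reduces the determinant to that of l^2 - (A - 1) * (A + 1), which factors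
  as (t - A) * (t + A) once t^2 = l^2 + 1. For real l such a t is real, so the factorization of det
  (t - A) over the reals is enough.\<close>

lemma poly_char_poly_stability_matrix:
  assumes A: "\<And>t. det (t \<cdot>\<^sub>m 1\<^sub>m 4 - A_mat m \<omega> x) = t * (t - 1) * (t\<^sup>2 - S * t + P)"
  shows "poly (char_poly (stability_matrix m \<omega> x)) l = l\<^sup>2 * (l\<^sup>2 + 1) * ((l\<^sup>2 + 1 + P)\<^sup>2 - S\<^sup>2 * (l\<^sup>2 + 1))"
proof -
  let ?A = "A_mat m \<omega> x" and ?B = "stability_matrix m \<omega> x"
  define t where "t = sqrt (l\<^sup>2 + 1)"
  have t: "t\<^sup>2 = l\<^sup>2 + 1" by (simp add: t_def)
  have B: "?B \<in> carrier_mat 8 8" unfolding stability_matrix_blocks by (rule carrier_matI) simp_all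
  have eq: "- char_matrix ?B l = four_block_mat (l \<cdot>\<^sub>m 1\<^sub>m 4) (?A - 1\<^sub>m 4) (1\<^sub>m 4 + ?A) (l \<cdot>\<^sub>m 1\<^sub>m 4)"
    unfolding stability_matrix_blocks char_matrix_def
    by (rule eq_matI) (auto simp: A_mat_def)
  have "poly (char_poly ?B) l = det (- char_matrix ?B l)" by (rule char_poly_matrix[OF B])
  also have "\<dots> = det ((l \<cdot>\<^sub>m 1\<^sub>m 4) * (l \<cdot>\<^sub>m 1\<^sub>m 4) - (?A - 1\<^sub>m 4) * (1\<^sub>m 4 + ?A))"
    unfolding eq by (rule det_four_block_mat[of _ 4]) 
      (simp_all add: mult_smult_assoc_mat[of _ 4 4 _ 4] mult_smult_distrib[of _ 4 4 _ 4]
          left_mult_one_mat[of _ 4 4] right_mult_one_mat[of _ 4 4] minus_carrier_mat)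
  also have "(l \<cdot>\<^sub>m 1\<^sub>m 4) * (l \<cdot>\<^sub>m 1\<^sub>m 4) - (?A - 1\<^sub>m 4) * (1\<^sub>m 4 + ?A) = (t \<cdot>\<^sub>m 1\<^sub>m 4 - ?A) * (t \<cdot>\<^sub>m 1\<^sub>m 4 + ?A)"
    by (rule mat_difference_of_squares[OF A_mat_carrier t])
  also have "det \<dots> = det (t \<cdot>\<^sub>m 1\<^sub>m 4 - ?A) * det (t \<cdot>\<^sub>m 1\<^sub>m 4 + ?A)"
    by (rule det_mult[of _ 4]) (simp_all add: minus_carrier_mat)
  also have "t \<cdot>\<^sub>m 1\<^sub>m 4 + ?A = (-1) \<cdot>\<^sub>m ((- t) \<cdot>\<^sub>m 1\<^sub>m 4 - ?A)"
    by (rule eq_matI) (auto simp: A_mat_def)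
  \<comment> \<open>The order 4 is even, so the sign disappears.\<close>
  also have "det \<dots> = det ((- t) \<cdot>\<^sub>m 1\<^sub>m 4 - ?A)"
    by (subst det_smult) (simp add: A_mat_def)
  also have "det (t \<cdot>\<^sub>m 1\<^sub>m 4 - ?A) * det ((- t) \<cdot>\<^sub>m 1\<^sub>m 4 - ?A) = (t\<^sup>2 - 1) * t\<^sup>2 * ((t\<^sup>2 + P)\<^sup>2 - S\<^sup>2 * t\<^sup>2)"
    unfolding A by (simp add: algebra_simps eval_nat_numeral)
  also have "\<dots> = l\<^sup>2 * (l\<^sup>2 + 1) * ((l\<^sup>2 + 1 + P)\<^sup>2 - S\<^sup>2 * (l\<^sup>2 + 1))" unfolding t by simp
  finally show ?thesis .
qed

lemma proots_linear_factors:
  fixes rs :: "'a :: idom list"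
  shows "proots (\<Prod>r\<leftarrow>rs. [:- r, 1:]) = mset rs"
proof (induction rs)
  case (Cons r rs)
  have "(\<Prod>r\<leftarrow>rs. [:- r, 1:]) \<noteq> 0" by (auto simp: prod_list_zero_iff)
  thus ?case using Cons by (simp add: proots_mult del: mult_pCons_left)
qed simp

text \<open>The complex characteristic polynomial agrees with the product of the linear factors at
  every real point, and these are infinitely many. Hence the two are equal and the multiplicities
  can be read off, coincident eigenvalues included.\<close>

lemma nontrivial_eigenvalues_eq:
  fixes \<mu>1 \<mu>2 z1 z2 :: complex
  assumes A: "\<And>t. det (t \<cdot>\<^sub>m 1\<^sub>m 4 - A_mat m \<omega> x) = t * (t - 1) * (t\<^sup>2 - S * t + P)"
    and mu: "\<mu>1 + \<mu>2 = of_real S" "\<mu>1 * \<mu>2 = of_real P" and z: "z1\<^sup>2 = \<mu>1\<^sup>2 - 1" "z2\<^sup>2 = \<mu>2\<^sup>2 - 1"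
  shows "nontrivial_eigenvalues m \<omega> x = {#z1, - z1, z2, - z2#}"
proof -
  let ?B = "stability_matrix m \<omega> x"
  let ?cp = "char_poly (map_mat complex_of_real ?B)"
  have B: "?B \<in> carrier_mat 8 8" unfolding stability_matrix_blocks by (rule carrier_matI) simp_all
  interpret of_real_hom: comm_ring_hom complex_of_real by unfold_locales simp_all
  define T where "T = (\<Prod>r\<leftarrow>[0, 0, \<i>, - \<i>, z1, - z1, z2, - z2]. [:- r, 1:])"
  have cp: "?cp = map_poly complex_of_real (char_poly ?B)"
    by (rule of_real_hom.char_poly_hom[OF B])
  have "poly ?cp (of_real l) = poly T (of_real l)" for l
  proof -
    have "poly T (of_real l) = (of_real l)\<^sup>2 * ((of_real l)\<^sup>2 - \<i>\<^sup>2) * (((of_real l)\<^sup>2 - z1\<^sup>2) * ((of_real l)\<^sup>2 - z2\<^sup>2))"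
      by (simp add: T_def algebra_simps power2_eq_square)
    also have "((of_real l)\<^sup>2 - z1\<^sup>2) * ((of_real l)\<^sup>2 - z2\<^sup>2) =
       ((of_real l)\<^sup>2 + 1 + \<mu>1 * \<mu>2)\<^sup>2 - (\<mu>1 + \<mu>2)\<^sup>2 * ((of_real l)\<^sup>2 + 1)"
      unfolding z by (simp add: algebra_simps eval_nat_numeral)
    also have "(of_real l)\<^sup>2 * ((of_real l)\<^sup>2 - \<i>\<^sup>2) * \<dots> = of_real (poly (char_poly ?B) l)"
      unfolding mu poly_char_poly_stability_matrix[OF A] by simp
    also have "\<dots> = poly ?cp (of_real l)" unfolding cp
      by (simp add: of_real_hom.poly_map_poly)
    finally show ?thesis ..
  qed
  hence "range complex_of_real \<subseteq> {z. poly (?cp - T) z = 0}" by auto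
  moreover have "infinite (range complex_of_real)"
    using finite_imageD[of complex_of_real UNIV] infinite_UNIV_char_0 by (auto simp: inj_of_real)
  ultimately have "infinite {z. poly (?cp - T) z = 0}" using finite_subset by blast
  hence "?cp - T = 0" using poly_roots_finite by blast
  hence "?cp = T" by simp
  moreover have "proots T = {#0, 0, \<i>, - \<i>#} + {#z1, - z1, z2, - z2#}"
    unfolding T_def proots_linear_factors by simp
  ultimately show ?thesis unfolding nontrivial_eigenvalues_def by simp
qed

subsection \<open>Configurations of the two eigenvalues\<close>

definition mu_max :: "real \<Rightarrow> real \<Rightarrow> real" where
  "mu_max m v = (mu_sum m v + sqrt (mu_disc m v)) / 2"

definition mu_min :: "real \<Rightarrow> real \<Rightarrow> real" where
  "mu_min m v = (mu_sum m v - sqrt (mu_disc m v)) / 2"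

lemma mu_max_min:
  assumes "mu_disc m v \<ge> 0"
  shows "mu_max m v + mu_min m v = mu_sum m v" "mu_max m v * mu_min m v = mu_prod m v" "mu_min m v \<le> mu_max m v"
    "mu_disc m v > 0 \<Longrightarrow> mu_min m v < mu_max m v"
proof -
  show "mu_max m v + mu_min m v = mu_sum m v" by (simp add: mu_max_def mu_min_def field_simps)
  have "mu_max m v * mu_min m v = ((mu_sum m v)\<^sup>2 - (sqrt (mu_disc m v))\<^sup>2) / 4"
    by (simp add: mu_max_def mu_min_def field_simps power2_eq_square)
  also have "\<dots> = mu_prod m v" using assms by (simp add: mu_disc_def)
  finally show "mu_max m v * mu_min m v = mu_prod m v" .
qed (use assms in \<open>auto simp: mu_max_def mu_min_def\<close>)

text \<open>The quantity 1 - \<open>mu_sum\<close> + \<open>mu_prod\<close> is the product of the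
  two differences from 1, so both eigenvalues lie on one side of 1 and the sum tells which.\<close>

lemma mu_gt_1:
  assumes d: "mu_disc m v \<ge> 0" and s: "mu_sum m v > 2" and p: "1 - mu_sum m v + mu_prod m v > 0"
  shows "1 < mu_min m v"
proof -
  note M = mu_max_min[OF d]
  have "(mu_max m v - 1) * (mu_min m v - 1) > 0" using p unfolding M(1,2)[symmetric] by (simp add: algebra_simps)
  hence "mu_min m v > 1 \<or> mu_max m v < 1" by (auto simp: zero_less_mult_iff)
  thus ?thesis using M(1,3) s by linarith
qed

lemma mu_between_0_1:
  assumes d: "mu_disc m v \<ge> 0" and s: "0 < mu_sum m v" "mu_sum m v < 2" and p: "1 - mu_sum m v + mu_prod m v > 0"
    and P: "mu_prod m v > 0"
  shows "0 < mu_min m v" "mu_max m v < 1"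
proof -
  note M = mu_max_min[OF d]
  have "mu_max m v * mu_min m v > 0" using P M(2) by simp
  thus "0 < mu_min m v" using M(1,3) s by (auto simp: zero_less_mult_iff)
  have "(mu_max m v - 1) * (mu_min m v - 1) > 0" using p unfolding M(1,2)[symmetric] by (simp add: algebra_simps)
  hence "mu_min m v > 1 \<or> mu_max m v < 1" by (auto simp: zero_less_mult_iff)
  thus "mu_max m v < 1" using M(1,3) s by linarith
qed

text \<open>The interface between configurations and spectra: through it the nontrivial eigenvalues
  depend on the configuration only by way of v.\<close>

definition char_factor :: "real \<Rightarrow> real \<Rightarrow> (nat \<Rightarrow> real) \<Rightarrow> real \<Rightarrow> bool" where
  "char_factor m \<omega> x v \<longleftrightarrow>
     (\<forall>t. det (t \<cdot>\<^sub>m 1\<^sub>m 4 - A_mat m \<omega> x) = t * (t - 1) * (t\<^sup>2 - mu_sum m v * t + mu_prod m v))"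

lemma eigenvalues_real_pairs:
  assumes cf: "char_factor m \<omega> x v" and d: "mu_disc m v \<ge> 0" and s: "mu_sum m v > 2"
    and p: "1 - mu_sum m v + mu_prod m v > 0"
  defines "l1 \<equiv> sqrt ((mu_max m v)\<^sup>2 - 1)" and "l2 \<equiv> sqrt ((mu_min m v)\<^sup>2 - 1)"
  shows "nontrivial_eigenvalues m \<omega> x = real_pairs l1 l2" "l2 > 0" "mu_disc m v > 0 \<Longrightarrow> l2 < l1"
proof -
  note M = mu_max_min[OF d] and g = mu_gt_1[OF d s p]
  have sq: "y\<^sup>2 > 1" if "y > 1" for y :: real using that by (simp add: one_less_power)
  have "nontrivial_eigenvalues m \<omega> x = {#complex_of_real l1, - complex_of_real l1, complex_of_real l2, - complex_of_real l2#}"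
  proof (rule nontrivial_eigenvalues_eq)
    show "det (t \<cdot>\<^sub>m 1\<^sub>m 4 - A_mat m \<omega> x) = t * (t - 1) * (t\<^sup>2 - mu_sum m v * t + mu_prod m v)" for t
      using cf by (simp add: char_factor_def)
    show "complex_of_real (mu_max m v) + complex_of_real (mu_min m v) = complex_of_real (mu_sum m v)"
      "complex_of_real (mu_max m v) * complex_of_real (mu_min m v) = complex_of_real (mu_prod m v)"
      by (simp_all only: M(1,2)[symmetric] of_real_add of_real_mult)
    have "l1\<^sup>2 = (mu_max m v)\<^sup>2 - 1" "l2\<^sup>2 = (mu_min m v)\<^sup>2 - 1"
      using sq[OF g] sq[of "mu_max m v"] g M(3) by (simp_all add: l1_def l2_def)
    from this[THEN arg_cong[of _ _ complex_of_real]]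
    show "(complex_of_real l1)\<^sup>2 = (complex_of_real (mu_max m v))\<^sup>2 - 1"
      "(complex_of_real l2)\<^sup>2 = (complex_of_real (mu_min m v))\<^sup>2 - 1"
      by simp_all
  qed
  thus "nontrivial_eigenvalues m \<omega> x = real_pairs l1 l2" by (simp add: real_pairs_def)
  show "l2 > 0" using sq[OF g] by (simp add: l2_def)
  assume "mu_disc m v > 0"
  hence "(mu_min m v)\<^sup>2 < (mu_max m v)\<^sup>2" using M(4) g by (intro power_strict_mono) auto
  thus "l2 < l1" by (simp add: l1_def l2_def)
qed

text \<open>The two \<mu> are conjugate, and so are the values \<mu>^2 - 1. These are not real,
  because the imaginary part of \<mu>^2 is \<open>mu_sum\<close> times a positive number, and a
  square root of a nonreal number has both parts nonzero.\<close>

lemma eigenvalues_quartuplet: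
  assumes cf: "char_factor m \<omega> x v" and d: "mu_disc m v < 0" and s: "mu_sum m v > 0"
  obtains \<alpha> \<beta> :: real where "\<alpha> \<noteq> 0" "\<beta> \<noteq> 0" "nontrivial_eigenvalues m \<omega> x =
    {#Complex \<alpha> \<beta>, Complex \<alpha> (- \<beta>), Complex (- \<alpha>) \<beta>, Complex (- \<alpha>) (- \<beta>)#}"
proof -
  define r where "r = sqrt (- mu_disc m v) / 2"
  have r: "r > 0" "r\<^sup>2 = - mu_disc m v / 4" using d by (simp_all add: r_def power_divide)
  define \<mu> where "\<mu> = Complex (mu_sum m v / 2) r"
  define z where "z = csqrt (\<mu>\<^sup>2 - 1)"
  have z: "z\<^sup>2 = \<mu>\<^sup>2 - 1" by (simp add: z_def)
  have "Im (z\<^sup>2) = mu_sum m v * r" unfolding z by (simp add: \<mu>_def power2_eq_square)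
  moreover have "mu_sum m v * r > 0" using r(1) s by simp
  ultimately have "Im (z\<^sup>2) > 0" by simp
  hence nz: "Re z \<noteq> 0" "Im z \<noteq> 0" by (auto simp: power2_eq_square)
  have "nontrivial_eigenvalues m \<omega> x = {#z, - z, cnj z, - cnj z#}"
  proof (rule nontrivial_eigenvalues_eq)
    show "det (t \<cdot>\<^sub>m 1\<^sub>m 4 - A_mat m \<omega> x) = t * (t - 1) * (t\<^sup>2 - mu_sum m v * t + mu_prod m v)" for t
      using cf by (simp add: char_factor_def)
    show "\<mu> + cnj \<mu> = complex_of_real (mu_sum m v)" by (simp add: \<mu>_def complex_eq_iff)
    have "(mu_sum m v / 2)\<^sup>2 + r\<^sup>2 = mu_prod m v" unfolding r(2) by (simp add: mu_disc_def power_divide field_simps)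
    thus "\<mu> * cnj \<mu> = complex_of_real (mu_prod m v)" by (simp add: \<mu>_def complex_eq_iff power2_eq_square)
    show "z\<^sup>2 = \<mu>\<^sup>2 - 1" by (rule z)
    show "(cnj z)\<^sup>2 = (cnj \<mu>)\<^sup>2 - 1" using arg_cong[OF z, of cnj] by simp
  qed
  moreover have "z = Complex (Re z) (Im z)" "- z = Complex (- Re z) (- Im z)"
    "cnj z = Complex (Re z) (- Im z)" "- cnj z = Complex (- Re z) (Im z)"
    by (simp_all add: complex_eq_iff)
  ultimately have "nontrivial_eigenvalues m \<omega> x =
    {#Complex (Re z) (Im z), Complex (- Re z) (- Im z), Complex (Re z) (- Im z), Complex (- Re z) (Im z)#}"
    by simp
  also have "\<dots> = {#Complex (Re z) (Im z), Complex (Re z) (- Im z), Complex (- Re z) (Im z), Complex (- Re z) (- Im z)#}"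
    by (simp add: add_mset_commute)
  finally show ?thesis using that nz by blast
qed

lemma eigenvalues_imaginary:
  assumes cf: "char_factor m \<omega> x v" and d: "mu_disc m v \<ge> 0" and s: "0 < mu_sum m v" "mu_sum m v < 2"
    and p: "1 - mu_sum m v + mu_prod m v > 0" and P: "mu_prod m v > 0"
  defines "l1 \<equiv> sqrt (1 - (mu_max m v)\<^sup>2)" and "l2 \<equiv> sqrt (1 - (mu_min m v)\<^sup>2)"
  shows "nontrivial_eigenvalues m \<omega> x = {#\<i> * l1, - (\<i> * l1), \<i> * l2, - (\<i> * l2)#}" "l1 > 0" "l2 > 0"
proof -
  note M = mu_max_min[OF d] and g = mu_between_0_1[OF d s p P]
  have sq: "y\<^sup>2 < 1" if "0 < y" "y < 1" for y :: real using that abs_square_less_1[of y] by simp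
  have pos: "1 - (mu_max m v)\<^sup>2 > 0" "1 - (mu_min m v)\<^sup>2 > 0"
    using sq[of "mu_max m v"] sq[of "mu_min m v"] g M(3) by auto
  thus "l1 > 0" "l2 > 0" by (simp_all add: l1_def l2_def)
  have l: "l1\<^sup>2 = 1 - (mu_max m v)\<^sup>2" "l2\<^sup>2 = 1 - (mu_min m v)\<^sup>2" using pos by (simp_all add: l1_def l2_def)
  show "nontrivial_eigenvalues m \<omega> x = {#\<i> * l1, - (\<i> * l1), \<i> * l2, - (\<i> * l2)#}"
  proof (rule nontrivial_eigenvalues_eq)
    show "det (t \<cdot>\<^sub>m 1\<^sub>m 4 - A_mat m \<omega> x) = t * (t - 1) * (t\<^sup>2 - mu_sum m v * t + mu_prod m v)" for t
      using cf by (simp add: char_factor_def)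
    show "complex_of_real (mu_max m v) + complex_of_real (mu_min m v) = complex_of_real (mu_sum m v)"
      "complex_of_real (mu_max m v) * complex_of_real (mu_min m v) = complex_of_real (mu_prod m v)"
      by (simp_all only: M(1,2)[symmetric] of_real_add of_real_mult)
    show "(\<i> * l1)\<^sup>2 = (complex_of_real (mu_max m v))\<^sup>2 - 1" "(\<i> * l2)\<^sup>2 = (complex_of_real (mu_min m v))\<^sup>2 - 1"
      by (simp_all add: power_mult_distrib l flip: of_real_power)
  qed
qed

lemma collinear_re_char_factor:
  assumes r: "collinear_re m \<omega> x" and m: "m > -1"
  shows "char_factor m \<omega> x (shape_param \<omega> (x 1 - x 4) (x 2 - x 4) (x 3 - x 4))"
proof -
  have "m > -3" using m by simp
  from det_A_mat[OF collinear_re_line_re[OF r this] refl refl refl m]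
  show ?thesis by (simp add: char_factor_def)
qed

lemma group_I_root:
  assumes g: "group_I_solution m \<omega> x" and m: "m > -1"
  obtains v where "root_I m v" "char_factor m \<omega> x v"
proof -
  have r: "collinear_re m \<omega> x" using g by (simp add: group_I_solution_def)
  have m3: "m > -3" using m by simp
  have "x 1 - x 4 > 0 \<and> x 2 - x 4 > 0 \<and> x 3 - x 4 > 0 \<or> x 1 - x 4 < 0 \<and> x 2 - x 4 < 0 \<and> x 3 - x 4 < 0"
  proof -
    from g obtain p where "p \<in> group_I_orderings" "sorted_wrt (<) (map x p)"
      by (auto simp: group_I_solution_def has_ordering_def)
    thus ?thesis unfolding group_I_orderings_def by (elim insertE emptyE; simp)
  qed
  from root_I_if_exterior[OF collinear_re_line_re[OF r m3] m this] collinear_re_char_factor[OF r m]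
  show ?thesis by (rule that)
qed

lemma group_II_root:
  assumes g: "group_II_solution m \<omega> x" and m: "m > -1/2"
  obtains v where "root_II m v" "char_factor m \<omega> x v"
proof -
  have r: "collinear_re m \<omega> x" using g by (simp add: group_II_solution_def)
  have m3: "m > -3" and m1: "m > -1" using m by simp_all
  have "\<not> (x 1 - x 4 > 0 \<and> x 2 - x 4 > 0 \<and> x 3 - x 4 > 0 \<or> x 1 - x 4 < 0 \<and> x 2 - x 4 < 0 \<and> x 3 - x 4 < 0)"
  proof -
    from g obtain p where "p \<in> group_II_orderings" "sorted_wrt (<) (map x p)"
      by (auto simp: group_II_solution_def has_ordering_def)
    thus ?thesis unfolding group_II_orderings_def by (elim insertE emptyE; simp)
  qed
  from root_II_if_interior[OF collinear_re_line_re[OF r m3] m this] collinear_re_char_factor[OF r m1]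
  show ?thesis by (rule that)
qed

subsection \<open>Linear stability\<close>

definition cols4 :: "real vec \<Rightarrow> real vec \<Rightarrow> real vec \<Rightarrow> real vec \<Rightarrow> real mat" where
  "cols4 u0 u1 u2 u3 = mat_of_cols 4 [u0, u1, u2, u3]"

lemma cols4_carrier [simp]: "cols4 u0 u1 u2 u3 \<in> carrier_mat 4 4"
  by (rule carrier_matI) (simp_all add: cols4_def)

lemma vec4_expand: "p \<in> carrier_vec 4 \<Longrightarrow> vec4 (p $ 0) (p $ 1) (p $ 2) (p $ 3) = p"
proof (rule eq_vecI)
  fix i assume p: "p \<in> carrier_vec 4" and "i < dim_vec p"
  hence "i = 0 \<or> i = 1 \<or> i = 2 \<or> i = 3" by auto
  thus "vec4 (p $ 0) (p $ 1) (p $ 2) (p $ 3) $ i = p $ i" by auto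
qed simp

lemma cols4_mult_index:
  assumes "i < 4"
  shows "(cols4 u0 u1 u2 u3 *\<^sub>v vec4 s0 s1 s2 s3) $ i = s0 * u0 $ i + s1 * u1 $ i + s2 * u2 $ i + s3 * u3 $ i"
proof -
  have "{0..<4::nat} = {0, 1, 2, 3}" by auto
  thus ?thesis using assms by (simp add: cols4_def scalar_prod_def mat_of_cols_index mult.commute)
qed

lemma cols4_mult_vec4:
  assumes u: "u0 \<in> carrier_vec 4" "u1 \<in> carrier_vec 4" "u2 \<in> carrier_vec 4" "u3 \<in> carrier_vec 4"
  shows "cols4 u0 u1 u2 u3 *\<^sub>v vec4 s0 s1 s2 s3 = s0 \<cdot>\<^sub>v u0 + s1 \<cdot>\<^sub>v u1 + s2 \<cdot>\<^sub>v u2 + s3 \<cdot>\<^sub>v u3"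
proof (rule eq_vecI)
  fix i assume "i < dim_vec (s0 \<cdot>\<^sub>v u0 + s1 \<cdot>\<^sub>v u1 + s2 \<cdot>\<^sub>v u2 + s3 \<cdot>\<^sub>v u3)"
  hence "i < 4" using u by simp
  thus "(cols4 u0 u1 u2 u3 *\<^sub>v vec4 s0 s1 s2 s3) $ i = (s0 \<cdot>\<^sub>v u0 + s1 \<cdot>\<^sub>v u1 + s2 \<cdot>\<^sub>v u2 + s3 \<cdot>\<^sub>v u3) $ i"
    using u by (simp add: cols4_mult_index)
qed (use u in \<open>simp add: cols4_def\<close>)

lemma mult_cols4_eigen:
  assumes A: "A \<in> carrier_mat 4 4"
    and u: "u0 \<in> carrier_vec 4" "u1 \<in> carrier_vec 4" "u2 \<in> carrier_vec 4" "u3 \<in> carrier_vec 4"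
    and e: "A *\<^sub>v u0 = k0 \<cdot>\<^sub>v u0" "A *\<^sub>v u1 = k1 \<cdot>\<^sub>v u1" "A *\<^sub>v u2 = k2 \<cdot>\<^sub>v u2" "A *\<^sub>v u3 = k3 \<cdot>\<^sub>v u3"
  shows "A *\<^sub>v (cols4 u0 u1 u2 u3 *\<^sub>v vec4 s0 s1 s2 s3) =
    cols4 u0 u1 u2 u3 *\<^sub>v vec4 (k0 * s0) (k1 * s1) (k2 * s2) (k3 * s3)"
  unfolding cols4_mult_vec4[OF u]
  using u e by (simp add: mult_add_distrib_mat_vec[OF A] mult_mat_vec[OF A] smult_smult_assoc mult.commute)

text \<open>Lagrange elimination: weighting the four equations by the coefficients of (X - k1) * (X
  - k2) * (X - k3) cancels \<open>t1\<close>, \<open>t2\<close>, \<open>t3\<close>.\<close>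

lemma vandermonde_4:
  fixes t0 :: real
  assumes "t0 + t1 + t2 + t3 = 0" "k0 * t0 + k1 * t1 + k2 * t2 + k3 * t3 = 0"
    "k0 * (k0 * t0) + k1 * (k1 * t1) + k2 * (k2 * t2) + k3 * (k3 * t3) = 0"
    "k0 * (k0 * (k0 * t0)) + k1 * (k1 * (k1 * t1)) + k2 * (k2 * (k2 * t2)) + k3 * (k3 * (k3 * t3)) = 0"
    and d: "k0 \<noteq> k1" "k0 \<noteq> k2" "k0 \<noteq> k3"
  shows "t0 = 0"
proof -
  have "(k0 - k1) * (k0 - k2) * (k0 - k3) * t0 =
      (k0 * (k0 * (k0 * t0)) + k1 * (k1 * (k1 * t1)) + k2 * (k2 * (k2 * t2)) + k3 * (k3 * (k3 * t3)))
    - (k1 + k2 + k3) * (k0 * (k0 * t0) + k1 * (k1 * t1) + k2 * (k2 * t2) + k3 * (k3 * t3))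
    + (k1 * k2 + k1 * k3 + k2 * k3) * (k0 * t0 + k1 * t1 + k2 * t2 + k3 * t3)
    - k1 * k2 * k3 * (t0 + t1 + t2 + t3)"
    by (simp add: algebra_simps)
  also have "\<dots> = 0" unfolding assms(1-4) by simp
  finally show ?thesis using d by simp
qed

text \<open>Applying A up to three times to the relation gives a Vandermonde system in every row i
  for the terms \<open>s0 * u0 $ i\<close> to \<open>s3 * u3 $ i\<close>; a nonzero entry of each
  eigenvector then isolates its coefficient.\<close>

lemma cols4_eigen_inj:
  assumes A: "A \<in> carrier_mat 4 4"
    and u: "u0 \<in> carrier_vec 4" "u1 \<in> carrier_vec 4" "u2 \<in> carrier_vec 4" "u3 \<in> carrier_vec 4"
    and e: "A *\<^sub>v u0 = k0 \<cdot>\<^sub>v u0" "A *\<^sub>v u1 = k1 \<cdot>\<^sub>v u1" "A *\<^sub>v u2 = k2 \<cdot>\<^sub>v u2" "A *\<^sub>v u3 = k3 \<cdot>\<^sub>v u3"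
    and nz: "u0 \<noteq> 0\<^sub>v 4" "u1 \<noteq> 0\<^sub>v 4" "u2 \<noteq> 0\<^sub>v 4" "u3 \<noteq> 0\<^sub>v 4"
    and d: "k0 \<noteq> k1" "k0 \<noteq> k2" "k0 \<noteq> k3" "k1 \<noteq> k2" "k1 \<noteq> k3" "k2 \<noteq> k3"
    and z: "cols4 u0 u1 u2 u3 *\<^sub>v vec4 s0 s1 s2 s3 = 0\<^sub>v 4"
  shows "s0 = 0 \<and> s1 = 0 \<and> s2 = 0 \<and> s3 = 0"
proof -
  note step = mult_cols4_eigen[OF A u e]
  have A0: "A *\<^sub>v 0\<^sub>v 4 = 0\<^sub>v 4" using A by (intro eq_vecI) auto
  note z1 = arg_cong[OF z, of "\<lambda>v. A *\<^sub>v v", unfolded step A0]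
  note z2 = arg_cong[OF z1, of "\<lambda>v. A *\<^sub>v v", unfolded step A0]
  note z3 = arg_cong[OF z2, of "\<lambda>v. A *\<^sub>v v", unfolded step A0]
  have "s0 * u0 $ i = 0 \<and> s1 * u1 $ i = 0 \<and> s2 * u2 $ i = 0 \<and> s3 * u3 $ i = 0" if i: "i < 4" for i
  proof -
    define t0 t1 t2 t3 where "t0 = s0 * u0 $ i" and "t1 = s1 * u1 $ i" and "t2 = s2 * u2 $ i" and "t3 = s3 * u3 $ i"
    have E: "t0 + t1 + t2 + t3 = 0" "k0 * t0 + k1 * t1 + k2 * t2 + k3 * t3 = 0"
      "k0 * (k0 * t0) + k1 * (k1 * t1) + k2 * (k2 * t2) + k3 * (k3 * t3) = 0"
      "k0 * (k0 * (k0 * t0)) + k1 * (k1 * (k1 * t1)) + k2 * (k2 * (k2 * t2)) + k3 * (k3 * (k3 * t3)) = 0"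
      using arg_cong[OF z, of "\<lambda>v. v $ i"] arg_cong[OF z1, of "\<lambda>v. v $ i"]
        arg_cong[OF z2, of "\<lambda>v. v $ i"] arg_cong[OF z3, of "\<lambda>v. v $ i"] i
      by (simp_all add: cols4_mult_index t0_def t1_def t2_def t3_def mult.assoc)
    have "t0 = 0" using vandermonde_4[OF E] d by simp
    moreover have "t1 = 0" using vandermonde_4[of t1 t0 t2 t3 k1 k0 k2 k3] E d by (simp add: ac_simps)
    moreover have "t2 = 0" using vandermonde_4[of t2 t0 t1 t3 k2 k0 k1 k3] E d by (simp add: ac_simps)
    moreover have "t3 = 0" using vandermonde_4[of t3 t0 t1 t2 k3 k0 k1 k2] E d by (simp add: ac_simps)
    ultimately show ?thesis by (simp add: t0_def t1_def t2_def t3_def)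
  qed note * = this
  have ex: "\<exists>i<4. u $ i \<noteq> 0" if "u \<in> carrier_vec 4" "u \<noteq> 0\<^sub>v 4" for u :: "real vec"
  proof (rule ccontr)
    assume "\<not> (\<exists>i<4. u $ i \<noteq> 0)"
    hence "u = 0\<^sub>v 4" using that(1) by (intro eq_vecI) auto
    thus False using that(2) by simp
  qed
  show ?thesis using ex[OF u(1) nz(1)] ex[OF u(2) nz(2)] ex[OF u(3) nz(3)] ex[OF u(4) nz(4)] * by fastforce
qed

lemma cols4_eigen_surj:
  assumes A: "A \<in> carrier_mat 4 4"
    and u: "u0 \<in> carrier_vec 4" "u1 \<in> carrier_vec 4" "u2 \<in> carrier_vec 4" "u3 \<in> carrier_vec 4"
    and e: "A *\<^sub>v u0 = k0 \<cdot>\<^sub>v u0" "A *\<^sub>v u1 = k1 \<cdot>\<^sub>v u1" "A *\<^sub>v u2 = k2 \<cdot>\<^sub>v u2" "A *\<^sub>v u3 = k3 \<cdot>\<^sub>v u3"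
    and nz: "u0 \<noteq> 0\<^sub>v 4" "u1 \<noteq> 0\<^sub>v 4" "u2 \<noteq> 0\<^sub>v 4" "u3 \<noteq> 0\<^sub>v 4"
    and d: "k0 \<noteq> k1" "k0 \<noteq> k2" "k0 \<noteq> k3" "k1 \<noteq> k2" "k1 \<noteq> k3" "k2 \<noteq> k3"
    and p: "p \<in> carrier_vec 4"
  obtains s0 s1 s2 s3 where "p = cols4 u0 u1 u2 u3 *\<^sub>v vec4 s0 s1 s2 s3"
proof -
  let ?W = "cols4 u0 u1 u2 u3"
  have "det ?W \<noteq> 0"
  proof
    assume "det ?W = 0"
    then obtain v where v: "v \<in> carrier_vec 4" "v \<noteq> 0\<^sub>v 4" "?W *\<^sub>v v = 0\<^sub>v 4"
      using det_0_iff_vec_prod_zero[OF cols4_carrier] by blast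
    have "?W *\<^sub>v vec4 (v $ 0) (v $ 1) (v $ 2) (v $ 3) = 0\<^sub>v 4"
      unfolding vec4_expand[OF v(1)] by (rule v(3))
    from cols4_eigen_inj[OF A u e nz d this] have "v $ 0 = 0" "v $ 1 = 0" "v $ 2 = 0" "v $ 3 = 0" by auto
    hence "v = vec4 0 0 0 0" using vec4_expand[OF v(1)] by simp
    also have "\<dots> = 0\<^sub>v 4" by (rule eq_vecI) (auto simp: vec4_def)
    finally show False using v(2) by simp
  qed
  from det_non_zero_imp_unit[OF cols4_carrier this, unfolded Units_def ring_mat_def, of "()"]
  obtain B where B: "B \<in> carrier_mat 4 4" "?W * B = 1\<^sub>m 4" by auto
  define s where "s = B *\<^sub>v p"
  have s: "s \<in> carrier_vec 4" using B p by (simp add: s_def)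
  have "?W *\<^sub>v s = (?W * B) *\<^sub>v p" 
    unfolding s_def by (rule assoc_mult_mat_vec[OF cols4_carrier B(1) p, symmetric])
  also have "\<dots> = p" unfolding B(2) using p by simp
  finally have "?W *\<^sub>v s = p" .
  thus ?thesis using that vec4_expand[OF s] by metis
qed

section \<open>The bilinear form weighted by the circulations\<close>

definition circ_form :: "real \<Rightarrow> real vec \<Rightarrow> real vec \<Rightarrow> real" where
  "circ_form m p q = p $ 0 * q $ 0 + p $ 1 * q $ 1 + p $ 2 * q $ 2 + m * (p $ 3 * q $ 3)"

text \<open>Off the diagonal, entry (i, j) of A carries the circulation of j, so weighting row i by
  the circulation of i makes the matrix symmetric.\<close>

lemma circ_form_A_mat:
  assumes "p \<in> carrier_vec 4" "q \<in> carrier_vec 4"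
  shows "circ_form m (A_mat m \<omega> x *\<^sub>v p) q = circ_form m p (A_mat m \<omega> x *\<^sub>v q)"
proof -
  obtain p0 p1 p2 p3 q0 q1 q2 q3 where pq: "p = vec4 p0 p1 p2 p3" "q = vec4 q0 q1 q2 q3"
    using vec4_expand assms by metis
  define w12 w13 w23 w14 w24 w34 where "w12 = 1 / (x 1 - x 2)\<^sup>2" and "w13 = 1 / (x 1 - x 3)\<^sup>2"
    and "w23 = 1 / (x 2 - x 3)\<^sup>2" and "w14 = 1 / (x 1 - x 4)\<^sup>2" and "w24 = 1 / (x 2 - x 4)\<^sup>2"
    and "w34 = 1 / (x 3 - x 4)\<^sup>2"
  have w: "t / (x 1 - x 2)\<^sup>2 = t * w12" "t / (x 1 - x 3)\<^sup>2 = t * w13" "t / (x 2 - x 3)\<^sup>2 = t * w23"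
    "t / (x 1 - x 4)\<^sup>2 = t * w14" "t / (x 2 - x 4)\<^sup>2 = t * w24" "t / (x 3 - x 4)\<^sup>2 = t * w34" for t
    by (simp_all add: w12_def w13_def w23_def w14_def w24_def w34_def)
  define c where "c = 1 / \<omega>"
  show ?thesis unfolding pq A_mat_mult_vec4 circ_form_def vec4_simps w c_def[symmetric]
    by (simp add: algebra_simps)
qed

text \<open>In the basis of \<open>node_mat\<close> the centered positions have coordinates (-c, 1,
  0, 0), a visible eigenvector of \<open>model_mat\<close> for 1.\<close>

lemma A_mat_mult_position:
  assumes r: "line_re m \<omega> c a b d" and x: "x 1 - x 4 = a" "x 2 - x 4 = b" "x 3 - x 4 = d"
  shows "A_mat m \<omega> x *\<^sub>v vec4 (a - c) (b - c) (d - c) (- c) = vec4 (a - c) (b - c) (d - c) (- c)"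
proof -
  obtain \<alpha> \<beta> \<gamma> \<kappa> where AN: "A_mat m \<omega> x * node_mat a b d = node_mat a b d * model_mat m \<omega> c \<alpha> \<beta> \<gamma> \<kappa>"
    using A_mat_mult_node_mat[OF r x] by blast
  let ?A = "A_mat m \<omega> x" and ?N = "node_mat a b d" and ?C = "model_mat m \<omega> c \<alpha> \<beta> \<gamma> \<kappa>"
  have N: "?N *\<^sub>v vec4 (- c) 1 0 0 = vec4 (a - c) (b - c) (d - c) (- c)"
    unfolding node_mat_mult_vec4 by simp
  have C: "?C *\<^sub>v vec4 (- c) 1 0 0 = vec4 (- c) 1 0 0"
    unfolding model_mat_def cols4_def[symmetric]
  proof (rule eq_vecI)
    fix i assume "i < dim_vec (vec4 (- c) 1 0 0)"
    hence "i = 0 \<or> i = 1 \<or> i = 2 \<or> i = 3" by auto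
    thus "(cols4 (vec4 0 0 0 0) (vec4 (- c) 1 0 0) (vec4 (- ((m + 2) / \<omega>)) (- 2 * c) 2 ((m - 1) / \<omega>))
      (vec4 \<alpha> \<beta> \<gamma> \<kappa>) *\<^sub>v vec4 (- c) 1 0 0) $ i = vec4 (- c) 1 0 0 $ i"
      by (elim disjE) (simp_all add: cols4_mult_index)
  qed (simp add: cols4_def)
  have "?A *\<^sub>v (?N *\<^sub>v vec4 (- c) 1 0 0) = (?A * ?N) *\<^sub>v vec4 (- c) 1 0 0"
    by (rule assoc_mult_mat_vec[of _ 4 4 _ 4, symmetric]) simp_all
  also have "\<dots> = ?N *\<^sub>v (?C *\<^sub>v vec4 (- c) 1 0 0)"
    unfolding AN by (rule assoc_mult_mat_vec[of _ 4 4 _ 4]) simp_all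
  finally show ?thesis unfolding C N .
qed

text \<open>The virial identity: \<omega> times the moment of inertia is the sum over pairs of
  products of circulations. For m < 0 the form is indefinite, and this identity is what keeps the
  position vector from being isotropic.\<close>

lemma circ_form_position:
  assumes r: "line_re m \<omega> c a b d"
  shows "\<omega> * circ_form m (vec4 (a - c) (b - c) (d - c) (- c)) (vec4 (a - c) (b - c) (d - c) (- c)) = 3 * (1 + m)"
proof -
  define e1 e2 e3 where "e1 = a + b + d" and "e2 = a * b + a * d + b * d" and "e3 = a * b * d"
  note E = line_re_symmetric_functions[OF r, folded e1_def e2_def e3_def]
  have "circ_form m (vec4 (a - c) (b - c) (d - c) (- c)) (vec4 (a - c) (b - c) (d - c) (- c))
    = e1 * e1 - 2 * e2 - 2 * c * e1 + c * ((m + 3) * c)"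
    unfolding e1_def e2_def by (simp add: circ_form_def algebra_simps)
  also have "\<dots> = e1 * e1 - 2 * e2 - c * e1" unfolding E(1)[symmetric] by simp
  finally have "\<omega> * circ_form m (vec4 (a - c) (b - c) (d - c) (- c)) (vec4 (a - c) (b - c) (d - c) (- c))
    = \<omega> * (e1 * e1 - 2 * e2 - c * e1)" by simp
  also have "\<dots> = \<omega> * e1 * e1 - 2 * \<omega> * e2 - \<omega> * c * e1" by (simp add: algebra_simps)
  also have "\<dots> = \<omega> * e1 * e1 + 3 * (1 + m) - \<omega> * ((m + 3) * c) * e1"
    unfolding E(3) by (simp add: algebra_simps)
  also have "\<dots> = 3 * (1 + m)" unfolding E(1)[symmetric] by simp
  finally show ?thesis .
qed

section \<open>Coordinates on the phase space and its invariant subspace\<close>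

lemma sum_upt_8: "(\<Sum>i\<in>{0..<8::nat}. f i) = f 0 + f 1 + f 2 + f 3 + f 4 + f 5 + f 6 + (f 7 :: real)"
  by (simp add: eval_nat_numeral)

lemma sum_upt_6: "(\<Sum>i\<in>{0..<6::nat}. f i) = f 0 + f 1 + f 2 + f 3 + f 4 + (f 5 :: real)"
  by (simp add: eval_nat_numeral)

lemma vec4_append_index:
  "(vec4 p0 p1 p2 p3 @\<^sub>v vec4 q0 q1 q2 q3) $ 0 = p0" "(vec4 p0 p1 p2 p3 @\<^sub>v vec4 q0 q1 q2 q3) $ 1 = p1"
  "(vec4 p0 p1 p2 p3 @\<^sub>v vec4 q0 q1 q2 q3) $ 2 = p2" "(vec4 p0 p1 p2 p3 @\<^sub>v vec4 q0 q1 q2 q3) $ 3 = p3"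
  "(vec4 p0 p1 p2 p3 @\<^sub>v vec4 q0 q1 q2 q3) $ 4 = q0" "(vec4 p0 p1 p2 p3 @\<^sub>v vec4 q0 q1 q2 q3) $ 5 = q1"
  "(vec4 p0 p1 p2 p3 @\<^sub>v vec4 q0 q1 q2 q3) $ 6 = q2" "(vec4 p0 p1 p2 p3 @\<^sub>v vec4 q0 q1 q2 q3) $ 7 = q3"
  by (simp_all add: index_append_vec vec4_def)

lemma M_mat_form:
  assumes "p \<in> carrier_vec 4" "q \<in> carrier_vec 4" "p' \<in> carrier_vec 4" "q' \<in> carrier_vec 4"
  shows "(p @\<^sub>v q) \<bullet> (M_mat m *\<^sub>v (p' @\<^sub>v q')) = circ_form m p p' + circ_form m q q'"
proof -
  obtain p0 p1 p2 p3 q0 q1 q2 q3 where pq: "p = vec4 p0 p1 p2 p3" "q = vec4 q0 q1 q2 q3"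
    using vec4_expand assms by metis
  obtain p0' p1' p2' p3' q0' q1' q2' q3' where pq': "p' = vec4 p0' p1' p2' p3'" "q' = vec4 q0' q1' q2' q3'"
    using vec4_expand assms by metis
  define w where "w = p' @\<^sub>v q'"
  have w: "w \<in> carrier_vec 8" using assms append_carrier_vec[of p' 4 q' 4] by (simp add: w_def)
  have Mw: "(M_mat m *\<^sub>v w) $ i = circ m (i mod 4 + 1) * w $ i" if "i < 8" for i
  proof -
    have "(M_mat m *\<^sub>v w) $ i = (\<Sum>j\<in>{0..<8}. (if i = j then circ m (i mod 4 + 1) else 0) * w $ j)"
      using that w by (simp add: M_mat_def scalar_prod_def)
    also have "\<dots> = (\<Sum>j\<in>{0..<8}. if i = j then circ m (i mod 4 + 1) * w $ j else 0)"
      by (intro sum.cong) auto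
    also have "\<dots> = circ m (i mod 4 + 1) * w $ i" using that by simp
    finally show ?thesis .
  qed
  have "(p @\<^sub>v q) \<bullet> (M_mat m *\<^sub>v w) = (\<Sum>i\<in>{0..<8}. (p @\<^sub>v q) $ i * (circ m (i mod 4 + 1) * w $ i))"
  proof -
    have "dim_vec (M_mat m *\<^sub>v w) = 8" by (simp add: M_mat_def)
    thus ?thesis unfolding scalar_prod_def
      by (intro sum.cong) (simp_all only: Mw atLeastLessThan_iff)
  qed
  thus ?thesis unfolding sum_upt_8 w_def pq pq' vec4_append_index
    by (simp add: circ_def circ_form_def)
qed

lemma z0_vec_append:
  assumes "c0 = fst (center_of_vorticity (circ m) (\<lambda>i. (x i, 0)))"
  shows "z0_vec m x = vec4 (x 1 - c0) (x 2 - c0) (x 3 - c0) (x 4 - c0) @\<^sub>v vec4 0 0 0 0" (is "?l = ?r")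
proof (rule eq_vecI)
  fix i assume "i < dim_vec ?r"
  hence "i < 8" by simp
  hence "i = 0 \<or> i = 1 \<or> i = 2 \<or> i = 3 \<or> i = 4 \<or> i = 5 \<or> i = 6 \<or> i = 7" by arith
  thus "?l $ i = ?r $ i"
    by (elim disjE) (simp_all only: vec4_append_index, simp_all add: z0_vec_def assms numeral_2_eq_2[symmetric])
qed (simp add: z0_vec_def)

lemma K_mat_mult_append:
  assumes "p \<in> carrier_vec 4" "q \<in> carrier_vec 4"
  shows "K_mat *\<^sub>v (p @\<^sub>v q) = q @\<^sub>v - p"
proof -
  have "K_mat *\<^sub>v (p @\<^sub>v q) = (0\<^sub>m 4 4 *\<^sub>v p + 1\<^sub>m 4 *\<^sub>v q) @\<^sub>v ((- 1\<^sub>m 4) *\<^sub>v p + 0\<^sub>m 4 4 *\<^sub>v q)"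
    unfolding K_mat_def by (rule four_block_mat_mult_vec[of _ 4 4 _ 4 _ 4]) (use assms in simp_all)
  also have "(- 1\<^sub>m 4) *\<^sub>v p = - p" using assms by (intro eq_vecI) auto
  also have "0\<^sub>m 4 4 *\<^sub>v p = 0\<^sub>v 4" using assms by (intro eq_vecI) auto
  also have "0\<^sub>m 4 4 *\<^sub>v q = 0\<^sub>v 4" using assms by (intro eq_vecI) auto
  finally show ?thesis using assms by simp
qed

text \<open>\<open>V_space\<close> is spanned by (X, 0) and (0, -X), so orthogonality splits into
  separate conditions on the two halves.\<close>

lemma V_perp_iff:
  assumes "c0 = fst (center_of_vorticity (circ m) (\<lambda>i. (x i, 0)))" "p \<in> carrier_vec 4" "q \<in> carrier_vec 4"
  defines "X \<equiv> vec4 (x 1 - c0) (x 2 - c0) (x 3 - c0) (x 4 - c0)"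
  shows "p @\<^sub>v q \<in> V_perp m x \<longleftrightarrow> circ_form m p X = 0 \<and> circ_form m q X = 0"
proof -
  have X: "X \<in> carrier_vec 4" by (simp add: X_def)
  have Z: "vec4 0 0 0 (0::real) = 0\<^sub>v 4" by (rule eq_vecI) (auto simp: vec4_def)
  have z0: "z0_vec m x = X @\<^sub>v 0\<^sub>v 4" unfolding X_def z0_vec_append[OF assms(1)] Z ..
  have Kz0: "K_mat *\<^sub>v z0_vec m x = 0\<^sub>v 4 @\<^sub>v - X"
    unfolding z0 using X by (simp add: K_mat_mult_append)
  have comb: "s \<cdot>\<^sub>v z0_vec m x + t \<cdot>\<^sub>v (K_mat *\<^sub>v z0_vec m x) = (s \<cdot>\<^sub>v X) @\<^sub>v (- t) \<cdot>\<^sub>v X" for s t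
    unfolding z0 Kz0[unfolded z0] using X by (intro eq_vecI) (auto simp: index_append_vec)
  have form: "(p @\<^sub>v q) \<bullet> (M_mat m *\<^sub>v ((s \<cdot>\<^sub>v X) @\<^sub>v (- t) \<cdot>\<^sub>v X)) = s * circ_form m p X - t * circ_form m q X" for s t
    using X assms by (subst M_mat_form) (auto simp: circ_form_def algebra_simps)
  have car: "p @\<^sub>v q \<in> carrier_vec 8" using append_carrier_vec[OF assms(2,3)] by simp
  have "p @\<^sub>v q \<in> V_perp m x \<longleftrightarrow> (\<forall>s t. s * circ_form m p X - t * circ_form m q X = 0)"
    unfolding V_perp_def V_space_def comb using car form by fastforce
  also have "\<dots> \<longleftrightarrow> circ_form m p X = 0 \<and> circ_form m q X = 0"
  proof
    assume *: "\<forall>s t. s * circ_form m p X - t * circ_form m q X = 0"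
    from *[rule_format, of 1 0] *[rule_format, of 0 1] show "circ_form m p X = 0 \<and> circ_form m q X = 0" by simp
  qed simp
  finally show ?thesis .
qed

lemma A_mat_cols4_dims [simp]:
  "dim_row (A_mat m \<omega> x) = 4" "dim_col (A_mat m \<omega> x) = 4"
  "dim_row (cols4 u0 u1 u2 u3) = 4" "dim_col (cols4 u0 u1 u2 u3) = 4"
  by (simp_all add: A_mat_def cols4_def)

lemma mult_unit_vec_eq_col:
  fixes A :: "'a :: semiring_1 mat"
  assumes "A \<in> carrier_mat nr nc" "j < nc"
  shows "A *\<^sub>v unit_vec nc j = col A j"
  using assms by (intro eq_vecI) (auto simp: scalar_prod_right_unit)

lemma rotation_blocks_mult:
  fixes b0 b1 b2 :: real
  assumes c: "c \<in> carrier_vec 6"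
  defines "D \<equiv> diag_block_mat (map rotation_block [b0, b1, b2])"
  shows "D \<in> carrier_mat 6 6"
    "(D *\<^sub>v c) $ 0 = b0 * c $ 1" "(D *\<^sub>v c) $ 1 = - b0 * c $ 0" "(D *\<^sub>v c) $ 2 = b1 * c $ 3"
    "(D *\<^sub>v c) $ 3 = - b1 * c $ 2" "(D *\<^sub>v c) $ 4 = b2 * c $ 5" "(D *\<^sub>v c) $ 5 = - b2 * c $ 4"
proof -
  have R: "dim_row (rotation_block b) = 2" "dim_col (rotation_block b) = 2" for b
    by (simp_all add: rotation_block_def mat_of_rows_list_def)
  have Ri: "rotation_block b $$ (0, 0) = 0" "rotation_block b $$ (0, 1) = b"
    "rotation_block b $$ (1, 0) = - b" "rotation_block b $$ (1, 1) = 0" for b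
    by (simp_all add: rotation_block_def mat_of_rows_list_def)
  show D: "D \<in> carrier_mat 6 6"
    by (rule carrier_matI) (simp_all add: D_def dim_diag_block_mat R)
  have row: "(D *\<^sub>v c) $ i = D $$ (i, 0) * c $ 0 + D $$ (i, 1) * c $ 1 + D $$ (i, 2) * c $ 2 + D $$ (i, 3) * c $ 3
      + D $$ (i, 4) * c $ 4 + D $$ (i, 5) * c $ 5" if "i < 6" for i
    using that D c by (simp add: scalar_prod_def sum_upt_6)
  show "(D *\<^sub>v c) $ 0 = b0 * c $ 1" "(D *\<^sub>v c) $ 1 = - b0 * c $ 0" "(D *\<^sub>v c) $ 2 = b1 * c $ 3"
    "(D *\<^sub>v c) $ 3 = - b1 * c $ 2" "(D *\<^sub>v c) $ 4 = b2 * c $ 5" "(D *\<^sub>v c) $ 5 = - b2 * c $ 4"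
    by (simp_all add: row) (simp_all add: D_def Let_def R Ri Ri[unfolded One_nat_def])
qed

text \<open>A has the four distinct eigenvalues 0 < k2 < k1 < 1, and its eigenvector X for 1 is
  orthogonal to the other three. So \<open>V_perp\<close> consists of the pairs of combinations of
  \<open>u0\<close>, \<open>u1\<close>, \<open>u2\<close>, and each of these eigenvectors spans an
  invariant plane. A positive discriminant provides the distinctness.\<close>

lemma linearly_stableI:
  assumes r: "collinear_re m \<omega> x" and m: "m > -1" and cf: "char_factor m \<omega> x v" and d: "mu_disc m v > 0"
    and s: "0 < mu_sum m v" "mu_sum m v < 2" and p: "1 - mu_sum m v + mu_prod m v > 0" and P: "mu_prod m v > 0"
    and st: "spectrally_stable m \<omega> x"
  shows "linearly_stable m \<omega> x"
proof -
  have d0: "mu_disc m v \<ge> 0" using d by simp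
  define k1 k2 where "k1 = mu_max m v" and "k2 = mu_min m v"
  have k: "0 < k2" "k2 < k1" "k1 < 1"
    using mu_between_0_1[OF d0 s p P] mu_max_min(4)[OF d0 d] by (simp_all add: k1_def k2_def)
  let ?A = "A_mat m \<omega> x"
  note A = A_mat_carrier[of m \<omega> x]
  have "\<exists>u. u \<in> carrier_vec 4 \<and> u \<noteq> 0\<^sub>v 4 \<and> ?A *\<^sub>v u = t \<cdot>\<^sub>v u" if t: "t\<^sup>2 - mu_sum m v * t + mu_prod m v = 0" for t
  proof -
    have "- char_matrix ?A t = t \<cdot>\<^sub>m 1\<^sub>m 4 - ?A"
      unfolding char_matrix_def by (rule eq_matI) auto
    hence "poly (char_poly ?A) t = 0"
      unfolding char_poly_matrix[OF A] using cf t by (simp add: char_factor_def)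
    hence "eigenvalue ?A t" by (simp add: eigenvalue_root_char_poly[OF A])
    thus ?thesis by (auto simp: eigenvalue_def eigenvector_def)
  qed note eig = this
  have quad: "t\<^sup>2 - mu_sum m v * t + mu_prod m v = (t - k1) * (t - k2)" for t
    unfolding k1_def k2_def mu_max_min(1,2)[OF d0, symmetric] by (simp add: algebra_simps power2_eq_square)
  obtain u1 where u1: "u1 \<in> carrier_vec 4" "u1 \<noteq> 0\<^sub>v 4" "?A *\<^sub>v u1 = k1 \<cdot>\<^sub>v u1"
    using eig[of k1] unfolding quad by auto
  obtain u2 where u2: "u2 \<in> carrier_vec 4" "u2 \<noteq> 0\<^sub>v 4" "?A *\<^sub>v u2 = k2 \<cdot>\<^sub>v u2"
    using eig[of k2] unfolding quad by auto
  define u0 where "u0 = vec4 1 1 1 (1::real)"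
  have u0: "u0 \<in> carrier_vec 4" "u0 \<noteq> 0\<^sub>v 4" "?A *\<^sub>v u0 = 0 \<cdot>\<^sub>v u0"
  proof -
    have "u0 $ 0 = 1" by (simp add: u0_def)
    thus "u0 \<noteq> 0\<^sub>v 4" by auto
    show "?A *\<^sub>v u0 = 0 \<cdot>\<^sub>v u0" unfolding u0_def A_mat_mult_vec4 by (intro eq_vecI) (auto simp: vec4_def)
  qed (simp add: u0_def)
  define c0 where "c0 = fst (center_of_vorticity (circ m) (\<lambda>i. (x i, 0)))"
  have "m > -3" using m by simp
  note lr = collinear_re_line_re[OF r this, folded c0_def]
  define X where "X = vec4 (x 1 - c0) (x 2 - c0) (x 3 - c0) (x 4 - c0)"
  have X': "vec4 (x 1 - x 4 - (c0 - x 4)) (x 2 - x 4 - (c0 - x 4)) (x 3 - x 4 - (c0 - x 4)) (- (c0 - x 4)) = X"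
    unfolding X_def by simp
  have X: "X \<in> carrier_vec 4" "?A *\<^sub>v X = 1 \<cdot>\<^sub>v X"
    using A_mat_mult_position[OF lr refl refl refl] unfolding X' by (simp_all add: X_def)
  have GX: "circ_form m X X \<noteq> 0" using circ_form_position[OF lr] m unfolding X' by auto
  have "X \<noteq> 0\<^sub>v 4"
  proof
    assume X0: "X = 0\<^sub>v 4"
    have "circ_form m X X = 0" unfolding X0 by (simp add: circ_form_def)
    thus False using GX by simp
  qed note X = X this
  have orth: "circ_form m u X = 0" if u: "u \<in> carrier_vec 4" "?A *\<^sub>v u = t \<cdot>\<^sub>v u" "t \<noteq> 1" for u t
  proof -
    have "circ_form m (?A *\<^sub>v u) X = circ_form m u (?A *\<^sub>v X)" by (rule circ_form_A_mat[OF u(1) X(1)])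
    hence "t * circ_form m u X = circ_form m u X" unfolding u(2) X(2)
      using u(1) by (simp add: circ_form_def algebra_simps)
    thus ?thesis using u(3) by simp
  qed
  note u = u0(1) u1(1) u2(1) X(1) and e = u0(3) u1(3) u2(3) X(2) and nz = u0(2) u1(2) u2(2) X(3)
  have kd: "0 \<noteq> k1" "0 \<noteq> k2" "0 \<noteq> (1::real)" "k1 \<noteq> k2" "k1 \<noteq> 1" "k2 \<noteq> 1" using k by auto
  note inj = cols4_eigen_inj[OF A u e nz kd] and surj = cols4_eigen_surj[OF A u e nz kd]
    and Wk = mult_cols4_eigen[OF A u e]
  let ?W = "cols4 u0 u1 u2 X"
  \<comment> \<open>Pairing with X reads off the last coordinate, so membership in
    \<open>V_perp\<close> means that this coordinate is 0 in both halves.\<close>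
  have WX: "circ_form m (?W *\<^sub>v vec4 s0 s1 s2 s3) X = s3 * circ_form m X X" for s0 s1 s2 s3
  proof -
    have "circ_form m (?W *\<^sub>v vec4 s0 s1 s2 s3) X = s0 * circ_form m u0 X + s1 * circ_form m u1 X
       + s2 * circ_form m u2 X + s3 * circ_form m X X"
      unfolding circ_form_def by (simp add: cols4_mult_index algebra_simps del: index_mult_mat_vec)
    thus ?thesis using orth[OF u0(1,3)] orth[OF u1(1,3)] orth[OF u2(1,3)] kd by simp
  qed
  \<comment> \<open>On the plane of an eigenvector u for k the stability matrix multiplies by 1 - k
    in one direction and by -(1 + k) in the other. Scaling the two copies of u by the square roots
    of 1 - k and 1 + k balances these factors to a rotation block.\<close>
  define a1 a2 b1 b2 where "a1 = sqrt (1 - k1)" and "a2 = sqrt (1 - k2)" and "b1 = sqrt (1 + k1)" and "b2 = sqrt (1 + k2)"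
  have ab: "a1 > 0" "a2 > 0" "b1 > 0" "b2 > 0" "a1 * a1 = 1 - k1" "a2 * a2 = 1 - k2" "b1 * b1 = 1 + k1" "b2 * b2 = 1 + k2"
    using k by (simp_all add: a1_def a2_def b1_def b2_def)
  define Q where "Q = mat_of_cols 8 [u0 @\<^sub>v 0\<^sub>v 4, 0\<^sub>v 4 @\<^sub>v u0, (a1 \<cdot>\<^sub>v u1) @\<^sub>v 0\<^sub>v 4, 0\<^sub>v 4 @\<^sub>v (b1 \<cdot>\<^sub>v u1),
      (a2 \<cdot>\<^sub>v u2) @\<^sub>v 0\<^sub>v 4, 0\<^sub>v 4 @\<^sub>v (b2 \<cdot>\<^sub>v u2)]"
  \<comment> \<open>The first block belongs to \<open>u0\<close> and carries the trivial pair i, -i;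
    the other frequencies are sqrt (1 - k^2).\<close>
  define D where "D = diag_block_mat (map rotation_block [1, a1 * b1, a2 * b2])"
  have Q: "Q \<in> carrier_mat 8 6" by (rule carrier_matI) (simp_all add: Q_def)
  have Qc: "Q *\<^sub>v c = (?W *\<^sub>v vec4 (c $ 0) (a1 * c $ 2) (a2 * c $ 4) 0) @\<^sub>v (?W *\<^sub>v vec4 (c $ 1) (b1 * c $ 3) (b2 * c $ 5) 0)"
    (is "_ = ?rhs c") if c: "c \<in> carrier_vec 6" for c
  proof (rule eq_vecI)
    fix i assume "i < dim_vec (?rhs c)"
    hence i: "i < 8" by (simp add: cols4_def)
    have dW: "dim_vec (?W *\<^sub>v w) = 4" for w by (simp add: cols4_def)
    have "(Q *\<^sub>v c) $ i = Q $$ (i, 0) * c $ 0 + Q $$ (i, 1) * c $ 1 + Q $$ (i, 2) * c $ 2 + Q $$ (i, 3) * c $ 3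
      + Q $$ (i, 4) * c $ 4 + Q $$ (i, 5) * c $ 5"
      using i Q c by (simp add: scalar_prod_def sum_upt_6)
    also have "\<dots> = ?rhs c $ i"
    proof (cases "i < 4")
      case True
      thus ?thesis using i u
        by (simp add: Q_def mat_of_cols_index index_append_vec dW cols4_mult_index del: index_mult_mat_vec)
    next
      case False
      hence "i - 4 < 4" using i by simp
      thus ?thesis using i u False
        by (simp add: Q_def mat_of_cols_index index_append_vec dW cols4_mult_index del: index_mult_mat_vec)
    qed
    finally show "(Q *\<^sub>v c) $ i = ?rhs c $ i" .
  qed (use Q in \<open>simp add: cols4_def\<close>)
  have Vp: "w @\<^sub>v w' \<in> V_perp m x \<longleftrightarrow> circ_form m w X = 0 \<and> circ_form m w' X = 0"
    if "w \<in> carrier_vec 4" "w' \<in> carrier_vec 4" for w w'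
    using V_perp_iff[OF c0_def that] unfolding X_def .
  have Wc: "?W *\<^sub>v w \<in> carrier_vec 4" if "w \<in> carrier_vec 4" for w
    using that by (intro mult_mat_vec_carrier[OF cols4_carrier])
  have bij: "bij_betw (\<lambda>c. Q *\<^sub>v c) (carrier_vec 6) (V_perp m x)"
    unfolding bij_betw_def
  proof (intro conjI equalityI subsetI)
    show "inj_on (\<lambda>c. Q *\<^sub>v c) (carrier_vec 6)"
    proof (rule inj_onI)
      fix c c' :: "real vec" assume c: "c \<in> carrier_vec 6" "c' \<in> carrier_vec 6" and eq: "Q *\<^sub>v c = Q *\<^sub>v c'"
      have W0: "s0 = t0 \<and> s1 = t1 \<and> s2 = t2" if "?W *\<^sub>v vec4 s0 s1 s2 0 = ?W *\<^sub>v vec4 t0 t1 t2 0" for s0 s1 s2 t0 t1 t2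
      proof -
        have "?W *\<^sub>v vec4 (s0 - t0) (s1 - t1) (s2 - t2) 0 = 0\<^sub>v 4"
        proof (rule eq_vecI)
          fix i assume "i < dim_vec (0\<^sub>v 4 :: real vec)"
          hence i: "i < 4" by simp
          from arg_cong[OF that, of "\<lambda>v. v $ i"]
          show "(?W *\<^sub>v vec4 (s0 - t0) (s1 - t1) (s2 - t2) 0) $ i = 0\<^sub>v 4 $ i"
            using i by (simp add: cols4_mult_index algebra_simps del: index_mult_mat_vec)
        qed (simp add: cols4_def)
        from inj[OF this] show ?thesis by simp
      qed
      have "?W *\<^sub>v vec4 (c $ 0) (a1 * c $ 2) (a2 * c $ 4) 0 = ?W *\<^sub>v vec4 (c' $ 0) (a1 * c' $ 2) (a2 * c' $ 4) 0"
        "?W *\<^sub>v vec4 (c $ 1) (b1 * c $ 3) (b2 * c $ 5) 0 = ?W *\<^sub>v vec4 (c' $ 1) (b1 * c' $ 3) (b2 * c' $ 5) 0"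
        using eq unfolding Qc[OF c(1)] Qc[OF c(2)] by (simp_all add: append_vec_eq[OF Wc Wc])
      from W0[OF this(1)] W0[OF this(2)]
      have *: "c $ 0 = c' $ 0" "c $ 1 = c' $ 1" "c $ 2 = c' $ 2" "c $ 3 = c' $ 3" "c $ 4 = c' $ 4" "c $ 5 = c' $ 5"
        using ab by simp_all
      show "c = c'"
      proof (rule eq_vecI)
        fix i assume "i < dim_vec c'"
        hence "i < 6" using c by simp
        hence "i = 0 \<or> i = 1 \<or> i = 2 \<or> i = 3 \<or> i = 4 \<or> i = 5" by arith
        thus "c $ i = c' $ i" using * by (elim disjE) (simp_all only:)
      qed (use c in simp)
    qed
  next
    fix y assume "y \<in> (\<lambda>c. Q *\<^sub>v c) ` carrier_vec 6"
    then obtain c where c: "c \<in> carrier_vec 6" "y = Q *\<^sub>v c" by blast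
    show "y \<in> V_perp m x" unfolding c(2) Qc[OF c(1)] by (subst Vp) (auto simp: Wc WX)
  next
    fix y assume y: "y \<in> V_perp m x"
    hence "y \<in> carrier_vec (4 + 4)" by (simp add: V_perp_def)
    from vec_first_last_append[OF this] have ya: "y = vec_first y 4 @\<^sub>v vec_last y 4" by simp
    obtain s0 s1 s2 s3 where s: "vec_first y 4 = ?W *\<^sub>v vec4 s0 s1 s2 s3" by (rule surj[of "vec_first y 4"]) auto
    obtain t0 t1 t2 t3 where t: "vec_last y 4 = ?W *\<^sub>v vec4 t0 t1 t2 t3" by (rule surj[of "vec_last y 4"]) auto
    have "?W *\<^sub>v vec4 s0 s1 s2 s3 @\<^sub>v ?W *\<^sub>v vec4 t0 t1 t2 t3 \<in> V_perp m x" using y ya s t by simp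
    hence "s3 * circ_form m X X = 0" "t3 * circ_form m X X = 0" by (simp_all add: Vp Wc WX)
    hence z: "s3 = 0" "t3 = 0" using GX by simp_all
    define c where "c = vec 6 (\<lambda>i. if i = 0 then s0 else if i = 1 then t0 else if i = 2 then s1 / a1 else if i = 3 then t1 / b1
       else if i = 4 then s2 / a2 else t2 / b2)"
    have c: "c \<in> carrier_vec 6" by (simp add: c_def)
    have "c $ 0 = s0" "c $ 1 = t0" "a1 * c $ 2 = s1" "b1 * c $ 3 = t1" "a2 * c $ 4 = s2" "b2 * c $ 5 = t2"
      using ab by (simp_all add: c_def)
    hence "Q *\<^sub>v c = vec_first y 4 @\<^sub>v vec_last y 4"
      unfolding Qc[OF c] s t z by (simp only:)
    hence "Q *\<^sub>v c = y" by (simp only: ya[symmetric])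
    thus "y \<in> (\<lambda>c. Q *\<^sub>v c) ` carrier_vec 6" using c by blast
  qed
  let ?B = "stability_matrix m \<omega> x"
  have B: "?B \<in> carrier_mat 8 8" unfolding stability_matrix_blocks by (rule carrier_matI) simp_all
  have D: "D \<in> carrier_mat 6 6" unfolding D_def by (rule rotation_blocks_mult(1)[of "0\<^sub>v 6"]) simp
  have BQ: "?B *\<^sub>v (Q *\<^sub>v c) = Q *\<^sub>v (D *\<^sub>v c)" if c: "c \<in> carrier_vec 6" for c
  proof -
    have Dc: "D *\<^sub>v c \<in> carrier_vec 6" using D c by simp
    have mn: "(1\<^sub>m 4 - ?A) *\<^sub>v (?W *\<^sub>v vec4 s0 s1 s2 0) = ?W *\<^sub>v vec4 s0 ((1 - k1) * s1) ((1 - k2) * s2) 0"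
      "(- (1\<^sub>m 4 + ?A)) *\<^sub>v (?W *\<^sub>v vec4 s0 s1 s2 0) = ?W *\<^sub>v vec4 (- s0) (- (1 + k1) * s1) (- (1 + k2) * s2) 0" for s0 s1 s2
    proof -
      define w where "w = ?W *\<^sub>v vec4 s0 s1 s2 0"
      have w: "w \<in> carrier_vec 4" by (simp add: w_def Wc)
      have Aw: "?A *\<^sub>v w = ?W *\<^sub>v vec4 (0 * s0) (k1 * s1) (k2 * s2) (1 * 0)" unfolding w_def by (rule Wk)
      have "(1\<^sub>m 4 - ?A) *\<^sub>v w = w - ?A *\<^sub>v w"
        using w by (subst minus_mult_distrib_mat_vec[of _ 4 4]) auto
      moreover have "(- (1\<^sub>m 4 + ?A)) *\<^sub>v w = - (w + ?A *\<^sub>v w)"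
      proof -
        have "(- (1\<^sub>m 4 + ?A)) *\<^sub>v w = - ((1\<^sub>m 4 + ?A) *\<^sub>v w)"
          by (rule uminus_mult_mat_vec) (use w in \<open>simp add: A_mat_def\<close>)
        thus ?thesis using w by (simp add: add_mult_distrib_mat_vec[of _ 4 4])
      qed
      moreover have "w - ?A *\<^sub>v w = ?W *\<^sub>v vec4 s0 ((1 - k1) * s1) ((1 - k2) * s2) 0"
        unfolding Aw unfolding w_def
        by (rule eq_vecI) (simp_all add: cols4_mult_index algebra_simps del: index_mult_mat_vec)
      moreover have "- (w + ?A *\<^sub>v w) = ?W *\<^sub>v vec4 (- s0) (- (1 + k1) * s1) (- (1 + k2) * s2) 0"
        unfolding Aw unfolding w_def
        by (rule eq_vecI) (simp_all add: cols4_mult_index algebra_simps del: index_mult_mat_vec)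
      ultimately show "(1\<^sub>m 4 - ?A) *\<^sub>v (?W *\<^sub>v vec4 s0 s1 s2 0) = ?W *\<^sub>v vec4 s0 ((1 - k1) * s1) ((1 - k2) * s2) 0"
        "(- (1\<^sub>m 4 + ?A)) *\<^sub>v (?W *\<^sub>v vec4 s0 s1 s2 0) = ?W *\<^sub>v vec4 (- s0) (- (1 + k1) * s1) (- (1 + k2) * s2) 0"
        unfolding w_def by simp_all
    qed
    have zero: "0\<^sub>m 4 4 *\<^sub>v (?W *\<^sub>v vec4 s0 s1 s2 s3) = 0\<^sub>v 4" for s0 s1 s2 s3
      by (rule eq_vecI) (simp_all add: Wc)
    have "?B *\<^sub>v (Q *\<^sub>v c) =
        (0\<^sub>m 4 4 *\<^sub>v (?W *\<^sub>v vec4 (c $ 0) (a1 * c $ 2) (a2 * c $ 4) 0) + (1\<^sub>m 4 - ?A) *\<^sub>v (?W *\<^sub>v vec4 (c $ 1) (b1 * c $ 3) (b2 * c $ 5) 0))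
     @\<^sub>v ((- (1\<^sub>m 4 + ?A)) *\<^sub>v (?W *\<^sub>v vec4 (c $ 0) (a1 * c $ 2) (a2 * c $ 4) 0) + 0\<^sub>m 4 4 *\<^sub>v (?W *\<^sub>v vec4 (c $ 1) (b1 * c $ 3) (b2 * c $ 5) 0))"
      unfolding Qc[OF c] stability_matrix_blocks
      by (rule four_block_mat_mult_vec[of _ 4 4 _ 4 _ 4]) (auto intro!: Wc minus_carrier_mat)
    also have "\<dots> = (?W *\<^sub>v vec4 (c $ 1) ((1 - k1) * (b1 * c $ 3)) ((1 - k2) * (b2 * c $ 5)) 0)
     @\<^sub>v (?W *\<^sub>v vec4 (- c $ 0) (- (1 + k1) * (a1 * c $ 2)) (- (1 + k2) * (a2 * c $ 4)) 0)"
      unfolding zero mn by (simp add: Wc left_zero_vec right_zero_vec)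
    also have "\<dots> = Q *\<^sub>v (D *\<^sub>v c)"
    proof -
      have "a1 * (a1 * b1 * c $ 3) = (1 - k1) * (b1 * c $ 3)" "a2 * (a2 * b2 * c $ 5) = (1 - k2) * (b2 * c $ 5)"
        "b1 * (- (a1 * b1) * c $ 2) = - (1 + k1) * (a1 * c $ 2)" "b2 * (- (a2 * b2) * c $ 4) = - (1 + k2) * (a2 * c $ 4)"
        unfolding ab(5-8)[symmetric] by simp_all
      thus ?thesis unfolding Qc[OF Dc] unfolding D_def rotation_blocks_mult(2-7)[OF c]
        by (simp only: mult_1 mult_minus1)
    qed
    finally show ?thesis .
  qed
  have "?B * Q = Q * D"
  proof (rule mat_col_eqI)
    fix j assume "j < dim_col (Q * D)"
    hence j: "j < 6" using D by simp
    have "col (?B * Q) j = (?B * Q) *\<^sub>v unit_vec 6 j"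
      using j B Q by (intro mult_unit_vec_eq_col[of _ 8, symmetric]) auto
    also have "\<dots> = ?B *\<^sub>v (Q *\<^sub>v unit_vec 6 j)" using B Q by (intro assoc_mult_mat_vec) auto
    also have "\<dots> = Q *\<^sub>v (D *\<^sub>v unit_vec 6 j)" by (rule BQ) simp
    also have "\<dots> = (Q * D) *\<^sub>v unit_vec 6 j" using D Q by (intro assoc_mult_mat_vec[symmetric]) auto
    also have "\<dots> = col (Q * D) j"
      using j D Q by (intro mult_unit_vec_eq_col[of _ 8]) auto
    finally show "col (?B * Q) j = col (Q * D) j" .
  qed (use B Q D in auto)
  thus ?thesis unfolding linearly_stable_def
    using st Q bij by (intro conjI exI[of _ "[1, a1 * b1, a2 * b2]"] exI[of _ Q]) (simp_all add: D_def)
qed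

subsection \<open>Explicit shape parameters and existence in Group II\<close>

definition shape_disc :: "real \<Rightarrow> real" where
  "shape_disc m = ((1 - m) * (4 * m + 9))\<^sup>2 + 24 * (m + 2) * (m + 3)\<^sup>2 * (1 + 2 * m)"

text \<open>The quadratic formula with rationalized numerator: the leading coefficient vanishes at m
  = -1/2, where the Group I root stays finite.\<close>

definition v_I :: "real \<Rightarrow> real" where
  "v_I m = 12 * (m + 3) / ((1 - m) * (4 * m + 9) + sqrt (shape_disc m))"

definition v_II :: "real \<Rightarrow> real" where
  "v_II m = - ((1 - m) * (4 * m + 9) + sqrt (shape_disc m)) / (2 * ((m + 2) * (m + 3) * (1 + 2 * m)))"

lemma shape_disc_root:
  assumes "shape_poly m v = 0"
  shows "shape_disc m = (2 * ((m + 2) * (m + 3) * (1 + 2 * m)) * v + (1 - m) * (4 * m + 9))\<^sup>2"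
proof -
  define L B G where "L = (m + 2) * (m + 3) * (1 + 2 * m)" and "B = (1 - m) * (4 * m + 9)" and "G = 6 * (m + 3)"
  have g: "L * v\<^sup>2 + B * v - G = 0" using assms by (simp add: shape_poly_def L_def B_def G_def)
  have "(2 * L * v + B)\<^sup>2 = 4 * L * (L * v\<^sup>2 + B * v - G) + (B\<^sup>2 + 4 * L * G)"
    by (simp add: algebra_simps power2_eq_square)
  also have "\<dots> = shape_disc m" unfolding g
    by (simp add: shape_disc_def L_def B_def G_def power2_eq_square algebra_simps)
  finally show ?thesis by (simp add: L_def B_def)
qed

lemma root_I_eq_v_I:
  assumes m: "m > -1" and v: "root_I m v"
  shows "v = v_I m"
proof -
  define L B G where "L = (m + 2) * (m + 3) * (1 + 2 * m)" and "B = (1 - m) * (4 * m + 9)" and "G = 6 * (m + 3)"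
  have v': "0 < v" "v < 3 / (m + 2)" "shape_poly m v = 0" using v by (auto simp: root_I_def)
  have g: "L * v\<^sup>2 + B * v = G" using v'(3) by (simp add: shape_poly_def L_def B_def G_def)
  have G: "G > 0" using m by (simp add: G_def)
  have LB: "v * (L * v + B) = G" using g by (simp add: algebra_simps power2_eq_square)
  hence LB0: "L * v + B > 0" using G v' by (simp add: zero_less_mult_iff flip: LB)
  \<comment> \<open>The derivative of \<open>shape_poly\<close> at v, whose sign selects the branch
    of the square root. For L < 0 the chord from v to 3 / (m + 2) has positive slope, and by
    concavity the tangent at v is at least as steep.\<close>
  have "2 * L * v + B > 0"
  proof (cases "L \<ge> 0")
    case True
    hence "L * v \<ge> 0" using v' by simp
    thus ?thesis using LB0 by simp
  next
    case False
    define V where "V = 3 / (m + 2)"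
    have V: "v < V" "shape_poly m V > 0" using v' shape_poly_bound[OF m] by (simp_all add: V_def)
    have "(V - v) * (L * (V + v) + B) = shape_poly m V - shape_poly m v"
      by (simp add: shape_poly_def L_def B_def algebra_simps power2_eq_square)
    also have "\<dots> > 0" using V v' by simp
    finally have "L * (V + v) + B > 0" using V by (simp add: zero_less_mult_iff)
    moreover have "L * (V + v) \<le> L * (2 * v)" using False V by (intro mult_left_mono_neg) auto
    ultimately show ?thesis by simp
  qed
  hence "sqrt (shape_disc m) = 2 * L * v + B"
    unfolding shape_disc_root[OF v'(3)] by (simp add: L_def B_def)
  hence "v_I m = 2 * G / (2 * (L * v + B))" unfolding v_I_def B_def[symmetric] by (simp add: G_def algebra_simps)
  also have "\<dots> = v"
  proof -
    define Y where "Y = L * v + B"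
    show ?thesis using LB0 unfolding LB[symmetric] Y_def[symmetric] by simp
  qed
  finally show ?thesis ..
qed

lemma root_II_eq_v_II:
  assumes m: "m > -1/2" and v: "root_II m v"
  shows "v = v_II m"
proof -
  define L B G where "L = (m + 2) * (m + 3) * (1 + 2 * m)" and "B = (1 - m) * (4 * m + 9)" and "G = 6 * (m + 3)"
  have v': "v < 0" "shape_poly m v = 0" using v by (auto simp: root_II_def)
  have L: "L > 0" and G: "G > 0" using m by (simp_all add: L_def G_def)
  have "v * (L * v + B) = G" using v'(2) by (simp add: shape_poly_def L_def B_def G_def algebra_simps power2_eq_square)
  hence "v * (L * v + B) > 0" using G by simp
  hence "L * v + B < 0" using v' by (simp add: zero_less_mult_iff)
  moreover have "L * v < 0" using L v' by (simp add: mult_pos_neg)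
  \<comment> \<open>At the negative root the derivative is negative, which selects the other
    branch.\<close>
  ultimately have "2 * L * v + B < 0" by simp
  hence "sqrt (shape_disc m) = - (2 * L * v + B)"
    unfolding shape_disc_root[OF v'(2)] by (simp add: L_def B_def)
  thus ?thesis unfolding v_II_def B_def[symmetric] L_def[symmetric] using L by (simp add: field_simps)
qed

text \<open>Produces roots without a configuration. This yields the data at \<open>m_c\<close>
  independently of any solution there, and it starts the construction of the Group II
  solutions.\<close>

lemma
  assumes m: "m > -1/2"
  shows root_I_v_I: "root_I m (v_I m)" and root_II_v_II: "root_II m (v_II m)"
proof -
  define L B G where "L = (m + 2) * (m + 3) * (1 + 2 * m)" and "B = (1 - m) * (4 * m + 9)" and "G = 6 * (m + 3)"
  have L: "L > 0" and G: "G > 0" using m by (simp_all add: L_def G_def)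
  define R where "R = sqrt (shape_disc m)"
  have D: "shape_disc m = B\<^sup>2 + 4 * (L * G)"
    by (simp add: shape_disc_def L_def B_def G_def power2_eq_square algebra_simps)
  have LG: "L * G > 0" using L G by simp
  have "B\<^sup>2 + 4 * (L * G) \<ge> 0" using LG zero_le_power2[of B] by linarith
  hence R2: "R\<^sup>2 = B\<^sup>2 + 4 * L * G" unfolding R_def D by simp
  have "\<bar>B\<bar> < R" unfolding R_def D using LG by (intro real_less_rsqrt) (unfold power2_abs, linarith)
  hence S: "B + R > 0" by linarith
  have sp: "shape_poly m v = L * v\<^sup>2 + B * v - G" for v by (simp add: shape_poly_def L_def B_def G_def)
  have vI: "v_I m = 2 * G / (B + R)" by (simp add: v_I_def B_def G_def R_def)
  have vII: "v_II m = - (B + R) / (2 * L)" by (simp add: v_II_def B_def L_def R_def)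
  have S2: "(B + R)\<^sup>2 = 2 * B * (B + R) + 4 * L * G" using R2 by (simp add: power2_eq_square algebra_simps)
  have "(B + R)\<^sup>2 * shape_poly m (v_I m) = 0"
  proof -
    define y where "y = v_I m"
    have y: "(B + R) * y = 2 * G" using S by (simp add: y_def vI)
    have "(B + R)\<^sup>2 * shape_poly m y = L * ((B + R) * y)\<^sup>2 + B * (B + R) * ((B + R) * y) - G * (B + R)\<^sup>2"
      unfolding sp by (simp add: power2_eq_square algebra_simps)
    also have "\<dots> = 0" unfolding y S2 by (simp add: power2_eq_square algebra_simps)
    finally show ?thesis by (simp add: y_def)
  qed
  hence "shape_poly m (v_I m) = 0" using S by simp
  moreover have "v_I m > 0" using S G by (simp add: vI)
  ultimately show "root_I m (v_I m)" using m by (intro root_I_if_pos)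
  have "4 * L * shape_poly m (v_II m) = 0"
  proof -
    define y where "y = v_II m"
    have y: "2 * L * y = - (B + R)" using L by (simp add: y_def vII)
    have "4 * L * shape_poly m y = (2 * L * y)\<^sup>2 + 2 * B * (2 * L * y) - 4 * L * G"
      unfolding sp by (simp add: power2_eq_square algebra_simps)
    also have "\<dots> = 0" unfolding y power2_minus S2 by (simp add: algebra_simps)
    finally show ?thesis by (simp add: y_def)
  qed
  hence "shape_poly m (v_II m) = 0" using L by simp
  moreover have "v_II m < 0" using S L unfolding vII by (intro divide_neg_pos) auto
  ultimately show "root_II m (v_II m)" by (simp add: root_II_def)
qed

section \<open>Construction of the Group II solutions\<close>

lemma line_re_if_symmetric_functions:
  fixes m \<omega> c a b d :: real
  assumes nz: "\<omega> \<noteq> 0" "a \<noteq> 0" "b \<noteq> 0" "d \<noteq> 0" "a \<noteq> b" "a \<noteq> d" "b \<noteq> d"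
  defines "e1 \<equiv> a + b + d" and "e2 \<equiv> a * b + a * d + b * d" and "e3 \<equiv> a * b * d"
  assumes E: "e1 = (m + 3) * c" "e2 = \<omega> * c * e3"
    "2 * \<omega> * e2 = - 3 * (1 + m) + \<omega> * c * (2 + m) * e1"
    "3 * \<omega> * e3 = - (1 + 2 * m) * e1 + \<omega> * c * (1 + m) * e2"
  shows "line_re m \<omega> c a b d"
proof -
  have row: "\<omega> * (y - c) = 1 / (y - z) + 1 / (y - w) + m / y"
    if "y + z + w = e1" "y * z + y * w + z * w = e2" "y * z * w = e3" "y \<noteq> 0" "y \<noteq> z" "y \<noteq> w" for y z w
  proof -
    define \<sigma> where "\<sigma> = \<omega> * c"
    note E' = E[folded \<sigma>_def, folded that(1-3)]
    have "\<omega> * (y + z + w) = (m + 3) * \<sigma>" using E'(1) by (simp add: \<sigma>_def)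
    with E'(2-4) have D: "\<omega> * (y + z + w) - (m + 3) * \<sigma> = 0"
      "2 * \<omega> * (y * z + y * w + z * w) - (- 3 * (1 + m) + \<sigma> * (2 + m) * (y + z + w)) = 0"
      "3 * \<omega> * (y * z * w) - (- (1 + 2 * m) * (y + z + w) + \<sigma> * (1 + m) * (y * z + y * w + z * w)) = 0"
      "(y * z + y * w + z * w) - \<sigma> * (y * z * w) = 0" by simp_all
    \<comment> \<open>The force equation of y, cleared of denominators, is a combination of the four
      relations with coefficients y^3, -y^2, y and -m.\<close>
    have "(\<omega> * y - \<sigma>) * (y * (y - z) * (y - w)) - (y * (y - w) + y * (y - z) + m * ((y - z) * (y - w)))
      = y * (y\<^sup>2 * (\<omega> * (y + z + w) - (m + 3) * \<sigma>)
          - y * (2 * \<omega> * (y * z + y * w + z * w) - (- 3 * (1 + m) + \<sigma> * (2 + m) * (y + z + w)))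
          + (3 * \<omega> * (y * z * w) - (- (1 + 2 * m) * (y + z + w) + \<sigma> * (1 + m) * (y * z + y * w + z * w))))
        - m * ((y * z + y * w + z * w) - \<sigma> * (y * z * w))"
      by (simp add: algebra_simps power2_eq_square)
    also have "\<dots> = 0" unfolding D by simp
    finally have "(\<omega> * y - \<sigma>) * (y * (y - z) * (y - w)) = y * (y - w) + y * (y - z) + m * ((y - z) * (y - w))" by simp
    moreover have "y - z \<noteq> 0" "y - w \<noteq> 0" using that by auto
    ultimately have "\<omega> * y - \<sigma> = (y * (y - w) + y * (y - z) + m * ((y - z) * (y - w))) / (y * (y - z) * (y - w))"
      using that(4) by (simp add: eq_divide_eq)
    also have "\<dots> = 1 / (y - z) + 1 / (y - w) + m / y"
      using that(4) \<open>y - z \<noteq> 0\<close> \<open>y - w \<noteq> 0\<close> by (simp add: add_divide_distrib)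
    finally show ?thesis by (simp add: \<sigma>_def algebra_simps)
  qed
  have "1 / a + 1 / b + 1 / d = e2 / e3" using nz by (simp add: e2_def e3_def field_simps)
  also have "\<dots> = \<omega> * c" using E(2) nz by (simp add: e3_def)
  finally have "\<omega> * c = 1 / a + 1 / b + 1 / d" ..
  moreover have "\<omega> * (a - c) = 1 / (a - b) + 1 / (a - d) + m / a"
    by (rule row) (use nz in \<open>simp_all add: e1_def e2_def e3_def\<close>)
  moreover have "\<omega> * (b - c) = 1 / (b - a) + 1 / (b - d) + m / b"
    by (rule row) (use nz in \<open>simp_all add: e1_def e2_def e3_def\<close>)
  moreover have "\<omega> * (d - c) = 1 / (d - a) + 1 / (d - b) + m / d"
    by (rule row) (use nz in \<open>simp_all add: e1_def e2_def e3_def\<close>)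
  ultimately show ?thesis using nz E(1) by (simp add: line_re_def e1_def)
qed

text \<open>Here b and d would be the roots of X^2 - s * X + t, and q is (a - b) * (a - d). Subtract
  the force equations of b and d, divide by b - d and clear denominators: this is the result.
  Derived from the symmetric relations alone, it holds before b and d are known to be real.\<close>

lemma quadratic_factor_disc:
  fixes a s t \<sigma> \<omega> m :: real
  defines "q \<equiv> a\<^sup>2 - a * s + t" and "\<Delta> \<equiv> s\<^sup>2 - 4 * t"
  assumes E: "\<omega> * (a + s) = (m + 3) * \<sigma>" "a * s + t = \<sigma> * (a * t)"
    "2 * \<omega> * (a * s + t) = - 3 * (1 + m) + \<sigma> * (2 + m) * (a + s)"
    "3 * \<omega> * (a * t) = - (1 + 2 * m) * (a + s) + \<sigma> * (1 + m) * (a * s + t)"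
  shows "t * (q * \<Delta> * \<omega> + \<Delta> - 2 * q) + m * q * \<Delta> = 0"
proof -
  have D: "\<omega> * (a + s) - (m + 3) * \<sigma> = 0" "(a * s + t) - \<sigma> * (a * t) = 0"
    "2 * \<omega> * (a * s + t) - (- 3 * (1 + m) + \<sigma> * (2 + m) * (a + s)) = 0"
    "3 * \<omega> * (a * t) - (- (1 + 2 * m) * (a + s) + \<sigma> * (1 + m) * (a * s + t)) = 0"
    using E by simp_all
  have "t * (q * \<Delta> * \<omega> + \<Delta> - 2 * q) + m * q * \<Delta> =
    t * ((\<omega> * (a + s) - (m + 3) * \<sigma>) * (t * s - a * (s\<^sup>2 - 2 * t))
       - (2 * \<omega> * (a * s + t) - (- 3 * (1 + m) + \<sigma> * (2 + m) * (a + s))) * (2 * t - a * s)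
       + (3 * \<omega> * (a * t) - (- (1 + 2 * m) * (a + s) + \<sigma> * (1 + m) * (a * s + t))) * (s - 2 * a))
    - m * (s\<^sup>2 - a * s - 2 * t) * ((a * s + t) - \<sigma> * (a * t))"
    unfolding q_def \<Delta>_def by (simp add: algebra_simps power2_eq_square)
  also have "\<dots> = 0" unfolding D by simp
  finally show ?thesis .
qed

text \<open>Taking c = 1 fixes the scale; then \<omega> is u, and \<open>v_II\<close> prescribes the
  three symmetric functions. It remains to see that their cubic has three distinct real roots: the
  negative one by the intermediate value theorem, the others through the discriminant of the
  remaining quadratic factor.\<close>

lemma line_re_interior_exists:
  assumes m: "m > -1/2"
  obtains \<omega> c a b d where "line_re m \<omega> c a b d" "a < 0" "0 < b" "b < d"
proof -
  define v where "v = v_II m"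
  have v: "v < 0" "shape_poly m v = 0" using root_II_v_II[OF m] by (simp_all add: v_def root_II_def)
  \<comment> \<open>The affine relation between \<omega> * c^2 and v, solved for the former.\<close>
  define u where "u = (3 + (1 + 2 * m) * v) / (1 + m)"
  have u1: "(1 + m) * u = 3 + (1 + 2 * m) * v" using m by (simp add: u_def)
  have "(1 + m) * (v * ((m + 2) * (m + 3) * u - 3 * (1 + m)) - 2 * (m + 3) * u)
     = v * ((m + 2) * (m + 3) * ((1 + m) * u) - 3 * (1 + m)\<^sup>2) - 2 * (m + 3) * ((1 + m) * u)"
    by (simp add: algebra_simps power2_eq_square)
  also have "\<dots> = shape_poly m v" unfolding u1 shape_poly_def by (simp add: algebra_simps power2_eq_square)
  finally have u2: "v * ((m + 2) * (m + 3) * u - 3 * (1 + m)) = 2 * (m + 3) * u" using v m by simp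
  hence "u * ((m + 3) * (v * (m + 2) - 2)) = 3 * ((1 + m) * v)" by (simp add: algebra_simps)
  moreover have "3 * ((1 + m) * v) < 0" using v m by (simp add: mult_pos_neg)
  moreover have "v * (m + 2) - 2 < 0" using v m mult_neg_pos[of v "m + 2"] by simp
  hence "(m + 3) * (v * (m + 2) - 2) < 0" using m by (intro mult_pos_neg) auto
  ultimately have u: "u > 0" by (metis mult_less_0_iff order_less_asym)
  define e1 e3 where "e1 = m + 3" and "e3 = (m + 3) / (u * v)"
  define e2 where "e2 = u * e3"
  have e13: "e1 > 0" "e3 < 0" using m u v by (auto simp: e1_def e3_def intro!: divide_pos_neg mult_pos_neg)
  hence e2: "e2 < 0" using u by (simp add: e2_def mult_pos_neg)
  have e3: "u * e3 * v = m + 3" using u v by (simp add: e3_def)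
  have E1: "e1 = (m + 3) * 1" and E2: "e2 = u * 1 * e3" by (simp_all add: e1_def e2_def)
  have E3: "2 * u * e2 = - 3 * (1 + m) + u * 1 * (2 + m) * e1"
  proof -
    have "v * (2 * u * e2) = 2 * u * (u * e3 * v)" by (simp add: e2_def)
    also have "\<dots> = v * (- 3 * (1 + m) + u * 1 * (2 + m) * e1)"
      unfolding e3 using u2 by (simp add: e1_def algebra_simps)
    finally show ?thesis using v by simp
  qed
  have E4: "3 * u * e3 = - (1 + 2 * m) * e1 + u * 1 * (1 + m) * e2"
  proof -
    have "- (1 + 2 * m) * e1 + u * 1 * (1 + m) * e2 = - (1 + 2 * m) * (u * e3 * v) + u * e3 * ((1 + m) * u)"
      by (simp add: e3 e1_def e2_def)
    also have "\<dots> = 3 * u * e3" unfolding u1 by (simp add: algebra_simps)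
    finally show ?thesis ..
  qed
  define p where "p x = x ^ 3 - e1 * x\<^sup>2 + e2 * x - e3" for x :: real
  \<comment> \<open>A root bound of Cauchy type: as \<open>e2\<close> and \<open>e3\<close> are
    negative, the cubic is not positive at -N.\<close>
  define N where "N = 1 - e2 - e3"
  have N: "N \<ge> 1" using e2 e13 by (simp add: N_def)
  have "p (- N) \<le> 0"
  proof -
    have "N * (- e2) + (- e3) \<le> N * (- e2) + N * (- e3)" using N e13 by (simp add: mult_le_cancel_right1)
    also have "\<dots> = N * (N - 1)" by (simp add: N_def algebra_simps)
    also have "\<dots> \<le> N * (N * N)"
    proof (intro mult_left_mono)
      have "N * 1 \<le> N * N" using N by (intro mult_left_mono) auto
      thus "N - 1 \<le> N * N" by simp
    qed (use N in auto)
    finally have "N * (- e2) + (- e3) \<le> N ^ 3" by (simp add: power3_eq_cube)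
    moreover have "e1 * N\<^sup>2 \<ge> 0" using e13 by simp
    ultimately show ?thesis by (simp add: p_def algebra_simps)
  qed
  moreover have "p 0 \<ge> 0" using e13 by (simp add: p_def)
  moreover have "\<forall>x. - N \<le> x \<and> x \<le> 0 \<longrightarrow> isCont p x" unfolding p_def by (auto intro!: continuous_intros)
  ultimately obtain a where a: "a \<le> 0" "p a = 0" using IVT[of p "- N" 0 0] N by auto
  have "a \<noteq> 0" using a(2) e13 by (auto simp: p_def)
  hence a0: "a < 0" using a(1) by simp
  define s t where "s = e1 - a" and "t = e3 / a"
  have at: "a * t = e3" using a0 by (simp add: t_def)
  have s: "s > 0" using a0 e13 by (simp add: s_def)
  have t: "t > 0" using a0 e13 by (simp add: t_def divide_neg_neg)
  have "a * (a * s + t) = a * e2"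
    using a(2) at by (simp add: p_def s_def algebra_simps eval_nat_numeral)
  hence st: "a * s + t = e2" using a0 by simp
  define q \<Delta> where "q = a\<^sup>2 - a * s + t" and "\<Delta> = s\<^sup>2 - 4 * t"
  have "a * s < 0" using a0 s by (rule mult_neg_pos)
  hence q: "q > 0" using t zero_le_power2[of a] unfolding q_def by linarith
  have key: "t * (q * \<Delta> * u + \<Delta> - 2 * q) + m * q * \<Delta> = 0"
    unfolding q_def \<Delta>_def
    by (rule quadratic_factor_disc[where \<sigma> = u]) (use E2 E3 E4 at st in \<open>simp_all add: s_def e1_def\<close>)
  \<comment> \<open>If \<Delta> <= 0, then \<open>key\<close> demands m * \<Delta> >= 2 * t, whereas
    m > -1/2 gives m * \<Delta> <= -\<Delta> / 2 = 2 * t - s^2 / 2 < 2 * t.\<close>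
  have \<Delta>: "\<Delta> > 0"
  proof (rule ccontr)
    assume "\<not> \<Delta> > 0"
    hence \<Delta>0: "\<Delta> \<le> 0" by simp
    have "t * (q * u + 1) > 0" using t q u by (intro mult_pos_pos add_pos_pos) auto
    hence "t * (q * u + 1) * \<Delta> \<le> 0" using \<Delta>0 by (intro mult_nonneg_nonpos) auto
    hence "t * (q * \<Delta> * u + \<Delta>) \<le> 0" by (simp add: algebra_simps)
    hence "q * (m * \<Delta> - 2 * t) \<ge> 0" using key by (simp add: algebra_simps)
    hence *: "m * \<Delta> - 2 * t \<ge> 0" using q by (simp add: zero_le_mult_iff)
    have "m * \<Delta> \<le> (-1/2) * \<Delta>" using \<Delta>0 m by (intro mult_right_mono_neg) auto
    also have "(-1/2) * \<Delta> < 2 * t"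
    proof -
      have "(-1/2) * \<Delta> = 2 * t - s\<^sup>2 / 2" by (simp add: \<Delta>_def field_simps)
      moreover have "s\<^sup>2 > 0" using s by simp
      ultimately show ?thesis by linarith
    qed
    finally show False using * by simp
  qed
  define b d where "b = (s - sqrt \<Delta>) / 2" and "d = (s + sqrt \<Delta>) / 2"
  have bd: "b + d = s" "b < d" using \<Delta> by (simp_all add: b_def d_def field_simps)
  have "b * d = (s\<^sup>2 - (sqrt \<Delta>)\<^sup>2) / 4" by (simp add: b_def d_def field_simps power2_eq_square)
  hence bt: "b * d = t" using \<Delta> by (simp add: \<Delta>_def)
  have "b > 0"
  proof -
    have "d > 0" using bd s by linarith
    thus ?thesis using bt t by (metis zero_less_mult_pos2)
  qed
  have sym: "a + b + d = e1" "a * b + a * d + b * d = e2" "a * b * d = e3"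
    using bd(1) bt st at by (simp_all add: s_def mult.assoc distrib_left[symmetric])
  have "line_re m u 1 a b d"
  proof (rule line_re_if_symmetric_functions, unfold sym)
    show "u \<noteq> 0" "a \<noteq> 0" "b \<noteq> 0" "d \<noteq> 0" "a \<noteq> b" "a \<noteq> d" "b \<noteq> d" using u a0 \<open>b > 0\<close> bd(2) by auto
  qed (fact E1 E2 E3 E4)+
  thus ?thesis using that a0 \<open>b > 0\<close> bd by blast
qed

text \<open>The affine map sends \<open>y1\<close> to -1, \<open>y2\<close> to 1 and vortex 4 to h.
  Both sides of each force equation acquire the factor 1 / k once \<omega> is divided by k^2; a
  negative k is a reflection.\<close>

lemma line_re_collinear_re:
  assumes r: "line_re m \<omega> c y1 y2 y3" and m: "m > -3"
  defines "k \<equiv> 2 / (y2 - y1)" and "h \<equiv> - (y1 + y2) / (y2 - y1)"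
  shows "collinear_re m (\<omega> / k\<^sup>2)
    (\<lambda>i. if i = 1 then k * y1 + h else if i = 2 then k * y2 + h else if i = 3 then k * y3 + h else h)"
proof -
  note r' = r[unfolded line_re_def]
  have nz: "y1 \<noteq> 0" "y2 \<noteq> 0" "y3 \<noteq> 0" "y1 \<noteq> y2" "y1 \<noteq> y3" "y2 \<noteq> y3" "\<omega> \<noteq> 0" using r' by auto
  have k: "k \<noteq> 0" using nz by (simp add: k_def)
  have n1: "k * y1 + h = - 1" "k * y2 + h = 1"
  proof -
    define D where "D = y2 - y1"
    have D: "D \<noteq> 0" "y2 = y1 + D" using nz by (auto simp: D_def)
    show "k * y1 + h = - 1" "k * y2 + h = 1" unfolding k_def h_def D_def[symmetric] unfolding D(2)
      using D(1) by (simp_all add: field_simps)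
  qed
  have diff: "1 / ((k * z + h) - (k * w + h)) = (1 / k) * (1 / (z - w))" for z w
  proof -
    have "(k * z + h) - (k * w + h) = k * (z - w)" by (simp add: algebra_simps)
    thus ?thesis by (simp only: divide_divide_eq_left times_divide_times_eq mult_1)
  qed
  have diff0: "t / ((k * z + h) - h) = (1 / k) * (t / z)" "1 / (h - (k * z + h)) = (1 / k) * (- (1 / z))" for z t by simp_all
  have cc: "((k * y1 + h) + (k * y2 + h) + (k * y3 + h) + m * h) / (m + 3) = k * c + h"
  proof -
    have "(k * y1 + h) + (k * y2 + h) + (k * y3 + h) + m * h = k * (y1 + y2 + y3) + (m + 3) * h"
      by (simp add: algebra_simps)
    also have "y1 + y2 + y3 = (m + 3) * c" using r' by simp
    finally have "(k * y1 + h) + (k * y2 + h) + (k * y3 + h) + m * h = (m + 3) * (k * c + h)"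
      by (simp add: algebra_simps)
    thus ?thesis using m by simp
  qed
  have eq: "\<omega> / k\<^sup>2 * ((k * z + h) - (k * c + h)) = (1 / k) * (\<omega> * (z - c))" for z
    using k by (simp add: power2_eq_square field_simps)
  have eq0: "\<omega> / k\<^sup>2 * (h - (k * c + h)) = (1 / k) * (- (\<omega> * c))"
    using k by (simp add: power2_eq_square field_simps)
  have m3: "m \<noteq> -3" using m by simp
  define x where "x = (\<lambda>i::nat. if i = 1 then k * y1 + h else if i = 2 then k * y2 + h else if i = 3 then k * y3 + h else h)"
  have x: "x 1 = k * y1 + h" "x 2 = k * y2 + h" "x 3 = k * y3 + h" "x 4 = h" by (simp_all add: x_def)
  have F: "\<omega> * (y1 - c) = 1 / (y1 - y2) + 1 / (y1 - y3) + m / y1" "\<omega> * (y2 - c) = 1 / (y2 - y1) + 1 / (y2 - y3) + m / y2"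
    "\<omega> * (y3 - c) = 1 / (y3 - y1) + 1 / (y3 - y2) + m / y3" using r' by blast+
  have sum4: "- (1 / y1) + - (1 / y2) + - (1 / y3) = - (\<omega> * c)" using r' by simp
  have "relative_equilibrium (circ m) (\<omega> / k\<^sup>2) (\<lambda>i. (x i, 0))"
    unfolding relative_equilibrium_line_iff[OF m3] inj_on_1_4 x cc eq eq0 diff diff0 distrib_left[symmetric] sum4 F
    using nz k by simp
  thus ?thesis unfolding collinear_re_def x_def[symmetric] using n1 by (simp only: x simp_thms)
qed

text \<open>\<open>line_re\<close> is symmetric in the three equal vortices, so a single
  configuration a < 0 < b < d serves all orderings. Whenever \<open>y1\<close> exceeds
  \<open>y2\<close> the normalization reflects the line, which moves vortex 4 from the second to the
  third place.\<close>

lemma group_II_exists: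
  assumes m: "m > -1/2" and p: "p \<in> group_II_orderings"
  shows "\<exists>\<omega> x. collinear_re m \<omega> x \<and> has_ordering x p"
proof -
  obtain \<omega> c a b d where L: "line_re m \<omega> c a b d" and o: "a < 0" "0 < b" "b < d"
    using line_re_interior_exists[OF m] .
  have perm: "line_re m \<omega> c y1 y3 y2" "line_re m \<omega> c y2 y1 y3" if "line_re m \<omega> c y1 y2 y3" for y1 y2 y3
    using that unfolding line_re_def
    by (elim conjE, intro conjI; (assumption | (rule not_sym, assumption) | linarith))+
  have m3: "m > -3" using m by simp
  have main: "\<exists>\<omega> x. collinear_re m \<omega> x \<and> has_ordering x p"
    if "line_re m \<omega> c y1 y2 y3" and "\<And>k h. k * (y2 - y1) > 0 \<Longrightarrow>
       has_ordering (\<lambda>i. if i = 1 then k * y1 + h else if i = 2 then k * y2 + h else if i = 3 then k * y3 + h else h) p"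
    for y1 y2 y3
  proof -
    define D where "D = y2 - y1"
    have "D \<noteq> 0" using that(1) by (auto simp: line_re_def D_def)
    hence "2 / (y2 - y1) * (y2 - y1) > 0" unfolding D_def[symmetric] by simp
    from that(2)[OF this] line_re_collinear_re[OF that(1) m3] show ?thesis by blast
  qed
  have L': "line_re m \<omega> c b d a" "line_re m \<omega> c d b a" "line_re m \<omega> c a b d" "line_re m \<omega> c d a b"
    "line_re m \<omega> c b a d" "line_re m \<omega> c a d b"
    using L perm by blast+
  have sg: "k > 0" if "k * z > 0" "z > 0" for k z :: real using that by (simp add: zero_less_mult_iff)
  have sn: "k < 0" if "k * z > 0" "z < 0" for k z :: real using that by (simp add: zero_less_mult_iff)
  from p consider "p = [1,2,4,3]" | "p = [3,4,1,2]" | "p = [1,4,2,3]" | "p = [1,3,4,2]" | "p = [3,1,4,2]" | "p = [1,4,3,2]"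
    by (auto simp: group_II_orderings_def)
  thus ?thesis
  proof cases
    case 1
    show ?thesis
    proof (rule main[OF L'(2)])
      fix k h assume "k * (b - d) > 0"
      hence "k < 0" using o by (intro sn[of k "b - d"]) auto
      hence "0 < k * a" "k * b < 0" "k * d < k * b"
        using o by (simp_all add: mult_neg_pos mult_neg_neg mult_less_cancel_left_neg)
      thus "has_ordering (\<lambda>i. if i = 1 then k * d + h else if i = 2 then k * b + h else if i = 3 then k * a + h else h) p"
        unfolding 1 has_ordering_def by simp
    qed
  next
    case 2
    show ?thesis
    proof (rule main[OF L'(1)])
      fix k h assume "k * (d - b) > 0"
      hence "k > 0" using o by (intro sg[of k "d - b"]) auto
      hence "k * a < 0" "0 < k * b" "k * b < k * d"
        using o by (simp_all add: mult_pos_neg mult_less_cancel_left_pos)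
      thus "has_ordering (\<lambda>i. if i = 1 then k * b + h else if i = 2 then k * d + h else if i = 3 then k * a + h else h) p"
        unfolding 2 has_ordering_def by simp
    qed
  next
    case 3
    show ?thesis
    proof (rule main[OF L'(3)])
      fix k h assume "k * (b - a) > 0"
      hence "k > 0" using o by (intro sg[of k "b - a"]) auto
      hence "k * a < 0" "0 < k * b" "k * b < k * d"
        using o by (simp_all add: mult_pos_neg mult_less_cancel_left_pos)
      thus "has_ordering (\<lambda>i. if i = 1 then k * a + h else if i = 2 then k * b + h else if i = 3 then k * d + h else h) p"
        unfolding 3 has_ordering_def by simp
    qed
  next
    case 4
    show ?thesis
    proof (rule main[OF L'(4)])
      fix k h assume "k * (a - d) > 0"
      hence "k < 0" using o by (intro sn[of k "a - d"]) auto
      hence "0 < k * a" "k * b < 0" "k * d < k * b"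
        using o by (simp_all add: mult_neg_pos mult_neg_neg mult_less_cancel_left_neg)
      thus "has_ordering (\<lambda>i. if i = 1 then k * d + h else if i = 2 then k * a + h else if i = 3 then k * b + h else h) p"
        unfolding 4 has_ordering_def by simp
    qed
  next
    case 5
    show ?thesis
    proof (rule main[OF L'(5)])
      fix k h assume "k * (a - b) > 0"
      hence "k < 0" using o by (intro sn[of k "a - b"]) auto
      hence "0 < k * a" "k * b < 0" "k * d < k * b"
        using o by (simp_all add: mult_neg_pos mult_neg_neg mult_less_cancel_left_neg)
      thus "has_ordering (\<lambda>i. if i = 1 then k * b + h else if i = 2 then k * a + h else if i = 3 then k * d + h else h) p"
        unfolding 5 has_ordering_def by simp
    qed
  next
    case 6
    show ?thesis
    proof (rule main[OF L'(6)])
      fix k h assume "k * (d - a) > 0"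
      hence "k > 0" using o by (intro sg[of k "d - a"]) auto
      hence "k * a < 0" "0 < k * b" "k * b < k * d"
        using o by (simp_all add: mult_pos_neg mult_less_cancel_left_pos)
      thus "has_ordering (\<lambda>i. if i = 1 then k * a + h else if i = 2 then k * d + h else if i = 3 then k * b + h else h) p"
        unfolding 6 has_ordering_def by simp
    qed
  qed
qed

subsection \<open>Limits\<close>

definition lam_max :: "real \<Rightarrow> real \<Rightarrow> real" where
  "lam_max m v = sqrt ((mu_max m v)\<^sup>2 - 1)"

definition lam_min :: "real \<Rightarrow> real \<Rightarrow> real" where
  "lam_min m v = sqrt ((mu_min m v)\<^sup>2 - 1)"

lemma mu_limits:
  fixes v :: "real \<Rightarrow> real"
  assumes S: "((\<lambda>m. mu_sum m (v m)) \<longlongrightarrow> s) F" and P: "((\<lambda>m. mu_prod m (v m)) \<longlongrightarrow> p) F"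
  shows "((\<lambda>m. mu_max m (v m)) \<longlongrightarrow> (s + sqrt (s\<^sup>2 - 4 * p)) / 2) F"
    "((\<lambda>m. mu_min m (v m)) \<longlongrightarrow> (s - sqrt (s\<^sup>2 - 4 * p)) / 2) F"
  unfolding mu_max_def mu_min_def mu_disc_def
  by (intro tendsto_intros S P; simp)+

text \<open>As m grows, v tends to 0 while (1 - m) * v keeps a nonzero limit; the limits are
  therefore expressed through the latter.\<close>

lemma mu_sum_prod_limits:
  fixes v :: "real \<Rightarrow> real"
  assumes n: "((\<lambda>m. (1 - m) * v m) \<longlongrightarrow> n) F" and r: "((\<lambda>m. (m + 2) / (m + 3)) \<longlongrightarrow> r) F"
  shows "((\<lambda>m. mu_sum m (v m)) \<longlongrightarrow> 5 - n) F" "((\<lambda>m. mu_prod m (v m)) \<longlongrightarrow> 6 - 3 * r * n) F"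
proof -
  show "((\<lambda>m. mu_sum m (v m)) \<longlongrightarrow> 5 - n) F" unfolding mu_sum_def by (intro tendsto_intros n)
  have "mu_prod m (v m) = 6 - 3 * ((m + 2) / (m + 3)) * ((1 - m) * v m)" for m
    by (simp add: mu_prod_def)
  thus "((\<lambda>m. mu_prod m (v m)) \<longlongrightarrow> 6 - 3 * r * n) F" by (simp only:) (intro tendsto_intros n r)
qed

lemma ratio_at_top: "((\<lambda>m::real. (m + 2) / (m + 3)) \<longlongrightarrow> 1) at_top"
  by real_asymp

lemma lam_I_at_top:
  "((\<lambda>m. lam_max m (v_I m)) \<longlongrightarrow> 2 * sqrt 6) at_top" "((\<lambda>m. lam_min m (v_I m)) \<longlongrightarrow> 2 * sqrt 2) at_top"
proof -
  \<comment> \<open>The limit -3 makes the sum 8 and the product 15, hence the two eigenvalues 5 and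
    3.\<close>
  have "((\<lambda>m. (1 - m) * v_I m) \<longlongrightarrow> - 3) at_top"
    unfolding v_I_def shape_disc_def by real_asymp
  note M = mu_limits[OF mu_sum_prod_limits[OF this ratio_at_top]]
  have v: "sqrt (4::real) = 2" "sqrt (24::real) = 2 * sqrt 6" "sqrt (8::real) = 2 * sqrt 2"
    using real_sqrt_mult[of 4 6] real_sqrt_mult[of 4 2] by simp_all
  have "((\<lambda>m. lam_max m (v_I m)) \<longlongrightarrow> sqrt (((5 - - 3 + sqrt ((5 - - 3)\<^sup>2 - 4 * (6 - 3 * 1 * - 3))) / 2)\<^sup>2 - 1)) at_top"
    unfolding lam_max_def by (intro tendsto_intros M)
  thus "((\<lambda>m. lam_max m (v_I m)) \<longlongrightarrow> 2 * sqrt 6) at_top" by (simp add: v)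
  have "((\<lambda>m. lam_min m (v_I m)) \<longlongrightarrow> sqrt (((5 - - 3 - sqrt ((5 - - 3)\<^sup>2 - 4 * (6 - 3 * 1 * - 3))) / 2)\<^sup>2 - 1)) at_top"
    unfolding lam_min_def by (intro tendsto_intros M)
  thus "((\<lambda>m. lam_min m (v_I m)) \<longlongrightarrow> 2 * sqrt 2) at_top" by (simp add: v)
qed

lemma lam_II_at_top:
  "((\<lambda>m. lam_max m (v_II m)) \<longlongrightarrow> 2 * sqrt 2) at_top" "((\<lambda>m. lam_min m (v_II m)) \<longlongrightarrow> 0) at_top"
proof -
  \<comment> \<open>The limit 1 makes the eigenvalues 3 and 1, and the latter contributes the
    exponent 0.\<close>
  have "((\<lambda>m. (1 - m) * v_II m) \<longlongrightarrow> 1) at_top"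
    unfolding v_II_def shape_disc_def by real_asymp
  note M = mu_limits[OF mu_sum_prod_limits[OF this ratio_at_top]]
  have v: "sqrt (4::real) = 2" "sqrt (8::real) = 2 * sqrt 2"
    using real_sqrt_mult[of 4 2] by simp_all
  have "((\<lambda>m. lam_max m (v_II m)) \<longlongrightarrow> sqrt (((5 - 1 + sqrt ((5 - 1)\<^sup>2 - 4 * (6 - 3 * 1 * 1))) / 2)\<^sup>2 - 1)) at_top"
    unfolding lam_max_def by (intro tendsto_intros M)
  thus "((\<lambda>m. lam_max m (v_II m)) \<longlongrightarrow> 2 * sqrt 2) at_top" by (simp add: v)
  have "((\<lambda>m. lam_min m (v_II m)) \<longlongrightarrow> sqrt (((5 - 1 - sqrt ((5 - 1)\<^sup>2 - 4 * (6 - 3 * 1 * 1))) / 2)\<^sup>2 - 1)) at_top"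
    unfolding lam_min_def by (intro tendsto_intros M)
  thus "((\<lambda>m. lam_min m (v_II m)) \<longlongrightarrow> 0) at_top" by (simp add: v)
qed

lemma tendsto_v_I:
  assumes "(1 - a) * (4 * a + 9) > 0" "shape_disc a \<ge> 0"
  shows "(v_I \<longlongrightarrow> v_I a) (at_right a)"
proof -
  have D: "(shape_disc \<longlongrightarrow> shape_disc a) (at_right a)"
    unfolding shape_disc_def by (intro tendsto_intros)
  have "sqrt (shape_disc a) \<ge> 0" using assms(2) by simp
  hence "(1 - a) * (4 * a + 9) + sqrt (shape_disc a) \<noteq> 0" using assms(1) by linarith
  thus ?thesis unfolding v_I_def by (intro tendsto_intros D)
qed

lemma mu_I_at_right:
  assumes "a > -3" "(1 - a) * (4 * a + 9) > 0" "shape_disc a \<ge> 0"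
  shows "((\<lambda>m. mu_max m (v_I m)) \<longlongrightarrow> mu_max a (v_I a)) (at_right a)"
    "((\<lambda>m. mu_min m (v_I m)) \<longlongrightarrow> mu_min a (v_I a)) (at_right a)"
proof -
  have "((\<lambda>m. (1 - m) * v_I m) \<longlongrightarrow> (1 - a) * v_I a) (at_right a)"
    by (intro tendsto_intros tendsto_v_I assms)
  moreover have "((\<lambda>m. (m + 2) / (m + 3)) \<longlongrightarrow> (a + 2) / (a + 3)) (at_right a)"
    using assms(1) by (intro tendsto_intros) auto
  ultimately have *: "((\<lambda>m. mu_sum m (v_I m)) \<longlongrightarrow> 5 - (1 - a) * v_I a) (at_right a)"
    "((\<lambda>m. mu_prod m (v_I m)) \<longlongrightarrow> 6 - 3 * ((a + 2) / (a + 3)) * ((1 - a) * v_I a)) (at_right a)"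
    by (rule mu_sum_prod_limits)+
  have e: "5 - (1 - a) * v_I a = mu_sum a (v_I a)" "6 - 3 * ((a + 2) / (a + 3)) * ((1 - a) * v_I a) = mu_prod a (v_I a)"
    by (simp_all add: mu_sum_def mu_prod_def)
  from mu_limits[OF *, unfolded e, folded mu_disc_def mu_max_def mu_min_def]
  show "((\<lambda>m. mu_max m (v_I m)) \<longlongrightarrow> mu_max a (v_I a)) (at_right a)"
    "((\<lambda>m. mu_min m (v_I m)) \<longlongrightarrow> mu_min a (v_I a)) (at_right a)" .
qed

lemma mu_I_at_minus_1:
  "((\<lambda>m. mu_max m (v_I m)) \<longlongrightarrow> 1) (at_right (- 1))" "((\<lambda>m. mu_min m (v_I m)) \<longlongrightarrow> 0) (at_right (- 1))"
proof -
  have D: "shape_disc (- 1) = 4" by (simp add: shape_disc_def)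
  hence v: "v_I (- 1) = 2" by (simp add: v_I_def)
  have "mu_sum (- 1) 2 = 1" "mu_prod (- 1) 2 = 0" by (simp_all add: mu_sum_def mu_prod_def)
  hence "mu_max (- 1) 2 = 1" "mu_min (- 1) 2 = 0" by (simp_all add: mu_max_def mu_min_def mu_disc_def)
  thus "((\<lambda>m. mu_max m (v_I m)) \<longlongrightarrow> 1) (at_right (- 1))" "((\<lambda>m. mu_min m (v_I m)) \<longlongrightarrow> 0) (at_right (- 1))"
    using mu_I_at_right[of "- 1"] by (simp_all add: D v)
qed

text \<open>The sum S tends to infinity, so \<open>mu_min\<close> is a difference of two large
  terms. Rewritten as 2 * P / (S + sqrt (S^2 - 4 * P)) it has the limit of P / S, which is 9 /
  5.\<close>

lemma lam_II_at_right:
  "filterlim (\<lambda>m. lam_max m (v_II m)) at_top (at_right (- 1 / 2))"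
  "((\<lambda>m. lam_min m (v_II m)) \<longlongrightarrow> 2 * sqrt 14 / 5) (at_right (- 1 / 2))"
proof -
  let ?F = "at_right (- 1 / 2 :: real)"
  have S: "filterlim (\<lambda>m. mu_sum m (v_II m)) at_top ?F"
    unfolding mu_sum_def v_II_def shape_disc_def by real_asymp
  have PS: "((\<lambda>m. mu_prod m (v_II m) / mu_sum m (v_II m)) \<longlongrightarrow> 9 / 5) ?F"
    unfolding mu_sum_def mu_prod_def v_II_def shape_disc_def by real_asymp
  have ev: "\<forall>\<^sub>F m in ?F. m > - 1 / 2" by (rule eventually_at_right_less)
  have evS: "\<forall>\<^sub>F m in ?F. mu_sum m (v_II m) > 2" using S by (simp add: filterlim_at_top_dense)
  have d: "mu_disc m (v_II m) > 0" if "m > - 1 / 2" for m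
    using root_II_mu_disc_pos root_II_v_II that by simp
  have "filterlim (\<lambda>m. mu_sum m (v_II m) / 2) at_top ?F"
    by (rule filterlim_compose[OF _ S, of "\<lambda>y. y / 2"]) real_asymp
  moreover have "\<forall>\<^sub>F m in ?F. mu_sum m (v_II m) / 2 \<le> mu_max m (v_II m)"
    using ev by eventually_elim (use d in \<open>auto simp: mu_max_def less_imp_le\<close>)
  ultimately have "filterlim (\<lambda>m. mu_max m (v_II m)) at_top ?F"
    by (rule filterlim_at_top_mono)
  moreover have "filterlim (\<lambda>y::real. sqrt (y\<^sup>2 - 1)) at_top at_top" by real_asymp
  ultimately show "filterlim (\<lambda>m. lam_max m (v_II m)) at_top ?F"
    unfolding lam_max_def by (rule filterlim_compose[rotated])
  have S0: "((\<lambda>m. 1 / mu_sum m (v_II m)) \<longlongrightarrow> 0) ?F"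
    using S by (intro tendsto_divide_0[OF tendsto_const] filterlim_at_top_imp_at_infinity)
  have "((\<lambda>m. 2 * (mu_prod m (v_II m) / mu_sum m (v_II m)) /
      (1 + sqrt (1 - 4 * (mu_prod m (v_II m) / mu_sum m (v_II m)) * (1 / mu_sum m (v_II m))))) \<longlongrightarrow>
      2 * (9 / 5) / (1 + sqrt (1 - 4 * (9 / 5) * 0))) ?F"
    by (intro tendsto_intros PS S0) simp
  hence "((\<lambda>m. 2 * (mu_prod m (v_II m) / mu_sum m (v_II m)) /
      (1 + sqrt (1 - 4 * (mu_prod m (v_II m) / mu_sum m (v_II m)) * (1 / mu_sum m (v_II m))))) \<longlongrightarrow> 9 / 5) ?F" by simp
  moreover have "\<forall>\<^sub>F m in ?F. 2 * (mu_prod m (v_II m) / mu_sum m (v_II m)) /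
      (1 + sqrt (1 - 4 * (mu_prod m (v_II m) / mu_sum m (v_II m)) * (1 / mu_sum m (v_II m)))) = mu_min m (v_II m)"
    using ev evS
  proof eventually_elim
    case (elim m)
    define S P where "S = mu_sum m (v_II m)" and "P = mu_prod m (v_II m)"
    have S: "S > 2" using elim by (simp add: S_def)
    have D: "S\<^sup>2 - 4 * P > 0" using d[OF elim(1)] by (simp add: mu_disc_def S_def P_def)
    define R where "R = sqrt (S\<^sup>2 - 4 * P)"
    have R: "R\<^sup>2 = S\<^sup>2 - 4 * P" "R > 0" using D by (simp_all add: R_def)
    have "1 - 4 * (P / S) * (1 / S) = (S\<^sup>2 - 4 * P) / S\<^sup>2" using S by (simp add: power2_eq_square field_simps)
    hence "sqrt (1 - 4 * (P / S) * (1 / S)) = R / S" using S by (simp add: real_sqrt_divide R_def)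
    hence "2 * (P / S) / (1 + sqrt (1 - 4 * (P / S) * (1 / S))) = 2 * P / (S + R)"
      using S R by (simp add: field_simps)
    also have "2 * P = (S - R) * (S + R) / 2" using R(1) by (simp add: algebra_simps power2_eq_square)
    also have "(S - R) * (S + R) / 2 / (S + R) = (S - R) / 2"
    proof -
      define T where "T = S + R"
      have "T \<noteq> 0" using S R by (simp add: T_def)
      thus ?thesis unfolding T_def[symmetric] by simp
    qed
    also have "\<dots> = mu_min m (v_II m)" by (simp add: mu_min_def mu_disc_def R_def S_def P_def)
    finally show ?case by (simp add: S_def P_def)
  qed
  ultimately have M: "((\<lambda>m. mu_min m (v_II m)) \<longlongrightarrow> 9 / 5) ?F" by (rule Lim_transform_eventually)
  have "((\<lambda>m. lam_min m (v_II m)) \<longlongrightarrow> sqrt ((9 / 5)\<^sup>2 - 1)) ?F"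
    unfolding lam_min_def by (intro tendsto_intros M)
  also have "sqrt ((9 / 5)\<^sup>2 - 1) = 2 * sqrt 14 / (5::real)"
    using real_sqrt_mult[of 4 14] by (simp add: power_divide real_sqrt_divide)
  finally show "((\<lambda>m. lam_min m (v_II m)) \<longlongrightarrow> 2 * sqrt 14 / 5) ?F" .
qed

subsection \<open>The theorem\<close>

theorem theorem3p9:
  shows "\<exists>m_star m_c :: real.
    m_star < m_c \<and> {m. - 1 < m \<and> m < 0 \<and> \<Psi> m = 0} = {m_star, m_c} \<and>
    \<bar>m_star - (- 0.8564136)\<bar> < 0.00000005 \<and> \<bar>m_c - (- 0.0175413)\<bar> < 0.00000005 \<and>
    \<comment> \<open>(i)\<close>
    (\<forall>m \<omega> x. group_I_solution m \<omega> x \<longrightarrow>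
       (- 1 < m \<and> m < m_star \<longrightarrow> linearly_stable m \<omega> x) \<and>
       (m = m_star \<longrightarrow> spectrally_stable m \<omega> x) \<and>
       (m_star < m \<longrightarrow> unstable m \<omega> x)) \<and>
    \<comment> \<open>(ii)\<close>
    (\<exists>(l1 :: real \<Rightarrow> real) (l2 :: real \<Rightarrow> real) (lc :: real).
       (\<forall>m \<omega> x. m_c < m \<and> group_I_solution m \<omega> x \<longrightarrow>
          0 < l2 m \<and> l2 m < l1 m \<and>
          nontrivial_eigenvalues m \<omega> x = real_pairs (l1 m) (l2 m)) \<and>
       0 < lc \<and>
       (\<forall>\<omega> x. group_I_solution m_c \<omega> x \<longrightarrow>
          nontrivial_eigenvalues m_c \<omega> x = real_pairs lc lc) \<and>
       (l1 \<longlongrightarrow> lc) (at_right m_c) \<and> (l2 \<longlongrightarrow> lc) (at_right m_c) \<and>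
       (l1 \<longlongrightarrow> 2 * sqrt 6) at_top \<and> (l2 \<longlongrightarrow> 2 * sqrt 2) at_top) \<and>
    (\<forall>m \<omega> x. m_star < m \<and> m < m_c \<and> group_I_solution m \<omega> x \<longrightarrow>
       (\<exists>\<alpha> \<beta> :: real. \<alpha> \<noteq> 0 \<and> \<beta> \<noteq> 0 \<and>
          nontrivial_eigenvalues m \<omega> x =
            {#Complex \<alpha> \<beta>, Complex \<alpha> (- \<beta>), Complex (- \<alpha>) \<beta>, Complex (- \<alpha>) (- \<beta>)#})) \<and>
    (\<exists>e1 e2 e3 e4 :: real \<Rightarrow> complex.
       (\<forall>m \<omega> x. - 1 < m \<and> m < m_star \<and> group_I_solution m \<omega> x \<longrightarrow>
          nontrivial_eigenvalues m \<omega> x = {#e1 m, e2 m, e3 m, e4 m#}) \<and>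
       (e1 \<longlongrightarrow> 0) (at_right (- 1)) \<and> (e2 \<longlongrightarrow> 0) (at_right (- 1)) \<and>
       (e3 \<longlongrightarrow> \<i>) (at_right (- 1)) \<and> (e4 \<longlongrightarrow> - \<i>) (at_right (- 1))) \<and>
    \<comment> \<open>(iii)\<close>
    (\<forall>m > - 1 / 2. \<forall>p \<in> group_II_orderings. \<exists>\<omega> x. collinear_re m \<omega> x \<and> has_ordering x p) \<and>
    (\<exists>(l1 :: real \<Rightarrow> real) (l2 :: real \<Rightarrow> real).
       (\<forall>m \<omega> x. - 1 / 2 < m \<and> group_II_solution m \<omega> x \<longrightarrow>
          unstable m \<omega> x \<and> 0 < l2 m \<and> l2 m < l1 m \<and>
          nontrivial_eigenvalues m \<omega> x = real_pairs (l1 m) (l2 m)) \<and>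
       filterlim l1 at_top (at_right (- 1 / 2)) \<and>
       (l2 \<longlongrightarrow> 2 * sqrt 14 / 5) (at_right (- 1 / 2)) \<and>
       (l1 \<longlongrightarrow> 2 * sqrt 2) at_top \<and> (l2 \<longlongrightarrow> 0) at_top)"
proof -
  obtain m_star m_c where b: "- 85641365 / 100000000 < m_star" "m_star < - 85641355 / 100000000"
    "- 1754135 / 100000000 < m_c" "m_c < - 1754125 / 100000000" and \<Psi>: "\<Psi> m_star = 0" "\<Psi> m_c = 0"
    and left: "\<And>m. -1 < m \<Longrightarrow> m < m_star \<Longrightarrow> \<Psi> m > 0"
    and mid: "\<And>m. m_star < m \<Longrightarrow> m < m_c \<Longrightarrow> \<Psi> m < 0"
    and right: "\<And>m. m_c < m \<Longrightarrow> m \<le> 0 \<Longrightarrow> \<Psi> m > 0"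
    by (rule Psi_roots) (rule that)
  \<comment> \<open>The bound -4/5 gives access to \<open>root_I_mu_sum_lt_2\<close>, the bound -1/2
    to \<open>root_I_v_I\<close> at \<open>m_c\<close>.\<close>
  have ord: "-1 < m_star" "m_star < m_c" "m_c < 0" "m_star < - 4 / 5" "m_c > - 1 / 2" using b by auto
  have roots: "{m. - 1 < m \<and> m < 0 \<and> \<Psi> m = 0} = {m_star, m_c}"
  proof (intro equalityI subsetI)
    fix m assume "m \<in> {m. - 1 < m \<and> m < 0 \<and> \<Psi> m = 0}"
    hence m: "- 1 < m" "m < 0" "\<Psi> m = 0" by simp_all
    have "\<not> m < m_star" using left[OF m(1)] m(3) by auto
    moreover have "\<not> (m_star < m \<and> m < m_c)" using mid[of m] m(3) by auto
    moreover have "\<not> m_c < m" using right[OF _ less_imp_le[OF m(2)]] m(3) by auto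
    ultimately show "m \<in> {m_star, m_c}" by auto
  next
    fix m assume "m \<in> {m_star, m_c}"
    hence "m = m_star \<or> m = m_c" by simp
    thus "m \<in> {m. - 1 < m \<and> m < 0 \<and> \<Psi> m = 0}"
    proof
      assume "m = m_star" thus ?thesis using ord(1-3) \<Psi>(1) by simp
    next
      assume "m = m_c" thus ?thesis using ord(1-3) \<Psi>(2) by simp
    qed
  qed
  \<comment> \<open>For m > 0 the discriminant is positive for every v; \<Psi> is consulted only for
    m <= 0.\<close>
  have disc_pos: "mu_disc m v > 0" if m: "m > -1" and v: "root_I m v" and s: "m < m_star \<or> m_c < m" for m v
  proof (cases "m > 0")
    case False
    hence m0: "m \<le> 0" by simp
    have "\<Psi> m > 0" using s
    proof
      assume "m < m_star" thus ?thesis by (rule left[OF m])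
    next
      assume "m_c < m" thus ?thesis by (rule right[OF _ m0])
    qed
    thus ?thesis using root_I_mu_disc_sgn[OF m m0 v] by (metis sgn_greater)
  qed (rule mu_disc_pos_if_m_pos)
  have disc_0: "mu_disc m v = 0" if m: "m = m_star \<or> m = m_c" and v: "root_I m v" for m v
  proof -
    have "m > -1" "m \<le> 0" "\<Psi> m = 0" using m ord(1-3) \<Psi> by (elim disjE; simp)+
    thus ?thesis using root_I_mu_disc_sgn[OF _ _ v] by (metis sgn_0_0)
  qed
  have disc_neg: "mu_disc m v < 0" if m: "m_star < m" "m < m_c" and v: "root_I m v" for m v
  proof -
    have "m > -1" "m \<le> 0" using m ord(1-3) by simp_all
    from root_I_mu_disc_sgn[OF this v] show ?thesis using mid[OF m] by (metis sgn_less)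
  qed
  note bounds_I = mu_bounds[OF _ root_I_critical]
  \<comment> \<open>Includes m = \<open>m_c\<close>, where the discriminant vanishes and the two
    pairs coincide.\<close>
  have pairs_I: "nontrivial_eigenvalues m \<omega> x = real_pairs (lam_max m (v_I m)) (lam_min m (v_I m))"
    "0 < lam_min m (v_I m)" "m_c < m \<Longrightarrow> lam_min m (v_I m) < lam_max m (v_I m)"
    if m: "m_c \<le> m" and g: "group_I_solution m \<omega> x" for m \<omega> x
  proof -
    have m1: "m > -1" "m > -3/4" using m ord by auto
    obtain v where v: "root_I m v" and cf: "char_factor m \<omega> x v" using group_I_root[OF g m1(1)] .
    have d: "mu_disc m v \<ge> 0" using disc_pos[OF m1(1) v] disc_0[OF _ v] m by (cases "m = m_c") auto
    note E = eigenvalues_real_pairs[OF cf d root_I_mu_sum_gt_2[OF m1(2) v] bounds_I(1)[OF m1(1) m1(1) v],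
      folded lam_max_def lam_min_def, unfolded root_I_eq_v_I[OF m1(1) v]]
    show "nontrivial_eigenvalues m \<omega> x = real_pairs (lam_max m (v_I m)) (lam_min m (v_I m))"
      "0 < lam_min m (v_I m)" by (rule E)+
    show "lam_min m (v_I m) < lam_max m (v_I m)" if "m_c < m"
    proof -
      have "mu_disc m v > 0" using that by (intro disc_pos[OF m1(1) v]) simp
      thus ?thesis using E(3) unfolding root_I_eq_v_I[OF m1(1) v, symmetric] by simp
    qed
  qed
  have quartuplet: "\<exists>\<alpha> \<beta> :: real. \<alpha> \<noteq> 0 \<and> \<beta> \<noteq> 0 \<and> nontrivial_eigenvalues m \<omega> x =
      {#Complex \<alpha> \<beta>, Complex \<alpha> (- \<beta>), Complex (- \<alpha>) \<beta>, Complex (- \<alpha>) (- \<beta>)#}"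
    if m: "m_star < m" "m < m_c" and g: "group_I_solution m \<omega> x" for m \<omega> x
  proof -
    have m1: "m > -1" using m ord by auto
    obtain v where v: "root_I m v" and cf: "char_factor m \<omega> x v" using group_I_root[OF g m1] .
    have "mu_sum m v > 0" using bounds_I(3)[OF m1 m1 v] by simp
    from eigenvalues_quartuplet[OF cf disc_neg[OF m v] this] show ?thesis by metis
  qed
  have imag: "nontrivial_eigenvalues m \<omega> x = {#\<i> * sqrt (1 - (mu_max m (v_I m))\<^sup>2), - (\<i> * sqrt (1 - (mu_max m (v_I m))\<^sup>2)),
        \<i> * sqrt (1 - (mu_min m (v_I m))\<^sup>2), - (\<i> * sqrt (1 - (mu_min m (v_I m))\<^sup>2))#}"
    "spectrally_stable m \<omega> x" "m < m_star \<Longrightarrow> linearly_stable m \<omega> x"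
    if m: "-1 < m" "m \<le> m_star" and g: "group_I_solution m \<omega> x" for m \<omega> x
  proof -
    obtain v where v: "root_I m v" and cf: "char_factor m \<omega> x v" using group_I_root[OF g m(1)] .
    have d: "mu_disc m v \<ge> 0" using disc_pos[OF m(1) v] disc_0[OF _ v] m by (cases "m = m_star") auto
    note B = bounds_I[OF m(1) m(1) v]
    have s: "0 < mu_sum m v" "mu_sum m v < 2" using B(3) root_I_mu_sum_lt_2[OF m(1) _ v] m ord by auto
    note E = eigenvalues_imaginary[OF cf d s B(1,2)]
    show "nontrivial_eigenvalues m \<omega> x = {#\<i> * sqrt (1 - (mu_max m (v_I m))\<^sup>2), - (\<i> * sqrt (1 - (mu_max m (v_I m))\<^sup>2)),
        \<i> * sqrt (1 - (mu_min m (v_I m))\<^sup>2), - (\<i> * sqrt (1 - (mu_min m (v_I m))\<^sup>2))#}"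
      using E(1) unfolding root_I_eq_v_I[OF m(1) v] .
    show st: "spectrally_stable m \<omega> x"
    proof -
      have "(\<forall>\<mu>\<in>#{#\<i> * complex_of_real l1, - (\<i> * l1), \<i> * l2, - (\<i> * l2)#}. \<mu> \<noteq> 0) \<and>
          (\<forall>\<mu>\<in>#{#\<i> * complex_of_real l1, - (\<i> * l1), \<i> * l2, - (\<i> * l2)#}. Re \<mu> = 0)"
        if "0 < l1" "0 < l2" for l1 l2 :: real
        using that by simp
      from this[OF E(2,3)] show ?thesis unfolding spectrally_stable_def nondegenerate_def E(1) .
    qed
    show "linearly_stable m \<omega> x" if "m < m_star"
    proof (rule linearly_stableI[OF _ m(1) cf _ s B(1,2) st])
      show "collinear_re m \<omega> x" using g by (simp add: group_I_solution_def)
      show "mu_disc m v > 0" using that by (intro disc_pos[OF m(1) v]) simp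
    qed
  qed
  have pairs_unstable: "unstable m \<omega> x" if "nontrivial_eigenvalues m \<omega> x = real_pairs l1 l2" "0 < l2" for m \<omega> x l1 l2
    unfolding unstable_def that(1) real_pairs_def using that(2) by (intro bexI[of _ "complex_of_real l2"]) auto
  have unst: "unstable m \<omega> x" if m: "m_star < m" and g: "group_I_solution m \<omega> x" for m \<omega> x
  proof (cases "m < m_c")
    case True
    from quartuplet[OF m this g] obtain \<alpha> \<beta> :: real where "\<alpha> \<noteq> 0" "nontrivial_eigenvalues m \<omega> x =
      {#Complex \<alpha> \<beta>, Complex \<alpha> (- \<beta>), Complex (- \<alpha>) \<beta>, Complex (- \<alpha>) (- \<beta>)#}" by blast
    thus ?thesis unfolding unstable_def by auto
  next
    case False
    hence "m_c \<le> m" by simp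
    from pairs_unstable[OF pairs_I(1,2)[OF this g]] show ?thesis .
  qed
  have stab: "\<forall>m \<omega> x. group_I_solution m \<omega> x \<longrightarrow>
       (- 1 < m \<and> m < m_star \<longrightarrow> linearly_stable m \<omega> x) \<and>
       (m = m_star \<longrightarrow> spectrally_stable m \<omega> x) \<and>
       (m_star < m \<longrightarrow> unstable m \<omega> x)"
  proof (intro allI impI conjI)
    fix m \<omega> x assume g: "group_I_solution m \<omega> x"
    show "linearly_stable m \<omega> x" if "- 1 < m \<and> m < m_star"
      using that by (intro imag(3)[OF _ _ g]) auto
    show "spectrally_stable m \<omega> x" if "m = m_star"
      using that ord(1) by (intro imag(2)[OF _ _ g]) auto
    show "unstable m \<omega> x" if "m_star < m" by (rule unst[OF that g])
  qed
  \<comment> \<open>The positivity of \<open>lc\<close> is asserted outright, so these facts come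
    from the explicit root \<open>v_I m_c\<close> and not from a solution at
    \<open>m_c\<close>.\<close>
  have d_mc: "mu_disc m_c (v_I m_c) = 0" and s_mc: "mu_sum m_c (v_I m_c) > 2"
    and p_mc: "1 - mu_sum m_c (v_I m_c) + mu_prod m_c (v_I m_c) > 0"
  proof -
    have r: "root_I m_c (v_I m_c)" using ord by (intro root_I_v_I) auto
    have m1: "m_c > -1" "m_c > -3/4" using ord by auto
    show "mu_disc m_c (v_I m_c) = 0" "mu_sum m_c (v_I m_c) > 2" "1 - mu_sum m_c (v_I m_c) + mu_prod m_c (v_I m_c) > 0"
      using disc_0[OF _ r] root_I_mu_sum_gt_2[OF m1(2) r] bounds_I(1)[OF m1(1) m1(1) r] by auto
  qed
  define lc where "lc = lam_min m_c (v_I m_c)"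
  have lc_max: "lam_max m_c (v_I m_c) = lc"
    by (simp add: lc_def lam_max_def lam_min_def mu_max_def mu_min_def d_mc)
  have lc: "0 < lc"
  proof -
    have "1 < mu_min m_c (v_I m_c)" using mu_gt_1[OF _ s_mc p_mc] d_mc by simp
    thus ?thesis unfolding lc_def lam_min_def by (simp add: one_less_power)
  qed
  have cond: "(1 - m_c) * (4 * m_c + 9) > 0" "shape_disc m_c \<ge> 0" "m_c > -3"
  proof -
    show "(1 - m_c) * (4 * m_c + 9) > 0" "m_c > -3" using ord by auto
    have "(m_c + 2) * (m_c + 3)\<^sup>2 * (1 + 2 * m_c) \<ge> 0" using ord by (intro mult_nonneg_nonneg) auto
    moreover have "shape_disc m_c = ((1 - m_c) * (4 * m_c + 9))\<^sup>2 + 24 * ((m_c + 2) * (m_c + 3)\<^sup>2 * (1 + 2 * m_c))"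
      unfolding shape_disc_def by (simp only: mult.assoc)
    ultimately show "shape_disc m_c \<ge> 0" by (simp only: add_nonneg_nonneg zero_le_power2 mult_nonneg_nonneg zero_le_numeral)
  qed
  have lim_c: "((\<lambda>m. lam_max m (v_I m)) \<longlongrightarrow> lc) (at_right m_c)" "((\<lambda>m. lam_min m (v_I m)) \<longlongrightarrow> lc) (at_right m_c)"
  proof -
    note M = mu_I_at_right[OF cond(3,1,2)]
    have "((\<lambda>m. lam_max m (v_I m)) \<longlongrightarrow> lam_max m_c (v_I m_c)) (at_right m_c)"
      unfolding lam_max_def by (intro tendsto_intros M)
    thus "((\<lambda>m. lam_max m (v_I m)) \<longlongrightarrow> lc) (at_right m_c)" by (simp only: lc_max)
    show "((\<lambda>m. lam_min m (v_I m)) \<longlongrightarrow> lc) (at_right m_c)"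
      unfolding lc_def lam_min_def by (intro tendsto_intros M)
  qed
  have part_ii: "\<exists>(l1 :: real \<Rightarrow> real) (l2 :: real \<Rightarrow> real) (lc :: real).
       (\<forall>m \<omega> x. m_c < m \<and> group_I_solution m \<omega> x \<longrightarrow>
          0 < l2 m \<and> l2 m < l1 m \<and>
          nontrivial_eigenvalues m \<omega> x = real_pairs (l1 m) (l2 m)) \<and>
       0 < lc \<and>
       (\<forall>\<omega> x. group_I_solution m_c \<omega> x \<longrightarrow>
          nontrivial_eigenvalues m_c \<omega> x = real_pairs lc lc) \<and>
       (l1 \<longlongrightarrow> lc) (at_right m_c) \<and> (l2 \<longlongrightarrow> lc) (at_right m_c) \<and>
       (l1 \<longlongrightarrow> 2 * sqrt 6) at_top \<and> (l2 \<longlongrightarrow> 2 * sqrt 2) at_top"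
  proof (intro exI conjI)
    show "\<forall>m \<omega> x. m_c < m \<and> group_I_solution m \<omega> x \<longrightarrow>
          0 < lam_min m (v_I m) \<and> lam_min m (v_I m) < lam_max m (v_I m) \<and>
          nontrivial_eigenvalues m \<omega> x = real_pairs (lam_max m (v_I m)) (lam_min m (v_I m))"
    proof (intro allI impI, elim conjE)
      fix m \<omega> x assume m: "m_c < m" and g: "group_I_solution m \<omega> x"
      show "0 < lam_min m (v_I m) \<and> lam_min m (v_I m) < lam_max m (v_I m) \<and>
          nontrivial_eigenvalues m \<omega> x = real_pairs (lam_max m (v_I m)) (lam_min m (v_I m))"
        using pairs_I[OF less_imp_le[OF m] g] m by simp
    qed
    show "\<forall>\<omega> x. group_I_solution m_c \<omega> x \<longrightarrow> nontrivial_eigenvalues m_c \<omega> x = real_pairs lc lc"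
      using pairs_I(1)[of m_c] unfolding lc_max lc_def[symmetric] by blast
  qed (rule lc lim_c lam_I_at_top)+
  have part_ii': "\<exists>e1 e2 e3 e4 :: real \<Rightarrow> complex.
       (\<forall>m \<omega> x. - 1 < m \<and> m < m_star \<and> group_I_solution m \<omega> x \<longrightarrow>
          nontrivial_eigenvalues m \<omega> x = {#e1 m, e2 m, e3 m, e4 m#}) \<and>
       (e1 \<longlongrightarrow> 0) (at_right (- 1)) \<and> (e2 \<longlongrightarrow> 0) (at_right (- 1)) \<and>
       (e3 \<longlongrightarrow> \<i>) (at_right (- 1)) \<and> (e4 \<longlongrightarrow> - \<i>) (at_right (- 1))"
  proof (intro exI conjI)
    show "\<forall>m \<omega> x. - 1 < m \<and> m < m_star \<and> group_I_solution m \<omega> x \<longrightarrow> nontrivial_eigenvalues m \<omega> x =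
       {#\<i> * sqrt (1 - (mu_max m (v_I m))\<^sup>2), - (\<i> * sqrt (1 - (mu_max m (v_I m))\<^sup>2)),
        \<i> * sqrt (1 - (mu_min m (v_I m))\<^sup>2), - (\<i> * sqrt (1 - (mu_min m (v_I m))\<^sup>2))#}"
    proof (intro allI impI, elim conjE)
      fix m \<omega> x assume m: "- 1 < m" "m < m_star" and g: "group_I_solution m \<omega> x"
      from imag(1)[OF m(1) less_imp_le[OF m(2)] g] show "nontrivial_eigenvalues m \<omega> x =
       {#\<i> * sqrt (1 - (mu_max m (v_I m))\<^sup>2), - (\<i> * sqrt (1 - (mu_max m (v_I m))\<^sup>2)),
        \<i> * sqrt (1 - (mu_min m (v_I m))\<^sup>2), - (\<i> * sqrt (1 - (mu_min m (v_I m))\<^sup>2))#}" .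
    qed
    \<comment> \<open>The pair from \<open>mu_max\<close> collapses to 0, while the pair from
      \<open>mu_min\<close> tends to i and -i.\<close>
    have L: "((\<lambda>m. \<i> * complex_of_real (sqrt (1 - (mu_max m (v_I m))\<^sup>2))) \<longlongrightarrow> \<i> * complex_of_real (sqrt (1 - 1\<^sup>2))) (at_right (- 1))"
      "((\<lambda>m. \<i> * complex_of_real (sqrt (1 - (mu_min m (v_I m))\<^sup>2))) \<longlongrightarrow> \<i> * complex_of_real (sqrt (1 - 0\<^sup>2))) (at_right (- 1))"
      by (intro tendsto_intros mu_I_at_minus_1)+
    show "((\<lambda>m. \<i> * complex_of_real (sqrt (1 - (mu_max m (v_I m))\<^sup>2))) \<longlongrightarrow> 0) (at_right (- 1))"
      "((\<lambda>m. - (\<i> * complex_of_real (sqrt (1 - (mu_max m (v_I m))\<^sup>2)))) \<longlongrightarrow> 0) (at_right (- 1))"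
      "((\<lambda>m. \<i> * complex_of_real (sqrt (1 - (mu_min m (v_I m))\<^sup>2))) \<longlongrightarrow> \<i>) (at_right (- 1))"
      "((\<lambda>m. - (\<i> * complex_of_real (sqrt (1 - (mu_min m (v_I m))\<^sup>2)))) \<longlongrightarrow> - \<i>) (at_right (- 1))"
      using L tendsto_minus[OF L(1)] tendsto_minus[OF L(2)] by simp_all
  qed
  have part_iii: "\<exists>(l1 :: real \<Rightarrow> real) (l2 :: real \<Rightarrow> real).
       (\<forall>m \<omega> x. - 1 / 2 < m \<and> group_II_solution m \<omega> x \<longrightarrow>
          unstable m \<omega> x \<and> 0 < l2 m \<and> l2 m < l1 m \<and>
          nontrivial_eigenvalues m \<omega> x = real_pairs (l1 m) (l2 m)) \<and>
       filterlim l1 at_top (at_right (- 1 / 2)) \<and>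
       (l2 \<longlongrightarrow> 2 * sqrt 14 / 5) (at_right (- 1 / 2)) \<and>
       (l1 \<longlongrightarrow> 2 * sqrt 2) at_top \<and> (l2 \<longlongrightarrow> 0) at_top"
  proof (intro exI conjI)
    have *: "unstable m \<omega> x \<and> 0 < lam_min m (v_II m) \<and> lam_min m (v_II m) < lam_max m (v_II m) \<and>
          nontrivial_eigenvalues m \<omega> x = real_pairs (lam_max m (v_II m)) (lam_min m (v_II m))"
      if m: "- 1 / 2 < m" and g: "group_II_solution m \<omega> x" for m \<omega> x
    proof -
      obtain v where v: "root_II m v" and cf: "char_factor m \<omega> x v" using group_II_root[OF g m] .
      have d: "mu_disc m v > 0" by (rule root_II_mu_disc_pos[OF m v])
      have m1: "m > -1" using m by simp
      note E = eigenvalues_real_pairs[OF cf less_imp_le[OF d] root_II_mu_sum_gt_2[OF m v]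
          mu_bounds(1)[OF m1 root_II_critical[OF m v]], folded lam_max_def lam_min_def]
      show ?thesis using pairs_unstable[OF E(1,2)] E d unfolding root_II_eq_v_II[OF m v] by blast
    qed
    show "\<forall>m \<omega> x. - 1 / 2 < m \<and> group_II_solution m \<omega> x \<longrightarrow>
          unstable m \<omega> x \<and> 0 < lam_min m (v_II m) \<and> lam_min m (v_II m) < lam_max m (v_II m) \<and>
          nontrivial_eigenvalues m \<omega> x = real_pairs (lam_max m (v_II m)) (lam_min m (v_II m))"
      using * by blast
  qed (rule lam_II_at_right lam_II_at_top)+
  have near: "\<bar>m_star - (- 0.8564136)\<bar> < 0.00000005" "\<bar>m_c - (- 0.0175413)\<bar> < 0.00000005"
  proof -
    have p: "(10::real) ^ 7 = 10000000" "(10::real) ^ 8 = 100000000" by simp_all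
    show "\<bar>m_star - (- 0.8564136)\<bar> < 0.00000005" unfolding abs_less_iff p using b by (intro conjI; linarith)
    show "\<bar>m_c - (- 0.0175413)\<bar> < 0.00000005" unfolding abs_less_iff p using b by (intro conjI; linarith)
  qed
  have exists_II: "\<forall>m > - 1 / 2. \<forall>p \<in> group_II_orderings. \<exists>\<omega> x. collinear_re m \<omega> x \<and> has_ordering x p"
    using group_II_exists by blast
  have quartuplet': "\<forall>m \<omega> x. m_star < m \<and> m < m_c \<and> group_I_solution m \<omega> x \<longrightarrow>
       (\<exists>\<alpha> \<beta> :: real. \<alpha> \<noteq> 0 \<and> \<beta> \<noteq> 0 \<and>
          nontrivial_eigenvalues m \<omega> x =
            {#Complex \<alpha> \<beta>, Complex \<alpha> (- \<beta>), Complex (- \<alpha>) \<beta>, Complex (- \<alpha>) (- \<beta>)#})"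
    by (intro allI impI, elim conjE) (rule quartuplet)
  show ?thesis
    by (intro exI[of _ m_star] exI[of _ m_c] conjI)
      (fact ord(2) roots near stab part_ii quartuplet' part_ii' exists_II part_iii)+
qed

end
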